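(* Suppose that Assumptions 1, 2 and 3 (listed in the context) hold and that $\lambda\ge\mu$. Let $\psi(t)=Q(0)+(\lambda-\mu)t$ and let $$\eta(t)=\sup_{s\in[0,t]}(\psi(s)-H(0,s))^+,\qquad \phi(t)=\psi(t)-\eta(t),\qquad t\ge 0 .$$ Then $\left(\frac1N Q^N,\frac1N R^N\right)\Rightarrow(\phi,\eta)$ as $N\to\infty$.
   Context: Notation. $\mathbb R_+=[0,\infty)$, $x^+=x\vee 0$, $\mathbb I_A$ is the indicator of $A$. $\mathcal M$ is the space of finite nonnegative Borel measures on $\mathbb R_+$ with the weak topology. $D_{\mathcal S}(\mathbb R_+)$ is the space of right-continuous functions with left limits (RCLL) $\mathbb R_+\to\mathcal S$ with the Skorohod $J_1$ topology; processes are viewed as random elements of such spaces, and $\Rightarrow$ is convergence in distribution. All random variables live on a common probability space. Model. For each $N\in\mathbb N$ there is a single server with an infinite buffer. Parameters $\lambda^N,\mu^N>0$ are given. The arrival process is $E^N(t)=E^0(\lambda^Nt)$, where $E^0$ is a renewal process with mean inter-renewal time $1$; $a_i^N$ ($i=1,2,\dots$) is the arrival time of the $i$-th customer. $S^N(t)=S^0(\mu^Nt)$ is the number of jobs completed by the time the server has been busy for $t$ units of time, where $S^0$ is a renewal process with mean inter-renewal time $1$. $X^N(t)$ and $Q^N(t)$ are the numbers of customers at time $t$ in the system and in the queue (not including service). Customers in the system at time $0$ are indexed by $i=-X^N(0)+1,\dots,0$ (with arrival times $a^N_i\le0$). Customer $i$ has an initial lead time $u_i^N>0$ and lead time process $L_i^N(t)=u_i^N+a_i^N-t$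 (so $L_i^N(t)=L_i^N(0)-t$ for $i\le 0$). The $u_i^N$ of incoming customers are positive i.i.d. with law $\nu^N$ and cumulative distribution function $G^N$. The sequence of initial lead times, the arrival process and the service requirements are mutually independent. An arriving customer starts service immediately if the server is idle, otherwise joins the queue. A customer in the queue reneges (leaves) once his lead time becomes $\le 0$; customers in service do not renege, so customers in the queue have positive lead times. Service is non-idling and non-preemptive; when the server completes a job and the queue is nonempty, it takes the customer in the queue with smallest lead time (non-preemptive earliest-deadline-first). $R^N(t)$ is the number of customers that reneged in $[0,t]$, with $R^N(0)=0$. With $D^N(t)=S^N\big(\int_0^t\mathbb I_{\{X^N(s)>0\}}ds\big)$ the number of service completions by time $t$, $$X^N(t)=X^N(0)+E^N(t)-D^N(t)-R^N(t),\qquad Q^N(t)=(X^N(t)-1)^+ .$$ Queue measure: for Borel $B\subset(0,\infty)$, $\mathcal Q^N_t(B)$ is the number of customers in the queue at time $t$ whose lead time at time $t$ lies in $B$ (extended by zero outside $(0,\infty)$). $F^N(0)$ is the lead time of the customer at the head of the queue (smallest lead time) at time $0$, or $0$ if the queue is empty. Assumption 1. As $N\to\infty$: (i) $\lambda^N/N\to\lambda>0$; (ii) $\mu^N/N\to\mu>0$; (iii) $u_1^N$ converges in distribution to a random variable $u$ with law $\nu$ and cumulative distribution function $G$; $G$ is strictly increasing in $(0,y_{\max})$, where $y_{\max}=\inf\{x:G(x)=1\}$, and $G$ is continuous at $0$ with $G(0)=0$. Let $y^*=\sup\{y<y_{\max}:\lambda G(y)<\mu\}$. Assumption 2. If $\lambda>\mu$,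 $G$ is continuous at $y^*$. Assumption 3. There is a pair $(\mathcal Q_0,F(0))\in\mathcal M\times[0,y^*]$ such that: (i) $\mathcal Q_0([0,F(0)])=0$ and $G_0(x)=\mathcal Q_0([0,x])$ is a continuous cumulative distribution function; (ii) $\mathcal Q_0([0,x])>0$ for all $x>F(0)$; (iii) $(\frac1N\mathcal Q_0^N,F^N(0))\Rightarrow(\mathcal Q_0,F(0))$ as $N\to\infty$. Set $Q(0)=\mathcal Q_0(\mathbb R_+)$, $\overline G=1-G$, $\overline G_0(x)=\mathcal Q_0((x,\infty))$ and $$H(x,t)=\overline G_0(x+t)+\lambda\int_0^t\overline G(x+t-s)\,ds,\qquad x,t\ge0 .$$ *)

theory Defs
  imports "HOL-Probability.Probability"
begin

section \<open>Convergence in distribution\<close>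

definition borel_of :: "'a topology \<Rightarrow> 'a measure" where
  "borel_of T = sigma (topspace T) {U. openin T U}"

text \<open>Sequences are indexed by \<open>N = 1, 2, \<dots>\<close>; the entry at \<open>N = 0\<close> is never looked at.
  Being a random element (Borel measurable, with values in the space) is part of the notion.\<close>

definition converges_in_distribution ::
  "'w measure \<Rightarrow> 'a topology \<Rightarrow> (nat \<Rightarrow> 'w \<Rightarrow> 'a) \<Rightarrow> ('w \<Rightarrow> 'a) \<Rightarrow> bool" where
  "converges_in_distribution M T X Y \<longleftrightarrow>
     (\<forall>N>0. X N \<in> M \<rightarrow>\<^sub>M borel_of T) \<and> Y \<in> M \<rightarrow>\<^sub>M borel_of T \<and>
     (\<forall>f. continuous_map T euclideanreal f \<and> bounded (f ` topspace T) \<longrightarrow>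
        (\<lambda>N. \<integral>\<omega>. f (X N \<omega>) \<partial>M) \<longlonglongrightarrow> (\<integral>\<omega>. f (Y \<omega>) \<partial>M))"

section \<open>The Skorohod space on the half line\<close>

text \<open>Paths are total functions on the reals of which only the values on \<open>[0,\<infinity>)\<close> matter: paths
  agreeing there lie in the same open sets.\<close>

definition rcll :: "(real \<Rightarrow> 'a::topological_space) set" where
  "rcll = {x. \<forall>t\<ge>0. (x \<longlongrightarrow> x t) (at_right t) \<and> (t > 0 \<longrightarrow> (\<exists>l. (x \<longlongrightarrow> l) (at_left t)))}"

definition time_change :: "(real \<Rightarrow> real) \<Rightarrow> bool" where
  "time_change l \<longleftrightarrow> strict_mono_on {0..} l \<and> bij_betw l {0..} {0..}"

text \<open>Neighbourhoods for the \<open>J\<^sub>1\<close> topology. A sequence of RCLL paths is eventually in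
  each \<open>J1_nbhd x T e\<close> iff for each \<open>T\<close> there are time changes \<open>l\<^sub>n\<close> with
  \<open>l\<^sub>n(t) - t \<rightarrow> 0\<close> and \<open>d(y\<^sub>n(t), x(l\<^sub>n(t))) \<rightarrow> 0\<close> uniformly on \<open>[0,T]\<close>, which is the
  usual description of \<open>J\<^sub>1\<close> convergence (Ethier and Kurtz, Prop. 3.5.3).\<close>

definition J1_nbhd :: "(real \<Rightarrow> 'a::metric_space) \<Rightarrow> real \<Rightarrow> real \<Rightarrow> (real \<Rightarrow> 'a) set" where
  "J1_nbhd x T e = {y \<in> rcll. \<exists>l. time_change l \<and>
     (\<forall>t\<in>{0..T}. \<bar>l t - t\<bar> < e \<and> dist (y t) (x (l t)) < e)}"

definition skorohod_topology :: "(real \<Rightarrow> 'a::metric_space) topology" where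
  "skorohod_topology =
     topology (\<lambda>U. U \<subseteq> rcll \<and> (\<forall>x\<in>U. \<exists>T>0. \<exists>e>0. J1_nbhd x T e \<subseteq> U))"

lemma openin_skorohod_topology:
  "openin skorohod_topology U \<longleftrightarrow>
     U \<subseteq> rcll \<and> (\<forall>x\<in>U. \<exists>T>0. \<exists>e>0. J1_nbhd x T e \<subseteq> U)"
proof -
  have "istopology (\<lambda>U :: (real \<Rightarrow> 'a) set.
          U \<subseteq> rcll \<and> (\<forall>x\<in>U. \<exists>T>0. \<exists>e>0. J1_nbhd x T e \<subseteq> U))"
    unfolding istopology_def
  proof (intro conjI allI impI ballI)
    fix U V :: "(real \<Rightarrow> 'a) set" and x
    assume U: "U \<subseteq> rcll \<and> (\<forall>x\<in>U. \<exists>T>0. \<exists>e>0. J1_nbhd x T e \<subseteq> U)"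
      and V: "V \<subseteq> rcll \<and> (\<forall>x\<in>V. \<exists>T>0. \<exists>e>0. J1_nbhd x T e \<subseteq> V)"
    show "U \<inter> V \<subseteq> rcll" using U by blast
    assume "x \<in> U \<inter> V"
    with U V obtain T e T' e' where
      *: "T > 0" "e > 0" "J1_nbhd x T e \<subseteq> U" "T' > 0" "e' > 0" "J1_nbhd x T' e' \<subseteq> V"
      by (metis IntE)
    have "J1_nbhd x (max T T') (min e e') \<subseteq> J1_nbhd x T e \<inter> J1_nbhd x T' e'"
      unfolding J1_nbhd_def by fastforce
    with * show "\<exists>T>0. \<exists>e>0. J1_nbhd x T e \<subseteq> U \<inter> V"
      by (intro exI[of _ "max T T'"] conjI exI[of _ "min e e'"]) auto
  next
    fix K :: "(real \<Rightarrow> 'a) set set" and x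
    assume K: "\<forall>U\<in>K. U \<subseteq> rcll \<and> (\<forall>x\<in>U. \<exists>T>0. \<exists>e>0. J1_nbhd x T e \<subseteq> U)"
    then show "\<Union>K \<subseteq> rcll" by blast
    assume "x \<in> \<Union>K"
    then obtain U where "U \<in> K" "x \<in> U" by blast
    then show "\<exists>T>0. \<exists>e>0. J1_nbhd x T e \<subseteq> \<Union>K" using K by (meson Sup_upper order_trans)
  qed
  then show ?thesis
    by (simp add: skorohod_topology_def topology_inverse')
qed

lemma topspace_skorohod_topology: "topspace skorohod_topology = rcll"
proof -
  have "openin skorohod_topology (rcll :: (real \<Rightarrow> 'a) set)"
    by (auto simp: openin_skorohod_topology J1_nbhd_def intro!: exI[of _ 1])
  then show ?thesis
    by (meson openin_skorohod_topology openin_subset openin_topspace subset_antisym)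
qed

section \<open>Finite Borel measures on the half line\<close>

definition finite_borel_measures :: "real measure set" where
  "finite_borel_measures = {m. sets m = sets (restrict_space borel {0..}) \<and> finite_measure m}"

definition weak_topology :: "real measure topology" where
  "weak_topology = topology_generated_by
     {{m \<in> finite_borel_measures. (\<integral>x. f x \<partial>m) \<in> U} | (f :: real \<Rightarrow> real) U.
        continuous_on {0..} f \<and> bounded (f ` {0..}) \<and> open U}"

section \<open>The earliest-deadline-first queue with reneging\<close>

text \<open>For inter-renewal times \<open>T 0, T 1, \<dots>\<close> the \<open>n\<close>-th renewal is at \<open>T 0 + \<dots> + T (n - 1)\<close>.\<close>

definition renewal_count :: "(nat \<Rightarrow> real) \<Rightarrow> real \<Rightarrow> nat" where
  "renewal_count T t = card {n. 0 < n \<and> (\<Sum>k<n. T k) \<le> t}"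

definition renewal_sequence :: "'w measure \<Rightarrow> (nat \<Rightarrow> 'w \<Rightarrow> real) \<Rightarrow> bool" where
  "renewal_sequence M T \<longleftrightarrow>
     prob_space.indep_vars M (\<lambda>_. borel) T UNIV \<and>
     (\<forall>k. distr M borel (T k) = distr M borel (T 0)) \<and>
     (AE \<omega> in M. \<forall>k. T k \<omega> > 0) \<and>
     integrable M (T 0) \<and> (\<integral>\<omega>. T 0 \<omega> \<partial>M) = 1"

text \<open>In what follows customers are indexed by the integers \<open>i \<ge> 1 - x0\<close>, where \<open>x0\<close> is the number
  of customers present at time 0; \<open>a i\<close> is the arrival time and \<open>u i\<close> the initial lead time of
  customer \<open>i\<close>, and \<open>b i\<close> is the time at which \<open>i\<close> starts service, \<open>\<infinity>\<close> if this never happens.\<close>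

definition lead_time :: "(int \<Rightarrow> real) \<Rightarrow> (int \<Rightarrow> real) \<Rightarrow> int \<Rightarrow> real \<Rightarrow> real" where
  "lead_time a u i t = u i + a i - t"

definition queued ::
  "nat \<Rightarrow> (int \<Rightarrow> real) \<Rightarrow> (int \<Rightarrow> real) \<Rightarrow> (int \<Rightarrow> ereal) \<Rightarrow> real \<Rightarrow> int set" where
  "queued x0 a u b t = {i. 1 - int x0 \<le> i \<and> a i \<le> t \<and> ereal t < b i \<and> 0 < lead_time a u i t}"

text \<open>A customer reneges at time \<open>a i + u i\<close> if his service has not started before.\<close>

definition reneged ::
  "nat \<Rightarrow> (int \<Rightarrow> real) \<Rightarrow> (int \<Rightarrow> real) \<Rightarrow> (int \<Rightarrow> ereal) \<Rightarrow> real \<Rightarrow> int set" where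
  "reneged x0 a u b t = {i. 1 - int x0 \<le> i \<and> a i + u i \<le> t \<and> ereal (a i + u i) \<le> b i}"

definition queue_measure ::
  "nat \<Rightarrow> (int \<Rightarrow> real) \<Rightarrow> (int \<Rightarrow> real) \<Rightarrow> (int \<Rightarrow> ereal) \<Rightarrow> real \<Rightarrow> real measure" where
  "queue_measure x0 a u b t =
     distr (count_space (queued x0 a u b t)) (restrict_space borel {0..}) (\<lambda>i. lead_time a u i t)"

definition head_lead_time ::
  "nat \<Rightarrow> (int \<Rightarrow> real) \<Rightarrow> (int \<Rightarrow> real) \<Rightarrow> (int \<Rightarrow> ereal) \<Rightarrow> real \<Rightarrow> real" where
  "head_lead_time x0 a u b t =
     (if queued x0 a u b t = {} then 0
      else Min ((\<lambda>i. lead_time a u i t) ` queued x0 a u b t))"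

definition busy_time :: "(real \<Rightarrow> nat) \<Rightarrow> real \<Rightarrow> real" where
  "busy_time X t = integral {0..t} (\<lambda>s. if X s > 0 then 1 else 0)"

text \<open>Sample path dynamics. By \<open>balance\<close> and \<open>queue_length\<close>, the number of service starts up to
  time \<open>t\<close> equals the number of completions plus 1 if \<open>X t > 0\<close>: this says that there is a single
  server which does not idle and does not preempt. (Truncated subtraction: \<open>X t - 1\<close> is the positive part.)
  In case of a tie, arrivals and reneging at
  time \<open>t\<close> precede the choice of the next customer at time \<open>t\<close>. Equal lead times are ordered
  arbitrarily.\<close>

locale edf_path =
  fixes E S X R :: "real \<Rightarrow> nat"
    and a u :: "int \<Rightarrow> real"
    and b :: "int \<Rightarrow> ereal"
  assumes initial_arrival: "1 - int (X 0) \<le> i \<Longrightarrow> i \<le> 0 \<Longrightarrow> a i \<le> 0"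
    and arrival: "1 \<le> i \<Longrightarrow> a i = Inf {t. 0 \<le> t \<and> i \<le> int (E t)}"
    and lead_pos: "1 - int (X 0) \<le> i \<Longrightarrow> u i > 0"
    and balance: "0 \<le> t \<Longrightarrow>
      int (X t) = int (X 0) + int (E t) - int (S (busy_time X t)) - int (R t)"
    and queue_length: "0 \<le> t \<Longrightarrow>
      finite (queued (X 0) a u b t) \<and> card (queued (X 0) a u b t) = X t - 1"
    and reneging: "0 \<le> t \<Longrightarrow>
      finite (reneged (X 0) a u b t) \<and> card (reneged (X 0) a u b t) = R t"
    and no_initial_reneging: "R 0 = 0"
    and start: "1 - int (X 0) \<le> i \<Longrightarrow> b i \<noteq> \<infinity> \<Longrightarrow> ereal (a i) \<le> b i \<and> b i < ereal (a i + u i)"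
    and earliest_deadline: "1 - int (X 0) \<le> i \<Longrightarrow> b i = ereal t \<Longrightarrow> 0 < t \<Longrightarrow>
      j \<in> queued (X 0) a u b t \<Longrightarrow> lead_time a u i t \<le> lead_time a u j t"

text \<open>Here \<open>A\<close> and \<open>V\<close> are the inter-renewal times of the renewal processes \<open>E\<^sup>0\<close> and \<open>S\<^sup>0\<close>.\<close>

locale edf_queues = prob_space M for M :: "'w measure" +
  fixes lamN muN :: "nat \<Rightarrow> real"
    and nuN :: "nat \<Rightarrow> real measure"
    and A V :: "nat \<Rightarrow> 'w \<Rightarrow> real"
    and X Q R :: "nat \<Rightarrow> 'w \<Rightarrow> real \<Rightarrow> nat"
    and a u :: "nat \<Rightarrow> 'w \<Rightarrow> int \<Rightarrow> real"
    and b :: "nat \<Rightarrow> 'w \<Rightarrow> int \<Rightarrow> ereal"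
  assumes rates_pos: "N > 0 \<Longrightarrow> lamN N > 0 \<and> muN N > 0"
    and arrival_renewals: "renewal_sequence M A"
    and service_renewals: "renewal_sequence M V"
    and lead_times_indep: "N > 0 \<Longrightarrow> indep_vars (\<lambda>_. borel) (\<lambda>i \<omega>. u N \<omega> i) {1..}"
    and lead_times_law: "N > 0 \<Longrightarrow> 1 \<le> i \<Longrightarrow> distr M borel (\<lambda>\<omega>. u N \<omega> i) = nuN N"
    and mutually_indep: "N > 0 \<Longrightarrow>
      indep_vars (\<lambda>_. PiM UNIV (\<lambda>_. borel))
        (\<lambda>j \<omega>. [\<lambda>k. u N \<omega> (int k + 1), \<lambda>k. A k \<omega>, \<lambda>k. V k \<omega>] ! j) {..<3::nat}"
    and random_paths: "N > 0 \<Longrightarrow>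
      (\<lambda>\<omega> t. (real (X N \<omega> t), real (R N \<omega> t))) \<in> M \<rightarrow>\<^sub>M borel_of skorohod_topology"
    and queue_eq: "N > 0 \<Longrightarrow> \<omega> \<in> space M \<Longrightarrow> 0 \<le> t \<Longrightarrow> Q N \<omega> t = X N \<omega> t - 1"
    and dynamics: "N > 0 \<Longrightarrow> AE \<omega> in M.
      edf_path (\<lambda>t. renewal_count (\<lambda>k. A k \<omega>) (lamN N * t))
        (\<lambda>t. renewal_count (\<lambda>k. V k \<omega>) (muN N * t))
        (X N \<omega>) (R N \<omega>) (a N \<omega>) (u N \<omega>) (b N \<omega>)"

section \<open>The fluid limit\<close>

definition y_max :: "(real \<Rightarrow> real) \<Rightarrow> ereal" where
  "y_max G = Inf (ereal ` {x. G x = 1})"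

definition y_star :: "real \<Rightarrow> real \<Rightarrow> (real \<Rightarrow> real) \<Rightarrow> ereal" where
  "y_star lam mu G = Sup (ereal ` {y. ereal y < y_max G \<and> lam * G y < mu})"

definition fluid_H :: "real \<Rightarrow> (real \<Rightarrow> real) \<Rightarrow> real measure \<Rightarrow> real \<Rightarrow> real \<Rightarrow> real" where
  "fluid_H lam G Q0 x t =
     measure Q0 {x + t<..} + lam * integral {0..t} (\<lambda>s. 1 - G (x + t - s))"

definition fluid_psi :: "real \<Rightarrow> real \<Rightarrow> real measure \<Rightarrow> real \<Rightarrow> real" where
  "fluid_psi lam mu Q0 t = measure Q0 {0..} + (lam - mu) * t"

definition fluid_eta ::
  "real \<Rightarrow> real \<Rightarrow> (real \<Rightarrow> real) \<Rightarrow> real measure \<Rightarrow> real \<Rightarrow> real" where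
  "fluid_eta lam mu G Q0 t =
     (SUP s\<in>{0..t}. max 0 (fluid_psi lam mu Q0 s - fluid_H lam G Q0 0 s))"

definition fluid_phi ::
  "real \<Rightarrow> real \<Rightarrow> (real \<Rightarrow> real) \<Rightarrow> real measure \<Rightarrow> real \<Rightarrow> real" where
  "fluid_phi lam mu G Q0 t = fluid_psi lam mu Q0 t - fluid_eta lam mu G Q0 t"

end

theory Submission
  imports Defs
begin

text \<open>All limits are deterministic, so every subsequence has a further subsequence along which the
  primitives (renewal processes, numbers of short initial lead times, initial queue) obey their laws
  of large numbers almost surely, and the theorem becomes a statement about sample paths.

  Let \<open>K t\<close> be the scaled number of customers with deadline at most \<open>t\<close>; in the limit
  \<open>\<psi> t - H(0,t) = K t - \<mu> t\<close>. A customer with deadline at most \<open>s\<close> has left the queue by time \<open>s\<close>, so the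
  scaled reneging count is at least \<open>K s - \<mu> s\<close> for all \<open>s \<le> t\<close>. Conversely, suppose that a customer
  reneges at \<open>\<tau>\<close>. If no customer with deadline beyond \<open>\<tau> + c\<close> has started service, then up to
  \<open>O(c)\<close> the count at \<open>\<tau>\<close> is at most \<open>K \<tau> - \<mu> \<tau>\<close>. Otherwise let \<open>\<sigma>\<close> be the last start of such a
  customer: by earliest-deadline-first, everybody served in \<open>(\<sigma>,\<tau>)\<close> arrived after \<open>\<sigma>\<close> with deadline at
  most \<open>\<tau> + c\<close>, which the rates allow only if \<open>\<tau> - \<sigma>\<close> is small; as the reneging customer arrived after
  \<open>\<sigma>\<close> too, his initial lead time is tiny, and few customers are like that because \<open>G\<close> vanishes at \<open>0\<close>.
  For \<open>\<lambda> > \<mu>\<close> this needs that no customer starts service with lead time much above \<open>y*\<close>: the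
  recent arrivals with shorter deadlines would exceed the capacity of the server. Since the limiting
  queue is bounded away from \<open>0\<close>, the server never idles.\<close>

section \<open>Convergence in distribution to a continuous path\<close>

text \<open>The smallness of \<open>\<tau> - \<sigma>\<close> comes from a comparison of rates. Put
  \<open>z = \<tau> - \<sigma>\<close>. Arrivals in that window with deadline at most
  \<open>\<tau> + c\<close> number about \<open>lam * (Gam (z + c) - Gam c)\<close> per unit of
  scale, where \<open>Gam\<close> is the integral of \<open>G\<close>, against \<open>mu * z\<close>
  services. Near 0 the slope \<open>lam * G\<close> is at most \<open>mu / 2\<close>, which creates
  a deficit once \<open>z\<close> reaches a fixed \<open>v\<close>. If \<open>lam = mu\<close>, the
  slope never exceeds \<open>mu\<close> and the deficit persists; if \<open>mu < lam\<close>, it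
  could be made up at arguments beyond the frontier y*, so these have to be excluded beforehand.

  The estimates are circular: counting services by \<open>S t\<close> presupposes a busy server, and
  the server is busy because few customers have reneged. Looking at the first idle time breaks the
  circle.

  As \<open>G\<close> may jump, short lead times are counted only at continuity points. The integral
  \<open>Gam\<close> is nevertheless Lipschitz; hence the limiting counts that enter the comparison
  are continuous, and monotonicity upgrades pointwise to locally uniform convergence.\<close>

abbreviation ncard :: "'a set \<Rightarrow> real" where "ncard A \<equiv> real (card A)"

abbreviation ticks :: "real \<Rightarrow> nat \<Rightarrow> nat" where "ticks q N \<equiv> nat \<lfloor>q * real N\<rfloor>"

lemma space_borel_of [simp]: "space (borel_of T) = topspace T"
  unfolding borel_of_def by (rule space_measure_of) (auto dest: openin_subset)

lemma openin_sets_borel_of: "openin T U \<Longrightarrow> U \<in> sets (borel_of T)"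
  unfolding borel_of_def by (subst sets_measure_of) (auto dest: openin_subset intro: sigma_sets.Basic)

lemma measurable_borel_ofI:
  assumes "\<And>x. x \<in> space M \<Longrightarrow> f x \<in> topspace T"
    and "\<And>U. openin T U \<Longrightarrow> f -` U \<inter> space M \<in> sets M"
  shows "f \<in> M \<rightarrow>\<^sub>M borel_of T"
  unfolding borel_of_def
  by (rule measurable_measure_of) (use assms in \<open>auto dest: openin_subset\<close>)

lemma borel_measurable_continuous_map:
  assumes "continuous_map T euclideanreal f"
  shows "f \<in> borel_measurable (borel_of T)"
proof (rule borel_measurableI)
  fix S :: "real set" assume "open S"
  then have "openin T {x \<in> topspace T. f x \<in> S}"
    using assms by (simp add: continuous_map_def)
  moreover have "f -` S \<inter> space (borel_of T) = {x \<in> topspace T. f x \<in> S}" by auto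
  ultimately show "f -` S \<inter> space (borel_of T) \<in> sets (borel_of T)"
    by (simp add: openin_sets_borel_of)
qed

lemma tendsto_subsequenceI:
  fixes x :: "nat \<Rightarrow> real"
  assumes "\<And>r :: nat \<Rightarrow> nat. strict_mono r \<Longrightarrow> \<exists>s. strict_mono s \<and> (\<lambda>j. x (r (s j))) \<longlonglongrightarrow> l"
  shows "x \<longlonglongrightarrow> l"
proof (rule ccontr)
  assume "\<not> x \<longlonglongrightarrow> l"
  then obtain e where e: "e > 0" "\<And>n0. \<exists>n\<ge>n0. e \<le> dist (x n) l"
    unfolding lim_sequentially by (auto simp: not_less)
  have "infinite {n. e \<le> dist (x n) l}"
    using e(2) by (auto simp: infinite_nat_iff_unbounded_le)
  from infinite_enumerate[OF this]
  obtain r :: "nat \<Rightarrow> nat" where r: "strict_mono r" "\<And>n. r n \<in> {n. e \<le> dist (x n) l}" by blast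
  obtain s where "(\<lambda>j. x (r (s j))) \<longlonglongrightarrow> l" using assms[OF r(1)] by blast
  then have "\<forall>\<^sub>F j in sequentially. dist (x (r (s j))) l < e" using e(1) by (rule tendstoD)
  then obtain j where "dist (x (r (s j))) l < e" by (auto simp: eventually_sequentially)
  then show False using r(2)[of "s j"] by simp
qed

text \<open>Almost sure convergence of every continuous functional along a further subsequence
  passes to expectations by dominated convergence, and the subsequence principle returns the whole
  sequence. The requirement \<open>0 < r (s j)\<close> avoids index 0, where nothing is known about
  \<open>X 0\<close>.\<close>

lemma (in prob_space) converges_in_distribution_constI:
  assumes meas: "\<And>N. N > 0 \<Longrightarrow> X N \<in> M \<rightarrow>\<^sub>M borel_of T" and c: "c \<in> topspace T"
    and sub: "\<And>r :: nat \<Rightarrow> nat. strict_mono r \<Longrightarrow> \<exists>s. strict_mono s \<and> (\<forall>j. 0 < r (s j)) \<and>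
      (AE w in M. \<forall>f. continuous_map T euclideanreal f \<longrightarrow> (\<lambda>j. f (X (r (s j)) w)) \<longlonglongrightarrow> f c)"
  shows "converges_in_distribution M T X (\<lambda>_. c)"
  unfolding converges_in_distribution_def
proof (intro conjI allI impI)
  show "X N \<in> M \<rightarrow>\<^sub>M borel_of T" if "N > 0" for N using meas that .
  show "(\<lambda>_. c) \<in> M \<rightarrow>\<^sub>M borel_of T" using c by (intro measurable_const) simp
  fix f assume f: "continuous_map T euclideanreal f \<and> bounded (f ` topspace T)"
  then obtain B where B: "\<And>x. x \<in> topspace T \<Longrightarrow> \<bar>f x\<bar> \<le> B" by (auto simp: bounded_iff)
  have fX: "(\<lambda>w. f (X N w)) \<in> borel_measurable M" if "N > 0" for N
    using measurable_compose[OF meas[OF that] borel_measurable_continuous_map] f by blast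
  show "(\<lambda>N. \<integral>w. f (X N w) \<partial>M) \<longlonglongrightarrow> (\<integral>w. f c \<partial>M)"
  proof (rule tendsto_subsequenceI)
    fix r :: "nat \<Rightarrow> nat" assume "strict_mono r"
    from sub[OF this] obtain s where s: "strict_mono s" "\<And>j. 0 < r (s j)"
      and lim: "AE w in M. \<forall>f. continuous_map T euclideanreal f \<longrightarrow> (\<lambda>j. f (X (r (s j)) w)) \<longlonglongrightarrow> f c" by auto
    have "(\<lambda>j. \<integral>w. f (X (r (s j)) w) \<partial>M) \<longlonglongrightarrow> (\<integral>w. f c \<partial>M)"
    proof (rule integral_dominated_convergence[where w = "\<lambda>_. B"])
      show "AE w in M. norm (f (X (r (s j)) w)) \<le> B" for j
        using B measurable_space[OF meas[OF s(2)]] by (intro AE_I2) auto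
      show "AE w in M. (\<lambda>j. f (X (r (s j)) w)) \<longlonglongrightarrow> f c"
        using lim by eventually_elim (use f in blast)
    qed (use fX s in auto)
    then show "\<exists>s. strict_mono s \<and> (\<lambda>j. \<integral>w. f (X (r (s j)) w) \<partial>M) \<longlonglongrightarrow> (\<integral>w. f c \<partial>M)"
      using s by blast
  qed
qed

section \<open>Locally uniform limits and measurability in the Skorohod space\<close>

lemma rcll_cong:
  assumes "x \<in> rcll" "\<And>t. 0 \<le> t \<Longrightarrow> y t = x t"
  shows "y \<in> rcll"
proof -
  have "(y \<longlongrightarrow> y t) (at_right t) \<and> (t > 0 \<longrightarrow> (\<exists>l. (y \<longlongrightarrow> l) (at_left t)))" if t: "0 \<le> t" for t
  proof (intro conjI impI)
    have *: "(x \<longlongrightarrow> x t) (at_right t) \<and> (t > 0 \<longrightarrow> (\<exists>l. (x \<longlongrightarrow> l) (at_left t)))"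
      using assms(1) t unfolding rcll_def by blast
    then have "(x \<longlongrightarrow> y t) (at_right t)" using assms(2)[OF t] by simp
    then show "(y \<longlongrightarrow> y t) (at_right t)"
      by (rule Lim_transform_eventually)
        (use eventually_at_right_less[of t] in eventually_elim, use assms t in auto)
    assume "0 < t"
    then obtain l where "(x \<longlongrightarrow> l) (at_left t)" using * by blast
    then have "(y \<longlongrightarrow> l) (at_left t)"
      by (rule Lim_transform_eventually)
        (use eventually_at_left_real[OF \<open>0 < t\<close>] in eventually_elim, use assms in auto)
    then show "\<exists>l. (y \<longlongrightarrow> l) (at_left t)" ..
  qed
  then show ?thesis by (simp add: rcll_def)
qed

lemma time_change_id: "time_change (\<lambda>t. t)"
  by (auto simp: time_change_def strict_mono_on_def bij_betw_def)

lemma J1_nbhdI_uniform: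
  assumes "y \<in> rcll" "0 < e" "\<And>t. 0 \<le> t \<Longrightarrow> t \<le> T \<Longrightarrow> dist (y t) (x t) < e"
  shows "y \<in> J1_nbhd x T e"
  unfolding J1_nbhd_def using assms time_change_id by (auto intro!: exI[of _ "\<lambda>t. t"])

lemma skorohod_open_cong:
  assumes "openin skorohod_topology U" "x \<in> U" "\<And>t. 0 \<le> t \<Longrightarrow> y t = x t"
  shows "y \<in> U"
proof -
  have "x \<in> rcll" using assms by (auto simp: openin_skorohod_topology)
  then have "y \<in> rcll" using rcll_cong assms(3) by blast
  moreover obtain T e where "e > 0" "J1_nbhd x T e \<subseteq> U"
    using assms(1,2) by (auto simp: openin_skorohod_topology)
  ultimately show ?thesis using J1_nbhdI_uniform[of y e T x] assms(3) by auto
qed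

text \<open>The identity serves as time change. An open set contains some \<open>J1_nbhd\<close>
  around each of its points, so it is enough that the paths enter such a neighbourhood, open or
  not.\<close>

lemma skorohod_continuous_map_uniform_limit:
  assumes f: "continuous_map skorohod_topology euclideanreal f" and x: "x \<in> rcll"
    and y: "\<And>j. y j \<in> rcll"
    and lim: "\<And>T e. 0 < T \<Longrightarrow> 0 < e \<Longrightarrow> \<forall>\<^sub>F j in \<F>. \<forall>t\<in>{0..T}. dist (y j t) (x t) < e"
  shows "((\<lambda>j. f (y j)) \<longlongrightarrow> f x) \<F>"
proof (rule topological_tendstoI)
  fix S assume "open S" "f x \<in> S"
  let ?U = "{z \<in> topspace skorohod_topology. f z \<in> S}"
  have "openin skorohod_topology ?U" using f \<open>open S\<close> by (simp add: continuous_map_def)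
  moreover have "x \<in> ?U" using x \<open>f x \<in> S\<close> by (simp add: topspace_skorohod_topology)
  ultimately obtain T e where "T > 0" "e > 0" and U: "J1_nbhd x T e \<subseteq> ?U"
    unfolding openin_skorohod_topology by blast
  show "\<forall>\<^sub>F j in \<F>. f (y j) \<in> S"
    using lim[OF \<open>T > 0\<close> \<open>e > 0\<close>]
  proof eventually_elim
    case (elim j)
    then have "y j \<in> J1_nbhd x T e" using y \<open>e > 0\<close> by (intro J1_nbhdI_uniform) auto
    then show ?case using U by auto
  qed
qed

lemma rcll_compose:
  fixes x :: "real \<Rightarrow> 'a::t2_space" and h :: "'a \<Rightarrow> 'b::t2_space"
  assumes "x \<in> rcll" and h: "continuous_on UNIV h"
  shows "(\<lambda>t. h (x t)) \<in> rcll"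
proof -
  have "isCont h z" for z using h by (simp add: continuous_on_eq_continuous_at)
  then have h': "((\<lambda>t. h (y t)) \<longlongrightarrow> h l) F" if "(y \<longlongrightarrow> l) F" for y l and F :: "real filter"
    using isCont_tendsto_compose that by blast
  show ?thesis using assms(1) h' unfolding rcll_def by fastforce
qed

text \<open>Transfers measurability from the unscaled paths to the scaled ones. A 1-Lipschitz
  \<open>h\<close> maps neighbourhoods into neighbourhoods with the same time change and the same
  radius, so preimages of open sets are open. As \<open>Y\<close> is prescribed on nonnegative times
  only, \<open>skorohod_open_cong\<close> makes the link.\<close>

lemma measurable_skorohod_compose:
  fixes h :: "'a::metric_space \<Rightarrow> 'b::metric_space"
  assumes X: "X \<in> M \<rightarrow>\<^sub>M borel_of skorohod_topology"
    and h: "\<And>p q. dist (h p) (h q) \<le> dist p q"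
    and Y: "\<And>w t. w \<in> space M \<Longrightarrow> 0 \<le> t \<Longrightarrow> Y w t = h (X w t)"
  shows "Y \<in> M \<rightarrow>\<^sub>M borel_of skorohod_topology"
proof (rule measurable_borel_ofI)
  have "continuous_on UNIV h"
    unfolding continuous_on_iff using h by (metis le_less_trans)
  then have rc: "(\<lambda>t. h (x t)) \<in> rcll" if "x \<in> rcll" for x using rcll_compose that by blast
  have Xr: "X w \<in> rcll" if "w \<in> space M" for w
    using measurable_space[OF X that] by (simp add: topspace_skorohod_topology)
  show "Y w \<in> topspace skorohod_topology" if "w \<in> space M" for w
    using rcll_cong[OF rc[OF Xr[OF that]]] Y[OF that] by (simp add: topspace_skorohod_topology)
  fix U :: "(real \<Rightarrow> 'b) set" assume U: "openin skorohod_topology U"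
  define V where "V = {x \<in> rcll. (\<lambda>t. h (x t)) \<in> U}"
  have "openin skorohod_topology V"
    unfolding openin_skorohod_topology
  proof (intro conjI ballI)
    show "V \<subseteq> rcll" by (auto simp: V_def)
    fix x assume "x \<in> V"
    then obtain T e where T: "T > 0" "e > 0" "J1_nbhd (\<lambda>t. h (x t)) T e \<subseteq> U"
      using U by (auto simp: openin_skorohod_topology V_def)
    have "J1_nbhd x T e \<subseteq> V"
    proof
      fix y assume "y \<in> J1_nbhd x T e"
      then have "y \<in> rcll" "(\<lambda>t. h (y t)) \<in> J1_nbhd (\<lambda>t. h (x t)) T e"
        using rc h by (auto simp: J1_nbhd_def) (meson le_less_trans)
      then show "y \<in> V" using T by (auto simp: V_def)
    qed
    then show "\<exists>T>0. \<exists>e>0. J1_nbhd x T e \<subseteq> V" using T by blast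
  qed
  then have "X -` V \<inter> space M \<in> sets M"
    by (intro measurable_sets[OF X] openin_sets_borel_of)
  moreover have "Y -` U \<inter> space M = X -` V \<inter> space M"
  proof -
    have "Y w \<in> U \<longleftrightarrow> X w \<in> V" if "w \<in> space M" for w
      using skorohod_open_cong[OF U, of "Y w" "\<lambda>t. h (X w t)"] skorohod_open_cong[OF U, of "\<lambda>t. h (X w t)" "Y w"]
        Y[OF that] Xr[OF that] by (auto simp: V_def)
    then show ?thesis by auto
  qed
  ultimately show "Y -` U \<inter> space M \<in> sets M" by simp
qed

section \<open>Weak convergence of the initial queue, read as convergence of counts\<close>

lemma topspace_weak_topology: "topspace weak_topology = finite_borel_measures"
proof -
  \<comment> \<open>The zero function with \<open>UNIV\<close> as target exhibits the whole space as
    a member of the generating family.\<close>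
  have "finite_borel_measures = {m \<in> finite_borel_measures. (\<integral>x. (\<lambda>_. 0::real) x \<partial>m) \<in> UNIV}" by simp
  moreover have "continuous_on {0..} (\<lambda>_::real. 0::real)" "bounded ((\<lambda>_. 0::real) ` {0::real..})"
    by (auto intro: boundedI[of _ 0])
  ultimately show ?thesis
    unfolding weak_topology_def topology_generated_by_topspace by blast
qed

lemma continuous_map_integral_weak:
  assumes "continuous_on {0..} f" "bounded (f ` {0..})"
  shows "continuous_map weak_topology euclideanreal (\<lambda>m. \<integral>x. f x \<partial>m)"
  unfolding continuous_map_def
proof (intro conjI allI impI)
  fix U :: "real set" assume "openin euclidean U"
  then have "openin weak_topology {m \<in> finite_borel_measures. (\<integral>x. f x \<partial>m) \<in> U}"
    unfolding weak_topology_def using assms by (intro topology_generated_by_Basis) auto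
  then show "openin weak_topology {x \<in> topspace weak_topology. (\<integral>y. f y \<partial>x) \<in> U}"
    by (simp add: topspace_weak_topology)
qed auto

text \<open>Convergence in distribution to a constant becomes convergence in probability by testing
  with the bounded continuous functional that measures the truncated distance to the limiting
  integral and vanishes at \<open>Q0\<close>.\<close>

lemma converges_in_distribution_integral:
  fixes f :: "real \<Rightarrow> real"
  assumes conv: "converges_in_distribution M (prod_topology weak_topology S) (\<lambda>N w. (m N w, y N w)) (\<lambda>w. (Q0, y0))"
    and f: "continuous_on {0..} f" "bounded (f ` {0..})"
  shows "N > 0 \<Longrightarrow> (\<lambda>w. \<integral>x. f x \<partial>m N w) \<in> borel_measurable M"
    and "(\<lambda>N. \<integral>w. min 1 \<bar>(\<integral>x. f x \<partial>m N w) - (\<integral>x. f x \<partial>Q0)\<bar> \<partial>M) \<longlonglongrightarrow> 0"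
proof -
  have c: "continuous_map (prod_topology weak_topology S) euclideanreal (\<lambda>p. \<integral>x. f x \<partial>fst p)"
    using continuous_map_compose[OF continuous_map_fst continuous_map_integral_weak[OF f]] by (simp add: comp_def)
  then show "(\<lambda>w. \<integral>x. f x \<partial>m N w) \<in> borel_measurable M" if "N > 0"
    using conv measurable_compose[OF _ borel_measurable_continuous_map[OF c], of "\<lambda>w. (m N w, y N w)" M] that
    by (simp add: converges_in_distribution_def)
  define g where "g p = min 1 \<bar>(\<integral>x. f x \<partial>fst p) - (\<integral>x. f x \<partial>Q0)\<bar>" for p :: "real measure \<times> 'b"
  have "continuous_map euclideanreal euclideanreal (\<lambda>z. min 1 \<bar>z - (\<integral>x. f x \<partial>Q0)\<bar>)"
    by (auto intro!: continuous_intros)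
  from continuous_map_compose[OF c this]
  have "continuous_map (prod_topology weak_topology S) euclideanreal g"
    by (simp add: comp_def g_def[abs_def])
  moreover have "bounded (g ` topspace (prod_topology weak_topology S))"
    by (rule boundedI[of _ 1]) (auto simp: g_def)
  ultimately have "(\<lambda>N. \<integral>w. g (m N w, y N w) \<partial>M) \<longlonglongrightarrow> (\<integral>w. g (Q0, y0) \<partial>M)"
    using conv by (simp add: converges_in_distribution_def)
  then show "(\<lambda>N. \<integral>w. min 1 \<bar>(\<integral>x. f x \<partial>m N w) - (\<integral>x. f x \<partial>Q0)\<bar> \<partial>M) \<longlonglongrightarrow> 0"
    by (simp add: g_def)
qed

lemma integral_scaled_queue_measure:
  assumes fin: "finite (queued x0 a u b t)" and f: "continuous_on {0..} f" "\<And>x. 0 \<le> f x" and "0 \<le> c"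
  shows "(\<integral>x. f x \<partial>scale_measure (ennreal c) (queue_measure x0 a u b t)) =
    c * (\<Sum>i\<in>queued x0 a u b t. f (lead_time a u i t))"
proof -
  let ?Q = "queued x0 a u b t" and ?L = "\<lambda>i. lead_time a u i t"
  have L: "?L \<in> count_space ?Q \<rightarrow>\<^sub>M restrict_space borel {0..}"
    by (auto simp: queued_def space_restrict_space intro!: less_imp_le)
  have fm: "f \<in> borel_measurable (restrict_space borel {0..})"
    by (rule borel_measurable_continuous_on_restrict[OF f(1)])
  have fm': "f \<in> borel_measurable (scale_measure (ennreal c) (queue_measure x0 a u b t))"
    using fm by (subst measurable_cong_sets[OF _ refl]) (auto simp: queue_measure_def)
  have "(\<integral>\<^sup>+x. ennreal (f x) \<partial>queue_measure x0 a u b t) = (\<integral>\<^sup>+i. ennreal (f (?L i)) \<partial>count_space ?Q)"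
    unfolding queue_measure_def using fm by (subst nn_integral_distr[OF L]) auto
  also have "\<dots> = (\<Sum>i\<in>?Q. ennreal (f (?L i)))" using fin by (rule nn_integral_count_space_finite)
  also have "\<dots> = ennreal (\<Sum>i\<in>?Q. f (?L i))" using f(2) by simp
  finally have "(\<integral>\<^sup>+x. ennreal (f x) \<partial>scale_measure (ennreal c) (queue_measure x0 a u b t)) =
      ennreal (c * (\<Sum>i\<in>?Q. f (?L i)))"
    using fm \<open>0 \<le> c\<close> by (subst nn_integral_scale_measure) (auto simp: queue_measure_def ennreal_mult' sum_nonneg f(2))
  then show ?thesis
    using \<open>0 \<le> c\<close> f(2) by (subst integral_eq_nn_integral[OF fm']) (auto simp: sum_nonneg)
qed

text \<open>For \<open>p < q\<close>, a piecewise linear function between the indicators of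
  \<open>{..p}\<close> and \<open>{..q}\<close>: the continuous test functions from which counts are
  recovered.\<close>

definition ramp :: "real \<Rightarrow> real \<Rightarrow> real \<Rightarrow> real" where
  "ramp p q x = max 0 (min 1 ((q - x) / (q - p)))"

lemma ramp_bounds:
  assumes "p < q"
  shows "0 \<le> ramp p q x" "ramp p q x \<le> 1" "x \<le> p \<Longrightarrow> ramp p q x = 1" "q \<le> x \<Longrightarrow> ramp p q x = 0"
  using assms by (auto simp: ramp_def divide_le_0_iff)

lemma ramp_continuous: "p < q \<Longrightarrow> continuous_on S (ramp p q)"
  unfolding ramp_def by (intro continuous_intros) auto

lemma ramp_bounded: "p < q \<Longrightarrow> bounded (ramp p q ` S)"
  by (rule boundedI[of _ 1]) (use ramp_bounds in auto)

text \<open>A portmanteau argument: ramps with rational corners determine the scaled counts at every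
  continuity point.\<close>

lemma initial_count_limit:
  fixes I :: "'i \<Rightarrow> int set" and L :: "'i \<Rightarrow> int \<Rightarrow> real" and n :: "'i \<Rightarrow> real"
  assumes Q0: "Q0 \<in> finite_borel_measures"
    and G0: "continuous_on {0..} (\<lambda>x. measure Q0 {0..x})" "measure Q0 {0..0} = 0"
    and fin: "\<And>j. finite (I j)" and L: "\<And>j i. i \<in> I j \<Longrightarrow> 0 < L j i" and n: "\<And>j. 0 < n j"
    and lim: "\<And>p q. p \<in> \<rat> \<Longrightarrow> q \<in> \<rat> \<Longrightarrow> p < q \<Longrightarrow>
      ((\<lambda>j. (\<Sum>i\<in>I j. ramp p q (L j i)) / n j) \<longlongrightarrow> (\<integral>x. ramp p q x \<partial>Q0)) \<F>"
    and x: "0 \<le> x"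
  shows "((\<lambda>j. ncard {i \<in> I j. L j i \<le> x} / n j) \<longlongrightarrow> measure Q0 {0..x}) \<F>"
proof -
  interpret Q0: finite_measure Q0 using Q0 by (simp add: finite_borel_measures_def)
  have sets_Q0: "sets Q0 = sets (restrict_space borel {0..})" using Q0 by (simp add: finite_borel_measures_def)
  have space_Q0: "space Q0 = {0..}" using sets_eq_imp_space_eq[OF sets_Q0] by (simp add: space_restrict_space)
  have sets: "{0..y} \<in> sets Q0" for y :: real
    unfolding sets_Q0 by (auto simp: sets_restrict_space_iff)
  have ramp_int: "integrable Q0 (ramp p q)" if "p < q" for p q
    using borel_measurable_continuous_on_restrict[OF ramp_continuous[OF that, of "{0..}"]] ramp_bounds[OF that]
    by (intro Q0.integrable_const_bound[of _ 1]) (auto simp: measurable_cong_sets[OF sets_Q0 refl])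
  have ind_int: "integrable Q0 (indicator {0..y} :: real \<Rightarrow> real)" for y
    using sets by (intro integrable_real_indicator) (auto simp: Q0.emeasure_finite less_top[symmetric])
  have up: "(\<integral>x. ramp p q x \<partial>Q0) \<le> measure Q0 {0..q}" if "p < q" for p q
  proof -
    have "(\<integral>x. ramp p q x \<partial>Q0) \<le> (\<integral>x. indicator {0..q} x \<partial>Q0)"
      using ramp_bounds[OF that] by (intro integral_mono ramp_int ind_int that) (auto simp: space_Q0 indicator_def)
    then show ?thesis using sets by (simp add: space_Q0 Int_absorb2)
  qed
  have low: "measure Q0 {0..p} \<le> (\<integral>x. ramp p q x \<partial>Q0)" if "p < q" for p q
  proof -
    have "(\<integral>x. indicator {0..p} x \<partial>Q0) \<le> (\<integral>x. ramp p q x \<partial>Q0)"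
      using ramp_bounds[OF that] by (intro integral_mono ramp_int ind_int that) (auto simp: space_Q0 indicator_def)
    then show ?thesis using sets by (simp add: space_Q0 Int_absorb2)
  qed
  have cont: "\<exists>d>0. \<forall>y\<ge>0. \<bar>y - x\<bar> < d \<longrightarrow> \<bar>measure Q0 {0..y} - measure Q0 {0..x}\<bar> < e" if "0 < e" for e
    using G0(1) x that unfolding continuous_on_iff by (fastforce simp: dist_real_def)
  show ?thesis
  proof (rule order_tendstoI)
    fix z assume z: "measure Q0 {0..x} < z"
    obtain d where d: "d > 0" "\<And>y. 0 \<le> y \<Longrightarrow> \<bar>y - x\<bar> < d \<Longrightarrow> \<bar>measure Q0 {0..y} - measure Q0 {0..x}\<bar> < z - measure Q0 {0..x}"
      using cont[of "z - measure Q0 {0..x}"] z by auto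
    obtain p where p: "p \<in> \<rat>" "x < p" "p < x + d" using Rats_dense_in_real[of x "x + d"] d by auto
    obtain q where q: "q \<in> \<rat>" "p < q" "q < x + d" using Rats_dense_in_real[of p "x + d"] p by auto
    have "measure Q0 {0..q} < z" using d(2)[of q] p q x by (simp add: abs_less_iff)
    then have "(\<integral>x. ramp p q x \<partial>Q0) < z" using up[OF q(2)] by simp
    then have "\<forall>\<^sub>F j in \<F>. (\<Sum>i\<in>I j. ramp p q (L j i)) / n j < z"
      by (rule order_tendstoD(2)[OF lim[OF p(1) q(1,2)]])
    then show "\<forall>\<^sub>F j in \<F>. ncard {i \<in> I j. L j i \<le> x} / n j < z"
    proof eventually_elim
      case (elim j)
      have "ncard {i \<in> I j. L j i \<le> x} = (\<Sum>i\<in>I j. if L j i \<le> x then 1 else 0)"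
        using fin[of j] by (simp add: sum.If_cases Int_def)
      also have "\<dots> \<le> (\<Sum>i\<in>I j. ramp p q (L j i))"
        using ramp_bounds[OF q(2)] p by (intro sum_mono) auto
      finally show ?case using elim n[of j] by (meson divide_right_mono le_less_trans less_imp_le)
    qed
  next
    fix z assume z: "z < measure Q0 {0..x}"
    show "\<forall>\<^sub>F j in \<F>. z < ncard {i \<in> I j. L j i \<le> x} / n j"
    \<comment> \<open>A lower ramp needs room between 0 and \<open>x\<close>. At
      \<open>x = 0\<close> the limit is 0, and counts are nonnegative anyway.\<close>
    proof (cases "x = 0")
      case True
      then have "z < 0" using z G0(2) by simp
      moreover have "0 \<le> ncard {i \<in> I j. L j i \<le> x} / n j" for j using n[of j] by simp
      ultimately show ?thesis by (intro always_eventually allI) (meson less_le_trans)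
    next
      case False
      obtain d where d: "d > 0" "\<And>y. 0 \<le> y \<Longrightarrow> \<bar>y - x\<bar> < d \<Longrightarrow> \<bar>measure Q0 {0..y} - measure Q0 {0..x}\<bar> < measure Q0 {0..x} - z"
        using cont[of "measure Q0 {0..x} - z"] z by auto
      obtain p where p: "p \<in> \<rat>" "max 0 (x - d) < p" "p < x"
        using Rats_dense_in_real[of "max 0 (x - d)" x] d x False by auto
      obtain q where q: "q \<in> \<rat>" "p < q" "q < x" using Rats_dense_in_real[of p x] p by auto
      have "z < measure Q0 {0..p}" using d(2)[of p] p by (simp add: abs_less_iff)
      then have "z < (\<integral>x. ramp p q x \<partial>Q0)" using low[OF q(2)] by simp
      then have "\<forall>\<^sub>F j in \<F>. z < (\<Sum>i\<in>I j. ramp p q (L j i)) / n j"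
        by (rule order_tendstoD(1)[OF lim[OF p(1) q(1,2)]])
      then show ?thesis
      proof eventually_elim
        case (elim j)
        have "(\<Sum>i\<in>I j. ramp p q (L j i)) \<le> (\<Sum>i\<in>I j. if L j i \<le> x then 1 else 0)"
          using ramp_bounds[OF q(2)] q by (intro sum_mono) (auto simp: not_le)
        also have "\<dots> = ncard {i \<in> I j. L j i \<le> x}"
          using fin[of j] by (simp add: sum.If_cases Int_def)
        finally show ?case using elim n[of j] by (meson divide_right_mono less_le_trans less_imp_le)
      qed
    qed
  qed
qed

section \<open>Renewal counts, arrival times and continuity points\<close>

lemma renewal_count_ge_iff:
  fixes T :: "nat \<Rightarrow> real"
  assumes pos: "\<And>k. 0 < T k" and unb: "\<exists>n. t < (\<Sum>k<n. T k)"
  shows "k \<le> renewal_count T t \<longleftrightarrow> k = 0 \<or> (\<Sum>i<k. T i) \<le> t"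
proof -
  let ?A = "{n. 0 < n \<and> (\<Sum>k<n. T k) \<le> t}"
  have mono: "(\<Sum>k<m. T k) \<le> (\<Sum>k<n. T k)" if "m \<le> n" for m n
    using that pos by (intro sum_mono2) (auto intro: less_imp_le)
  obtain n0 where n0: "t < (\<Sum>k<n0. T k)" using unb by blast
  have sub: "?A \<subseteq> {1..<m}" if "t < (\<Sum>k<m. T k)" for m
    using that mono by (force simp: not_less[symmetric])
  \<comment> \<open>Finiteness is the point where unbounded partial sums matter: \<open>card\<close>
    of an infinite set would be 0.\<close>
  then have "finite ?A" using n0 finite_subset by blast
  show ?thesis
  proof (cases "k = 0 \<or> (\<Sum>i<k. T i) \<le> t")
    case True
    have "{1..k} \<subseteq> ?A"
    proof
      fix m assume "m \<in> {1..k}"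
      then show "m \<in> ?A" using True mono[of m k] by auto
    qed
    then have "k \<le> card ?A" using card_mono[OF \<open>finite ?A\<close>, of "{1..k}"] by simp
    then show ?thesis using True by (simp add: renewal_count_def)
  next
    case False
    then have "card ?A \<le> card {1..<k}" by (intro card_mono sub) auto
    moreover have "0 < k" using False by simp
    ultimately have "card ?A < k" unfolding card_atLeastLessThan by linarith
    then show ?thesis using False by (simp add: renewal_count_def)
  qed
qed

text \<open>The count reaches \<open>k\<close> iff the first \<open>k\<close> intervals fit into the
  available time, so limits of partial sums at rational \<open>q\<close> on either side of
  \<open>\<rho> * t\<close> squeeze it. Thus countably many laws of large numbers suffice.\<close>

lemma renewal_count_limit:
  fixes T :: "nat \<Rightarrow> real" and N :: "nat \<Rightarrow> nat" and rate :: "nat \<Rightarrow> real"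
  assumes pos: "\<And>k. 0 < T k" and unb: "\<And>t. \<exists>n. t < (\<Sum>k<n. T k)"
    and N: "filterlim (\<lambda>j. real (N j)) at_top sequentially" and N_pos: "\<And>j. 0 < N j"
    and rate: "(\<lambda>j. rate j / real (N j)) \<longlonglongrightarrow> \<rho>"
    and sums: "\<And>q. q \<in> \<rat> \<Longrightarrow> 0 < q \<Longrightarrow> (\<lambda>j. (\<Sum>k<ticks q (N j). T k) / real (N j)) \<longlonglongrightarrow> q"
    and t: "0 \<le> t" and \<rho>: "0 < \<rho>"
  shows "(\<lambda>j. real (renewal_count T (rate j * t)) / real (N j)) \<longlonglongrightarrow> \<rho> * t"
proof -
  have rt: "(\<lambda>j. rate j * t / real (N j)) \<longlonglongrightarrow> \<rho> * t"
    using tendsto_mult_right[OF rate, of t] by simp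
  show ?thesis
  proof (rule order_tendstoI)
    fix z assume "\<rho> * t < z"
    then obtain q where q: "q \<in> \<rat>" "\<rho> * t < q" "q < z" using Rats_dense_in_real by blast
    have "0 \<le> \<rho> * t" using t \<rho> by simp
    then have "0 < q" using q by linarith
    have "(\<lambda>j. (\<Sum>k<ticks q (N j). T k) / real (N j) - rate j * t / real (N j)) \<longlonglongrightarrow> q - \<rho> * t"
      by (intro tendsto_diff sums q \<open>0 < q\<close> rt)
    then have "\<forall>\<^sub>F j in sequentially. 0 < (\<Sum>k<ticks q (N j). T k) / real (N j) - rate j * t / real (N j)"
      using q by (intro order_tendstoD(1)) auto
    then show "\<forall>\<^sub>F j in sequentially. real (renewal_count T (rate j * t)) / real (N j) < z"
      using filterlim_at_top_dense[THEN iffD1, OF N, rule_format, of "1 / q"]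
    proof eventually_elim
      case (elim j)
      have "rate j * t < (\<Sum>k<ticks q (N j). T k)"
        using elim(1) N_pos[of j] by (simp add: zero_less_divide_iff divide_less_0_iff flip: diff_divide_distrib)
      \<comment> \<open>Rules out \<open>ticks q (N j) = 0\<close>, where the inversion in
        \<open>renewal_count_ge_iff\<close> says nothing.\<close>
      moreover have "1 \<le> q * real (N j)" using elim(2) \<open>0 < q\<close> by (simp add: field_simps)
      then have "ticks q (N j) \<noteq> 0" by linarith
      ultimately have "\<not> ticks q (N j) \<le> renewal_count T (rate j * t)"
        using renewal_count_ge_iff[OF pos unb] by (simp add: not_le)
      then have "real (renewal_count T (rate j * t)) < q * real (N j)"
        using \<open>1 \<le> q * real (N j)\<close> by linarith
      then have "real (renewal_count T (rate j * t)) / real (N j) < q"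
        using N_pos[of j] by (simp add: divide_less_eq)
      then show ?case using q by simp
    qed
  next
    fix z assume z: "z < \<rho> * t"
    show "\<forall>\<^sub>F j in sequentially. z < real (renewal_count T (rate j * t)) / real (N j)"
    proof (cases "z < 0")
      case True
      then show ?thesis by (intro always_eventually allI) (auto intro: less_le_trans)
    next
      case False
      obtain q where q: "q \<in> \<rat>" "z < q" "q < \<rho> * t" using z Rats_dense_in_real by blast
      have "0 < q" using False q by simp
      have "(\<lambda>j. (\<Sum>k<ticks q (N j). T k) / real (N j) - rate j * t / real (N j)) \<longlonglongrightarrow> q - \<rho> * t"
        by (intro tendsto_diff sums q \<open>0 < q\<close> rt)
      then have "\<forall>\<^sub>F j in sequentially. (\<Sum>k<ticks q (N j). T k) / real (N j) - rate j * t / real (N j) < 0"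
        using q by (intro order_tendstoD(2)) auto
      then show ?thesis
        using filterlim_at_top_dense[THEN iffD1, OF N, rule_format, of "1 / (q - z)"]
      proof eventually_elim
        case (elim j)
        have "(\<Sum>k<ticks q (N j). T k) \<le> rate j * t"
          using elim(1) N_pos[of j] by (simp add: zero_less_divide_iff divide_less_0_iff flip: diff_divide_distrib)
        then have "ticks q (N j) \<le> renewal_count T (rate j * t)"
          using renewal_count_ge_iff[OF pos unb] by simp
        then have "q * real (N j) - 1 < real (renewal_count T (rate j * t))" by linarith
        \<comment> \<open>Rounding in \<open>ticks\<close> loses less than 1, which the gap between
          \<open>z\<close> and \<open>q\<close> absorbs.\<close>
        moreover have "1 < (q - z) * real (N j)" using elim(2) q by (simp add: field_simps)
        ultimately have "z * real (N j) < real (renewal_count T (rate j * t))" by (simp add: algebra_simps)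
        then show ?case using N_pos[of j] by (simp add: field_simps)
      qed
    qed
  qed
qed

text \<open>The infimum that defines an arrival time is attained: the set is the closed half-line
  that starts at the \<open>i\<close>-th renewal.\<close>

lemma renewal_arrival_iff:
  fixes T :: "nat \<Rightarrow> real"
  assumes pos: "\<And>k. 0 < T k" and unb: "\<And>t. \<exists>n. t < (\<Sum>k<n. T k)" and rate: "0 < rate"
    and a: "a = Inf {t. 0 \<le> t \<and> i \<le> int (renewal_count T (rate * t))}" and i: "1 \<le> i"
  shows "a \<le> t \<longleftrightarrow> i \<le> int (renewal_count T (rate * t))"
proof -
  let ?s = "(\<Sum>k<nat i. T k) / rate"
  have s: "0 \<le> ?s" using pos rate by (simp add: sum_nonneg less_imp_le)
  have iff: "i \<le> int (renewal_count T (rate * t)) \<longleftrightarrow> ?s \<le> t" for t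
    using renewal_count_ge_iff[OF pos unb, of "nat i" "rate * t"] i rate
    by (auto simp: field_simps nat_le_iff)
  then have "{t. 0 \<le> t \<and> i \<le> int (renewal_count T (rate * t))} = {?s..}" using s by auto
  then have "a = ?s" using a by simp
  then show ?thesis using iff by simp
qed

text \<open>A monotone function has countably many discontinuities while intervals are uncountable.
  One continuity point is picked for each pair of rationals, which keeps the set countable as
  \<open>AE_subsequence\<close> demands.\<close>

lemma countable_dense_continuity_points:
  fixes G :: "real \<Rightarrow> real"
  assumes "mono G"
  shows "\<exists>D. countable D \<and> (\<forall>x\<in>D. isCont G x) \<and> (\<forall>x y. x < y \<longrightarrow> (\<exists>z\<in>D. x < z \<and> z < y))"
proof -
  have cnt: "countable {x. \<not> isCont G x}" using mono_ctble_discont[OF assms] .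
  have "\<exists>z. isCont G z \<and> x < z \<and> z < y" if xy: "x < y" for x y
  proof -
    have "uncountable {x<..<y}" using xy by (simp add: uncountable_open_interval)
    then have "\<not> {x<..<y} \<subseteq> {x. \<not> isCont G x}" using cnt countable_subset by blast
    then show ?thesis by auto
  qed
  then obtain c where c: "\<And>x y. x < y \<Longrightarrow> isCont G (c x y) \<and> x < c x y \<and> c x y < y" by metis
  define D where "D = (\<lambda>(p, q). c p q) ` {(p, q). p \<in> \<rat> \<and> q \<in> \<rat> \<and> p < q}"
  have "countable (\<rat> \<times> (\<rat> :: real set))" by (intro countable_SIGMA countable_rat)
  then have "countable D" unfolding D_def by (intro countable_image) (rule countable_subset, auto)
  moreover have "\<forall>x\<in>D. isCont G x" using c by (auto simp: D_def)
  moreover have "\<exists>z\<in>D. x < z \<and> z < y" if xy: "x < y" for x y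
  proof -
    obtain p where p: "p \<in> \<rat>" "x < p" "p < y" using Rats_dense_in_real[OF xy] by auto
    obtain q where q: "q \<in> \<rat>" "p < q" "q < y" using Rats_dense_in_real[OF p(3)] by auto
    have "c p q \<in> D" using p q by (auto simp: D_def)
    then show ?thesis using c[OF q(2)] p q by (meson less_trans)
  qed
  ultimately show ?thesis by blast
qed

section \<open>Laws of large numbers\<close>

abbreviation (in prob_space) null_in_prob :: "(nat \<Rightarrow> 'a \<Rightarrow> real) \<Rightarrow> bool" where
  "null_in_prob Z \<equiv> (\<lambda>N. \<integral>w. min 1 \<bar>Z N w\<bar> \<partial>M) \<longlonglongrightarrow> 0"

text \<open>A diagonal argument in one stroke: convergence of all \<open>z k N\<close> in probability is convergence of
  \<open>\<Sum>k. (1/2)^k * min 1 \<bar>z k N\<bar>\<close> in mean.\<close>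

lemma (in prob_space) AE_subsequence:
  fixes F :: "(nat \<Rightarrow> 'a \<Rightarrow> real) set"
  assumes F: "countable F"
    and meas: "\<And>Z N. Z \<in> F \<Longrightarrow> N > 0 \<Longrightarrow> Z N \<in> borel_measurable M"
    and lim: "\<And>Z. Z \<in> F \<Longrightarrow> null_in_prob Z"
    and r: "strict_mono (r :: nat \<Rightarrow> nat)"
  shows "\<exists>s. strict_mono s \<and> (\<forall>j. 0 < r (s j)) \<and> (AE w in M. \<forall>Z\<in>F. (\<lambda>j. Z (r (s j)) w) \<longlonglongrightarrow> 0)"
proof (cases "F = {}")
  case True
  have "0 < r (Suc j)" for j using strict_monoD[OF r, of 0 "Suc j"] by simp
  then show ?thesis using True by (intro exI[of _ Suc]) (auto simp: strict_mono_def)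
next
  case False
  define z where "z = from_nat_into F"
  have z: "z k \<in> F" for k using False by (simp add: z_def from_nat_into)
  have surj: "\<exists>k. Z = z k" if "Z \<in> F" for Z
    using from_nat_into_surj[OF F that] by (auto simp: z_def)
  \<comment> \<open>Dropping the first term of a strictly increasing sequence guarantees positive
    indices.\<close>
  define g where "g j = r (Suc j)" for j
  have g: "strict_mono g" using r by (auto simp: g_def strict_mono_def)
  have g_pos: "0 < g j" for j using strict_monoD[OF r, of 0 "Suc j"] by (simp add: g_def)
  have [measurable]: "z k (g j) \<in> borel_measurable M" for k j using meas z g_pos by blast
  \<comment> \<open>Partial sums suffice because \<open>z k\<close> takes part from
    \<open>j = k\<close> on; all integrals then involve finite sums only.\<close>
  define W where "W j w = (\<Sum>k\<le>j. (1/2)^k * min 1 \<bar>z k (g j) w\<bar>)" for j w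
  have int: "integrable M (\<lambda>w. min 1 \<bar>z k (g j) w\<bar>)" for k j
    by (rule integrable_const_bound[of _ 1]) auto
  define I where "I k j = (\<integral>w. min 1 \<bar>z k (g j) w\<bar> \<partial>M)" for k j
  have I01: "0 \<le> I k j" "I k j \<le> 1" for k j
  proof -
    show "0 \<le> I k j" unfolding I_def by (rule integral_nonneg_AE) auto
    have "I k j \<le> (\<integral>w. 1 \<partial>M)" unfolding I_def by (intro integral_mono int) auto
    then show "I k j \<le> 1" by (simp add: prob_space)
  qed
  have W_int: "integrable M (W j)" for j
    unfolding W_def by (intro Bochner_Integration.integrable_sum integrable_mult_right int)
  have W_nonneg: "0 \<le> W j w" for j w unfolding W_def by (intro sum_nonneg) auto
  have W_eq: "(\<integral>w. norm (W j w) \<partial>M) = (\<Sum>k. if k \<le> j then (1/2)^k * I k j else 0)" for j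
  proof -
    have "(\<integral>w. norm (W j w) \<partial>M) = (\<integral>w. W j w \<partial>M)" using W_nonneg by simp
    also have "\<dots> = (\<Sum>k\<le>j. (1/2)^k * I k j)"
      unfolding W_def I_def using int by (subst Bochner_Integration.integral_sum) auto
    also have "\<dots> = (\<Sum>k\<le>j. if k \<le> j then (1/2)^k * I k j else 0)" by simp
    also have "\<dots> = (\<Sum>k. if k \<le> j then (1/2)^k * I k j else 0)"
      by (rule suminf_finite[symmetric]) auto
    finally show ?thesis .
  qed
  have "(\<lambda>j. \<Sum>k. if k \<le> j then (1/2)^k * I k j else 0) \<longlonglongrightarrow> (\<Sum>k::nat. 0)"
  \<comment> \<open>Dominated convergence for series: the \<open>k\<close>-th term is at most
    \<open>(1/2)^k\<close> since \<open>I k j \<le> 1\<close>.\<close>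
  proof (rule conjunct2[OF conjunct2[OF tannerys_theorem]])
    fix k
    have "(\<lambda>j. I k j) \<longlonglongrightarrow> 0"
      unfolding I_def using LIMSEQ_subseq_LIMSEQ[OF lim[OF z] g, of k] by (simp add: comp_def)
    then have "(\<lambda>j. (1/2)^k * I k j) \<longlonglongrightarrow> 0" by (rule tendsto_mult_right_zero)
    then show "(\<lambda>j. if k \<le> j then (1/2)^k * I k j else 0) \<longlonglongrightarrow> 0"
      by (rule Lim_transform_eventually) (use eventually_ge_at_top[of k] in eventually_elim, simp)
    show "summable (\<lambda>k. (1/2::real)^k)" by (rule summable_geometric) simp
    show "\<forall>\<^sub>F (k, j) in sequentially \<times>\<^sub>F sequentially. norm (if k \<le> j then (1/2)^k * I k j else 0) \<le> (1/2)^k"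
      using I01 by (intro always_eventually) (auto simp: abs_mult intro!: mult_left_le)
  qed simp
  then have "(\<lambda>j. \<integral>w. norm (W j w) \<partial>M) \<longlonglongrightarrow> 0" by (simp only: W_eq suminf_zero)
  from tendsto_L1_AE_subseq[OF W_int this]
  obtain s where s: "strict_mono s" "AE w in M. (\<lambda>j. W (s j) w) \<longlonglongrightarrow> 0" by auto
  have "AE w in M. \<forall>Z\<in>F. (\<lambda>j. Z (g (s j)) w) \<longlonglongrightarrow> 0"
    using s(2)
  proof (rule AE_mp, intro AE_I2 impI ballI)
    fix w Z assume W0: "(\<lambda>j. W (s j) w) \<longlonglongrightarrow> 0" and "Z \<in> F"
    then obtain k where Z: "Z = z k" using surj by auto
    \<comment> \<open>Multiplication by \<open>2^k\<close> isolates the \<open>k\<close>-th term,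
      which belongs to the partial sum once \<open>k \<le> s j\<close>.\<close>
    have "(\<lambda>j. 2^k * W (s j) w) \<longlonglongrightarrow> 2^k * 0" by (intro tendsto_intros W0)
    moreover have "\<forall>\<^sub>F j in sequentially. norm (min 1 \<bar>Z (g (s j)) w\<bar>) \<le> 2^k * W (s j) w"
      using eventually_ge_at_top[of k]
    proof eventually_elim
      case (elim j)
      then have "k \<le> s j" using seq_suble[OF s(1), of j] by simp
      then have "(1/2)^k * min 1 \<bar>z k (g (s j)) w\<bar> \<le> W (s j) w"
        unfolding W_def by (intro member_le_sum) auto
      then have "2^k * ((1/2)^k * min 1 \<bar>z k (g (s j)) w\<bar>) \<le> 2^k * W (s j) w" by simp
      then show ?case by (simp add: Z power_divide)
    qed
    ultimately have "(\<lambda>j. min 1 \<bar>Z (g (s j)) w\<bar>) \<longlonglongrightarrow> 0"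
      unfolding mult_zero_right by (rule Lim_null_comparison[rotated])
    then have small: "\<forall>\<^sub>F j in sequentially. min 1 \<bar>Z (g (s j)) w\<bar> < e" if "0 < e" for e
      by (rule order_tendstoD(2)[OF _ that])
    have "\<forall>\<^sub>F j in sequentially. dist (Z (g (s j)) w) 0 < e" if "0 < e" for e
    proof -
      have "0 < min 1 e" using that by simp
      from small[OF this] show ?thesis by eventually_elim (auto simp: dist_real_def min_def split: if_splits)
    qed
    then show "(\<lambda>j. Z (g (s j)) w) \<longlonglongrightarrow> 0" by (intro tendstoI)
  qed
  then show ?thesis
    using s(1) g_pos unfolding g_def by (intro exI[of _ "\<lambda>j. Suc (s j)"]) (auto simp: strict_mono_def)
qed

text \<open>Centred independent summands are orthogonal, so the second moment of the sum is at most
  \<open>ncard I * B * B\<close>, and the first absolute moment is at most its square root.\<close>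

lemma (in prob_space) L1_indep_sum:
  fixes X :: "'i \<Rightarrow> 'a \<Rightarrow> real"
  assumes ind: "indep_vars (\<lambda>_. borel) X I" and fin: "finite I"
    and bd: "\<And>i w. i \<in> I \<Longrightarrow> \<bar>X i w\<bar> \<le> B"
  shows "integrable M (\<lambda>w. \<bar>\<Sum>i\<in>I. X i w - expectation (X i)\<bar>)"
    and "(\<integral>w. \<bar>\<Sum>i\<in>I. X i w - expectation (X i)\<bar> \<partial>M) \<le> 2 * B * sqrt (ncard I)"
proof -
  have m: "X i \<in> borel_measurable M" if "i \<in> I" for i
    using ind that by (auto simp: indep_vars_def)
  have int: "integrable M (X i)" if "i \<in> I" for i
    using m[OF that] bd[OF that] by (intro integrable_const_bound[of _ B]) auto
  have int2: "integrable M (\<lambda>w. X i w * X j w)" if "i \<in> I" "j \<in> I" for i j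
    using m that bd[OF that(1)] bd[OF that(2)]
    by (intro integrable_const_bound[of _ "B * B"]) (auto simp: abs_mult intro!: mult_mono order_trans[OF abs_ge_zero])
  define Y where "Y i w = X i w - expectation (X i)" for i w
  have YY: "(\<integral>w. Y i w * Y j w \<partial>M) = (\<integral>w. X i w * X j w \<partial>M) - expectation (X i) * expectation (X j)"
    if "i \<in> I" "j \<in> I" for i j
  proof -
    have "(\<integral>w. Y i w * Y j w \<partial>M) = (\<integral>w. X i w * X j w - expectation (X i) * X j w
        - expectation (X j) * X i w + expectation (X i) * expectation (X j) \<partial>M)"
      unfolding Y_def by (intro Bochner_Integration.integral_cong) (auto simp: algebra_simps)
    then show ?thesis using int int2 that by (simp add: prob_space)
  qed
  have intYY: "integrable M (\<lambda>w. Y i w * Y j w)" if "i \<in> I" "j \<in> I" for i j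
  proof -
    have "integrable M (\<lambda>w. X i w * X j w - expectation (X i) * X j w
        - expectation (X j) * X i w + expectation (X i) * expectation (X j))"
      using int int2 that by simp
    then show ?thesis unfolding Y_def by (rule Bochner_Integration.integrable_cong[THEN iffD1, rotated -1]) (auto simp: algebra_simps)
  qed
  have off: "(\<integral>w. Y i w * Y j w \<partial>M) = 0" if "i \<in> I" "j \<in> I" "i \<noteq> j" for i j
  proof -
    have "indep_vars (\<lambda>_. borel) X {i, j}" using indep_vars_subset[OF ind, of "{i, j}"] that by simp
    then have "(\<integral>w. (\<Prod>k\<in>{i, j}. X k w) \<partial>M) = (\<Prod>k\<in>{i, j}. \<integral>w. X k w \<partial>M)"
      using int that by (intro indep_vars_lebesgue_integral) auto
    then show ?thesis using that YY[of i j] by simp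
  qed
  have diag: "(\<integral>w. Y i w * Y i w \<partial>M) \<le> B\<^sup>2" if "i \<in> I" for i
  proof -
    have "(\<integral>w. X i w * X i w \<partial>M) \<le> (\<integral>w. B\<^sup>2 \<partial>M)"
      using int2[OF that that] bd[OF that]
      by (intro integral_mono) (auto simp: power2_eq_square abs_le_square_iff[symmetric] intro: order_trans[OF _ abs_ge_self]
         simp flip: power2_eq_square)
    then show ?thesis using YY[OF that that] by (simp add: prob_space) (smt (verit) zero_le_square)
  qed
  define Z where "Z w = \<bar>\<Sum>i\<in>I. Y i w\<bar>" for w
  have Zm: "Z \<in> borel_measurable M" unfolding Z_def Y_def using m by (intro borel_measurable_abs borel_measurable_sum borel_measurable_diff) auto
  have Z2: "(Z w)\<^sup>2 = (\<Sum>i\<in>I. \<Sum>j\<in>I. Y i w * Y j w)" for w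
    by (simp add: Z_def power2_eq_square sum_product)
  have Z2_int: "integrable M (\<lambda>w. (Z w)\<^sup>2)"
    unfolding Z2 using intYY by (intro Bochner_Integration.integrable_sum)
  have Z_int: "integrable M Z"
    unfolding Z_def Y_def using int by (intro integrable_abs Bochner_Integration.integrable_sum Bochner_Integration.integrable_diff) auto
  have "(\<integral>w. (Z w)\<^sup>2 \<partial>M) = (\<Sum>i\<in>I. \<Sum>j\<in>I. \<integral>w. Y i w * Y j w \<partial>M)"
    unfolding Z2 using intYY
    by (subst Bochner_Integration.integral_sum, (intro Bochner_Integration.integrable_sum; blast))
      (intro sum.cong refl Bochner_Integration.integral_sum; blast)
  also have "\<dots> = (\<Sum>i\<in>I. \<integral>w. Y i w * Y i w \<partial>M)"
  proof (rule sum.cong[OF refl])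
    fix i assume "i \<in> I"
    then have "(\<Sum>j\<in>I. \<integral>w. Y i w * Y j w \<partial>M) = (\<Sum>j\<in>I. if j = i then \<integral>w. Y i w * Y i w \<partial>M else 0)"
      using off by (intro sum.cong) auto
    then show "(\<Sum>j\<in>I. \<integral>w. Y i w * Y j w \<partial>M) = (\<integral>w. Y i w * Y i w \<partial>M)"
      using \<open>i \<in> I\<close> fin by simp
  qed
  also have "\<dots> \<le> (\<Sum>i\<in>I. B\<^sup>2)" by (intro sum_mono diag)
  finally have "(\<integral>w. (Z w)\<^sup>2 \<partial>M) \<le> ncard I * B\<^sup>2" by simp
  \<comment> \<open>Nonnegativity of the variance of \<open>Z\<close>.\<close>
  moreover have "(\<integral>w. Z w \<partial>M)\<^sup>2 \<le> (\<integral>w. (Z w)\<^sup>2 \<partial>M)"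
    using variance_eq[OF Z_int Z2_int] variance_positive[of Z] by simp
  ultimately have "(\<integral>w. Z w \<partial>M)\<^sup>2 \<le> (\<bar>B\<bar> * sqrt (ncard I))\<^sup>2"
    by (simp add: power_mult_distrib mult.commute)
  then have "(\<integral>w. Z w \<partial>M) \<le> \<bar>B\<bar> * sqrt (ncard I)"
    by (rule power2_le_imp_le) auto
  \<comment> \<open>Only a member of \<open>I\<close> forces \<open>B\<close> to be nonnegative; if
    there is none, both sides are 0.\<close>
  also have "\<dots> \<le> 2 * B * sqrt (ncard I)"
  proof (cases "I = {}")
    case False
    then have "0 \<le> B" using bd abs_ge_zero order_trans by blast
    then show ?thesis by (intro mult_right_mono) auto
  qed simp
  finally show "(\<integral>w. \<bar>\<Sum>i\<in>I. X i w - expectation (X i)\<bar> \<partial>M) \<le> 2 * B * sqrt (ncard I)"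
    by (simp add: Z_def Y_def)
  show "integrable M (\<lambda>w. \<bar>\<Sum>i\<in>I. X i w - expectation (X i)\<bar>)"
    using Z_int unfolding Z_def[abs_def] Y_def .
qed

text \<open>Fluctuation about the mean plus distance of the mean from the target \<open>z\<close>.
  It serves truncated renewal intervals as well as indicators of short lead times.\<close>

lemma (in prob_space) L1_indep_average:
  fixes X :: "'i \<Rightarrow> 'a \<Rightarrow> real" and N :: nat
  assumes ind: "indep_vars (\<lambda>_. borel) X I" and fin: "finite I"
    and bd: "\<And>i w. i \<in> I \<Longrightarrow> \<bar>X i w\<bar> \<le> B" and mean: "\<And>i. i \<in> I \<Longrightarrow> expectation (X i) = \<mu>"
  shows "integrable M (\<lambda>w. \<bar>(\<Sum>i\<in>I. X i w) / real N - z\<bar>)"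
    and "(\<integral>w. \<bar>(\<Sum>i\<in>I. X i w) / real N - z\<bar> \<partial>M) \<le>
      2 * B * sqrt (ncard I) / real N + \<bar>ncard I / real N * \<mu> - z\<bar>"
proof -
  note L1 = L1_indep_sum[OF ind fin bd]
  let ?D = "\<lambda>w. \<bar>\<Sum>i\<in>I. X i w - expectation (X i)\<bar>" and ?r = "\<bar>ncard I / real N * \<mu> - z\<bar>"
  have int: "integrable M (X i)" if "i \<in> I" for i
    using ind bd[OF that] that by (intro integrable_const_bound[of _ B]) (auto simp: indep_vars_def)
  show 1: "integrable M (\<lambda>w. \<bar>(\<Sum>i\<in>I. X i w) / real N - z\<bar>)"
    by (intro integrable_abs Bochner_Integration.integrable_diff integrable_divide_zero
        Bochner_Integration.integrable_sum int) simp_all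
  have "(\<integral>w. \<bar>(\<Sum>i\<in>I. X i w) / real N - z\<bar> \<partial>M) \<le> (\<integral>w. ?D w / real N + ?r \<partial>M)"
  proof (rule integral_mono[OF 1])
    show "integrable M (\<lambda>w. ?D w / real N + ?r)" using L1(1) by simp
    fix w
    have "(\<Sum>i\<in>I. X i w) / real N - z =
        (\<Sum>i\<in>I. X i w - expectation (X i)) / real N + (ncard I / real N * \<mu> - z)"
      by (simp add: sum_subtractf mean diff_divide_distrib)
    moreover have "\<bar>(\<Sum>i\<in>I. X i w - expectation (X i)) / real N\<bar> = ?D w / real N" by simp
    ultimately show "\<bar>(\<Sum>i\<in>I. X i w) / real N - z\<bar> \<le> ?D w / real N + ?r"
      by (metis abs_triangle_ineq)
  qed
  also have "\<dots> = (\<integral>w. ?D w \<partial>M) / real N + ?r" using L1(1) by (simp add: prob_space)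
  also have "\<dots> \<le> 2 * B * sqrt (ncard I) / real N + ?r"
    using L1(2) by (intro add_mono divide_right_mono) auto
  finally show "(\<integral>w. \<bar>(\<Sum>i\<in>I. X i w) / real N - z\<bar> \<partial>M) \<le>
      2 * B * sqrt (ncard I) / real N + ?r" .
qed

lemma (in prob_space) integrable_distr_cong:
  fixes X Y :: "'a \<Rightarrow> real"
  assumes "integrable M X" "Y \<in> borel_measurable M" "distr M borel Y = distr M borel X"
  shows "integrable M Y"
proof -
  have "integrable (distr M borel X) (\<lambda>x. x)" using assms(1) by (subst integrable_distr_eq) auto
  then have "integrable (distr M borel Y) (\<lambda>x. x)" by (simp add: assms(3))
  then show ?thesis using assms(2) by (subst (asm) integrable_distr_eq) auto
qed

lemma sqrt_over_scale_tendsto_0: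
  fixes n :: "nat \<Rightarrow> nat"
  assumes "(\<lambda>N. real (n N) / real N) \<longlonglongrightarrow> q"
  shows "(\<lambda>N. C * sqrt (real (n N)) / real N) \<longlonglongrightarrow> 0"
proof -
  have "(\<lambda>N. C * (sqrt (real (n N) / real N) * sqrt (1 / real N))) \<longlonglongrightarrow> C * (sqrt q * sqrt 0)"
    by (intro tendsto_intros assms lim_1_over_n)
  moreover have "sqrt (real (n N) / real N) * sqrt (1 / real N) = sqrt (real (n N)) / real N" for N
    by (simp add: real_sqrt_divide)
  ultimately show ?thesis by simp
qed

text \<open>Only a first moment is available, so the intervals are truncated at \<open>c\<close>.
  The truncated ones obey the second moment bound, and the mean truncation error
  \<open>\<delta> c\<close> is paid twice: for replacing the summands and for the shift of their
  mean. A large \<open>c\<close> is fixed before \<open>N\<close> tends to infinity.\<close>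

lemma (in prob_space) weak_law_L1:
  fixes T :: "nat \<Rightarrow> 'a \<Rightarrow> real" and n :: "nat \<Rightarrow> nat"
  assumes ind: "indep_vars (\<lambda>_. borel) T UNIV"
    and distr: "\<And>k. distr M borel (T k) = distr M borel (T 0)"
    and int0: "integrable M (T 0)" and mean: "expectation (T 0) = 1"
    and n: "(\<lambda>N. real (n N) / real N) \<longlonglongrightarrow> q"
  shows "(\<lambda>N. \<integral>w. \<bar>(\<Sum>k<n N. T k w) / real N - q\<bar> \<partial>M) \<longlonglongrightarrow> 0"
proof -
  have m[measurable]: "T k \<in> borel_measurable M" for k
    using ind by (auto simp: indep_vars_def)
  have trans: "(\<integral>w. f (T k w) \<partial>M) = (\<integral>w. f (T 0 w) \<partial>M)" if "f \<in> borel_measurable borel" for f :: "real \<Rightarrow> real" and k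
    using that integral_distr[OF m, of f k] integral_distr[OF m, of f 0] distr[of k] by simp
  have int: "integrable M (T k)" for k by (rule integrable_distr_cong[OF int0 m distr])
  define clip where "clip c x = max (- c) (min c x)" for c x :: real
  have [measurable]: "clip c \<in> borel_measurable borel" for c unfolding clip_def by measurable
  have clip_bd: "\<bar>clip c x\<bar> \<le> c" if "0 \<le> c" for c x using that by (auto simp: clip_def)
  have clip_err: "\<bar>x - clip c x\<bar> \<le> \<bar>x\<bar>" if "0 \<le> c" for c x using that by (auto simp: clip_def)
  define \<delta> where "\<delta> c = (\<integral>w. \<bar>T 0 w - clip c (T 0 w)\<bar> \<partial>M)" for c
  have clip_int: "integrable M (\<lambda>w. clip c (T k w))" if "0 \<le> c" for c k
    using clip_bd[OF that] by (intro integrable_const_bound[of _ c]) auto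
  have \<delta>_lim: "(\<lambda>m. \<delta> (real m)) \<longlonglongrightarrow> 0"
  proof -
    have "(\<lambda>m. \<delta> (real m)) \<longlonglongrightarrow> (\<integral>w. 0 \<partial>M)"
      unfolding \<delta>_def
    proof (rule integral_dominated_convergence[where w = "\<lambda>w. \<bar>T 0 w\<bar>"])
      show "AE w in M. (\<lambda>m. \<bar>T 0 w - clip (real m) (T 0 w)\<bar>) \<longlonglongrightarrow> 0"
      proof (intro AE_I2 tendsto_eventually)
        fix w
        obtain m0 :: nat where "\<bar>T 0 w\<bar> < real m0" using reals_Archimedean2 by blast
        then show "\<forall>\<^sub>F m in sequentially. \<bar>T 0 w - clip (real m) (T 0 w)\<bar> = 0"
          by (intro eventually_sequentiallyI[of m0]) (auto simp: clip_def)
      qed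
      show "AE w in M. norm \<bar>T 0 w - clip (real m) (T 0 w)\<bar> \<le> \<bar>T 0 w\<bar>" for m
        using clip_err[of "real m"] by auto
    qed (use int0 in auto)
    then show ?thesis by simp
  qed
  have \<delta>_nonneg: "0 \<le> \<delta> c" for c unfolding \<delta>_def by (rule integral_nonneg_AE) auto
  have bound: "(\<integral>w. \<bar>(\<Sum>k<n N. T k w) / real N - q\<bar> \<partial>M) \<le>
      2 * c * sqrt (real (n N)) / real N + 2 * (real (n N) / real N) * \<delta> c + \<bar>real (n N) / real N - q\<bar>"
    if c: "0 \<le> c" for c N
  proof -
    define Y where "Y k w = clip c (T k w)" for k w
    have Y: "indep_vars (\<lambda>_. borel) Y {..<n N}"
      unfolding Y_def by (rule indep_vars_subset[OF indep_vars_compose2[OF ind]]) auto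
    have Y_bd: "\<bar>Y k w\<bar> \<le> c" for k w using clip_bd[OF c] by (simp add: Y_def)
    have EY: "expectation (Y k) = expectation (Y 0)" for k
      unfolding Y_def by (rule trans) measurable
    let ?p = "real (n N) / real N" and ?E = "expectation (Y 0)"
    note L1 = L1_indep_average[OF Y finite_lessThan Y_bd EY, of N q, unfolded card_lessThan]
    have "\<bar>?E - 1\<bar> = \<bar>\<integral>w. Y 0 w - T 0 w \<partial>M\<bar>"
      unfolding Y_def using clip_int[OF c] int0 mean by simp
    also have "\<dots> \<le> (\<integral>w. \<bar>Y 0 w - T 0 w\<bar> \<partial>M)" by (rule integral_abs_bound)
    finally have "?p * \<bar>?E - 1\<bar> \<le> ?p * \<delta> c"
      by (intro mult_left_mono) (auto simp: \<delta>_def Y_def abs_minus_commute)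
    moreover have "\<bar>?p * ?E - q\<bar> \<le> \<bar>?p * (?E - 1)\<bar> + \<bar>?p - q\<bar>"
      using abs_triangle_ineq[of "?p * (?E - 1)" "?p - q"] by (simp add: right_diff_distrib)
    ultimately have EY1: "\<bar>?p * ?E - q\<bar> \<le> ?p * \<delta> c + \<bar>?p - q\<bar>" by (simp add: abs_mult)
    have err: "(\<integral>w. \<bar>T k w - Y k w\<bar> \<partial>M) = \<delta> c" for k
      unfolding Y_def \<delta>_def by (rule trans[of "\<lambda>x. \<bar>x - clip c x\<bar>"]) measurable
    have err_int: "integrable M (\<lambda>w. \<bar>T k w - Y k w\<bar>)" for k
      unfolding Y_def using int clip_int[OF c] by (intro integrable_abs Bochner_Integration.integrable_diff) auto
    have "(\<integral>w. \<bar>(\<Sum>k<n N. T k w) / real N - q\<bar> \<partial>M) \<le>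
        (\<integral>w. \<bar>(\<Sum>k<n N. Y k w) / real N - q\<bar> + (\<Sum>k<n N. \<bar>T k w - Y k w\<bar>) / real N \<partial>M)"
    proof (rule integral_mono)
      show "integrable M (\<lambda>w. \<bar>(\<Sum>k<n N. T k w) / real N - q\<bar>)"
        by (intro integrable_abs Bochner_Integration.integrable_diff integrable_divide_zero
            Bochner_Integration.integrable_sum int) simp_all
      show "integrable M (\<lambda>w. \<bar>(\<Sum>k<n N. Y k w) / real N - q\<bar> + (\<Sum>k<n N. \<bar>T k w - Y k w\<bar>) / real N)"
        by (intro Bochner_Integration.integrable_add integrable_divide_zero
            Bochner_Integration.integrable_sum L1(1) err_int)
      fix w
      have *: "(\<Sum>k<n N. T k w) / real N - q = ((\<Sum>k<n N. Y k w) / real N - q) + (\<Sum>k<n N. T k w - Y k w) / real N"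
        by (simp add: sum_subtractf diff_divide_distrib)
      have "\<bar>(\<Sum>k<n N. T k w - Y k w) / real N\<bar> \<le> (\<Sum>k<n N. \<bar>T k w - Y k w\<bar>) / real N"
        using sum_abs[of "\<lambda>k. T k w - Y k w" "{..<n N}"] by (simp add: divide_right_mono)
      then show "\<bar>(\<Sum>k<n N. T k w) / real N - q\<bar> \<le>
          \<bar>(\<Sum>k<n N. Y k w) / real N - q\<bar> + (\<Sum>k<n N. \<bar>T k w - Y k w\<bar>) / real N"
        unfolding * by (intro order_trans[OF abs_triangle_ineq] add_left_mono)
    qed
    also have "\<dots> = (\<integral>w. \<bar>(\<Sum>k<n N. Y k w) / real N - q\<bar> \<partial>M) + ?p * \<delta> c"
      using L1(1) err_int by (simp add: Bochner_Integration.integral_sum err)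
    also have "\<dots> \<le> (2 * c * sqrt (real (n N)) / real N + \<bar>?p * ?E - q\<bar>) + ?p * \<delta> c"
      by (intro add_right_mono L1(2))
    also have "\<dots> \<le> (2 * c * sqrt (real (n N)) / real N + (?p * \<delta> c + \<bar>?p - q\<bar>)) + ?p * \<delta> c"
      by (intro add_right_mono add_left_mono EY1)
    finally show ?thesis by (simp add: algebra_simps)
  qed
  show ?thesis
  proof (rule LIMSEQ_I)
    fix e :: real assume "0 < e"
    have "(\<lambda>m. 2 * q * \<delta> (real m)) \<longlonglongrightarrow> 2 * q * 0" by (intro tendsto_intros \<delta>_lim)
    then have "\<forall>\<^sub>F m in sequentially. 2 * q * \<delta> (real m) < e" using \<open>0 < e\<close> order_tendstoD(2) by force
    then obtain m where m: "2 * q * \<delta> (real m) < e" by (auto simp: eventually_sequentially)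
    have "(\<lambda>N. 2 * real m * sqrt (real (n N)) / real N + 2 * (real (n N) / real N) * \<delta> (real m)
        + \<bar>real (n N) / real N - q\<bar>) \<longlonglongrightarrow> 0 + 2 * q * \<delta> (real m) + \<bar>q - q\<bar>"
      by (intro tendsto_intros n sqrt_over_scale_tendsto_0[OF n])
    then have "\<forall>\<^sub>F N in sequentially. 2 * real m * sqrt (real (n N)) / real N + 2 * (real (n N) / real N) * \<delta> (real m)
        + \<bar>real (n N) / real N - q\<bar> < e"
      using m order_tendstoD(2) by force
    then have "\<forall>\<^sub>F N in sequentially. norm ((\<integral>w. \<bar>(\<Sum>k<n N. T k w) / real N - q\<bar> \<partial>M) - 0) < e"
    proof eventually_elim
      case (elim N)
      have "0 \<le> (\<integral>w. \<bar>(\<Sum>k<n N. T k w) / real N - q\<bar> \<partial>M)" by (rule integral_nonneg_AE) auto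
      then show ?case using bound[of "real m" N] elim by simp
    qed
    then show "\<exists>no. \<forall>N\<ge>no. norm ((\<integral>w. \<bar>(\<Sum>k<n N. T k w) / real N - q\<bar> \<partial>M) - 0) < e"
      by (simp add: eventually_sequentially)
  qed
qed

text \<open>The law changes with \<open>N\<close>, so the lead times form a triangular array; the
  second moment bound treats each row by itself and yields convergence in mean.\<close>

lemma (in prob_space) lead_count_L1:
  fixes u :: "nat \<Rightarrow> 'a \<Rightarrow> int \<Rightarrow> real" and n :: "nat \<Rightarrow> nat"
  assumes ind: "\<And>N. N > 0 \<Longrightarrow> indep_vars (\<lambda>_. borel) (\<lambda>i w. u N w i) {1..}"
    and law: "\<And>N i. N > 0 \<Longrightarrow> 1 \<le> i \<Longrightarrow> distr M borel (\<lambda>w. u N w i) = nuN N"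
    and n: "(\<lambda>N. real (n N) / real N) \<longlonglongrightarrow> q"
    and G: "(\<lambda>N. cdf (nuN N) x) \<longlonglongrightarrow> g"
  shows "(\<lambda>N. \<integral>w. \<bar>ncard {i. 1 \<le> i \<and> i \<le> int (n N) \<and> u N w i \<le> x} / real N - q * g\<bar> \<partial>M) \<longlonglongrightarrow> 0"
    and "\<And>N. N > 0 \<Longrightarrow> (\<lambda>w. ncard {i. 1 \<le> i \<and> i \<le> int (n N) \<and> u N w i \<le> x}) \<in> borel_measurable M"
proof -
  define X where "X N i w = (indicator {..x} (u N w i) :: real)" for N i w
  have card_eq: "ncard {i. 1 \<le> i \<and> i \<le> int (n N) \<and> u N w i \<le> x} = (\<Sum>i\<in>{1..int (n N)}. X N i w)" for N w
  proof -
    have "{i. 1 \<le> i \<and> i \<le> int (n N) \<and> u N w i \<le> x} = {1..int (n N)} \<inter> {i. u N w i \<le> x}" by auto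
    then show ?thesis by (simp add: X_def indicator_def sum.If_cases)
  qed
  have m: "(\<lambda>w. u N w i) \<in> borel_measurable M" if "N > 0" "1 \<le> i" for N i
    using ind[OF that(1)] that(2) by (auto simp: indep_vars_def)
  have Xm: "X N i \<in> borel_measurable M" if "N > 0" "1 \<le> i" for N i
    unfolding X_def using m[OF that] by measurable
  show "(\<lambda>w. ncard {i. 1 \<le> i \<and> i \<le> int (n N) \<and> u N w i \<le> x}) \<in> borel_measurable M" if "N > 0" for N
    unfolding card_eq using Xm that by (intro borel_measurable_sum) auto
  have bound: "(\<integral>w. \<bar>ncard {i. 1 \<le> i \<and> i \<le> int (n N) \<and> u N w i \<le> x} / real N - q * g\<bar> \<partial>M)
      \<le> 2 * 1 * sqrt (real (n N)) / real N + \<bar>real (n N) / real N * cdf (nuN N) x - q * g\<bar>" if "N > 0" for N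
  proof -
    have ind': "indep_vars (\<lambda>_. borel) (X N) {1..int (n N)}"
      unfolding X_def
      by (rule indep_vars_subset[OF indep_vars_compose2[OF ind[OF that], where Y = "\<lambda>_. indicator {..x}"]]) auto
    have X_bd: "\<bar>X N i w\<bar> \<le> 1" for i w by (simp add: X_def indicator_def)
    have EX: "expectation (X N i) = cdf (nuN N) x" if "1 \<le> i" for i
    proof -
      have "expectation (X N i) = (\<integral>y. indicator {..x} y \<partial>distr M borel (\<lambda>w. u N w i))"
        unfolding X_def using m[OF \<open>N > 0\<close> that] by (subst integral_distr) auto
      also have "\<dots> = measure (nuN N) {..x}" 
        using law[OF \<open>N > 0\<close> that, symmetric] by simp
      finally show ?thesis by (simp add: cdf_def)
    qed
    show ?thesis
      using L1_indep_average(2)[OF ind' finite_atLeastAtMost_int X_bd EX, of N "q * g"] by (simp add: card_eq)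
  qed
  have "(\<lambda>N. 2 * 1 * sqrt (real (n N)) / real N + \<bar>real (n N) / real N * cdf (nuN N) x - q * g\<bar>)
      \<longlonglongrightarrow> 0 + \<bar>q * g - q * g\<bar>"
    by (intro tendsto_intros n G sqrt_over_scale_tendsto_0[OF n])
  then have "(\<lambda>N. 2 * 1 * sqrt (real (n N)) / real N + \<bar>real (n N) / real N * cdf (nuN N) x - q * g\<bar>) \<longlonglongrightarrow> 0" by simp
  then show "(\<lambda>N. \<integral>w. \<bar>ncard {i. 1 \<le> i \<and> i \<le> int (n N) \<and> u N w i \<le> x} / real N - q * g\<bar> \<partial>M) \<longlonglongrightarrow> 0"
  proof (rule tendsto_sandwich[OF _ _ tendsto_const, rotated -1])
    show "\<forall>\<^sub>F N in sequentially. 0 \<le> (\<integral>w. \<bar>ncard {i. 1 \<le> i \<and> i \<le> int (n N) \<and> u N w i \<le> x} / real N - q * g\<bar> \<partial>M)"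
      by (intro always_eventually allI integral_nonneg_AE) auto
  qed (use bound in \<open>auto intro!: eventually_sequentiallyI[of 1]\<close>)
qed

section \<open>Sample paths\<close>

text \<open>The state at \<open>t\<close> itself is left open, a single point being negligible for
  the integral. This form is needed at the first idle time, where positivity is still to be
  shown.\<close>

lemma busy_time_eq:
  assumes "0 \<le> t" "\<And>s. 0 \<le> s \<Longrightarrow> s < t \<Longrightarrow> X s > 0"
  shows "busy_time X t = t"
proof -
  have "((\<lambda>_. 1) has_integral t) {0..t}"
    using has_integral_const_real[of "1::real" 0 t] assms(1) by simp
  then have "((\<lambda>s. if X s > 0 then 1 else 0 :: real) has_integral t) {0..t}"
    by (rule has_integral_spike[of "{t}", rotated 2]) (use assms(2) in auto)
  then show ?thesis
    unfolding busy_time_def by (rule integral_unique)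
qed

lemma real_card_Diff_subset:
  assumes "finite B" "A \<subseteq> B"
  shows "ncard (B - A) = ncard B - ncard A"
  using assms by (simp add: card_Diff_subset finite_subset of_nat_diff card_mono)

text \<open>What the paths under study provide in addition: the infimum in \<open>arrival\<close> is
  attained for renewal processes, these have no renewal at time 0, and the initial queue has
  positive limiting mass.\<close>

locale edf_run = edf_path +
  assumes arrived_iff: "1 \<le> i \<Longrightarrow> 0 \<le> t \<Longrightarrow> a i \<le> t \<longleftrightarrow> i \<le> int (E t)"
    and no_arrival_at_0: "E 0 = 0"
    and initially_nonempty: "X 0 > 0"
begin

definition customers :: "int set" where "customers = {i. 1 - int (X 0) \<le> i}"

definition due :: "int \<Rightarrow> real" where "due i = a i + u i"

definition started :: "real \<Rightarrow> int set" where
  "started t = {i \<in> customers. b i \<le> ereal t}"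

definition due_by :: "real \<Rightarrow> int set" where
  "due_by t = {i \<in> customers. due i \<le> t}"

definition arrivals :: "real \<Rightarrow> real \<Rightarrow> int set" where
  "arrivals s d = {i. 1 \<le> i \<and> a i \<le> s \<and> due i \<le> d}"

text \<open>At time 0 lead times and deadlines coincide, so the cardinality is the mass that the
  initial queue measure gives to lead times up to \<open>x\<close>.\<close>

definition initial :: "real \<Rightarrow> int set" where
  "initial x = {i \<in> queued (X 0) a u b 0. due i \<le> x}"

section \<open>Bookkeeping of arrivals, starts and deadlines\<close>

lemma arrival_pos: "1 \<le> i \<Longrightarrow> a i > 0"
  using arrived_iff[of i 0] no_arrival_at_0 by auto

lemma due_gt: "i \<in> customers \<Longrightarrow> a i < due i"
  using lead_pos by (auto simp: customers_def due_def)

lemma started_before_due: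
  "i \<in> customers \<Longrightarrow> b i \<le> ereal t \<Longrightarrow> ereal (a i) \<le> b i \<and> b i < ereal (due i)"
  using start[of i] by (cases "b i = \<infinity>") (auto simp: customers_def due_def)

lemma b_finite: "i \<in> customers \<Longrightarrow> b i \<le> ereal t \<Longrightarrow> \<exists>s. b i = ereal s"
  using started_before_due[of i t] by (cases "b i") auto

lemma queued_eq: "queued (X 0) a u b t = {i \<in> customers. a i \<le> t \<and> ereal t < b i \<and> t < due i}"
  by (auto simp: queued_def customers_def due_def lead_time_def)

lemma reneged_eq: "reneged (X 0) a u b t = {i \<in> customers. due i \<le> t \<and> ereal (due i) \<le> b i}"
  by (auto simp: reneged_def customers_def due_def)

lemma customers_arrived:
  assumes "0 \<le> t"
  shows "{i \<in> customers. a i \<le> t} = {1 - int (X 0)..int (E t)}"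
proof (intro set_eqI iffI; clarsimp simp: customers_def)
  fix i assume i: "1 - int (X 0) \<le> i" "a i \<le> t"
  then show "i \<le> int (E t)" using arrived_iff[of i t] assms by (cases "1 \<le> i") auto
next
  fix i assume i: "1 - int (X 0) \<le> i" "i \<le> int (E t)"
  then show "a i \<le> t" using arrived_iff[of i t] initial_arrival[of i] assms by (cases "1 \<le> i") auto
qed

lemma finite_customers_arrived: "0 \<le> t \<Longrightarrow> finite {i \<in> customers. a i \<le> t}"
  using customers_arrived by simp

lemma finite_due_by: "0 \<le> t \<Longrightarrow> finite (due_by t)"
  by (rule finite_subset[OF _ finite_customers_arrived[of t]])
    (force simp: due_by_def dest: due_gt)

lemma finite_started: "0 \<le> t \<Longrightarrow> finite (started t)"
  by (rule finite_subset[OF _ finite_customers_arrived[of t]])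
    (auto simp: started_def dest: started_before_due intro: order_trans simp flip: ereal_less_eq(3))

lemma finite_initial: "finite (initial x)"
  using queue_length[of 0] by (auto simp: initial_def)

lemma arrivals_subset: "0 \<le> s \<Longrightarrow> arrivals s d \<subseteq> {1..int (E s)}"
  using arrived_iff by (auto simp: arrivals_def)

lemma finite_arrivals: "0 \<le> s \<Longrightarrow> finite (arrivals s d)"
  using arrivals_subset finite_subset by blast

lemma initial_subset: "initial x \<subseteq> {1 - int (X 0)..0}"
proof
  fix i assume "i \<in> initial x"
  then have "i \<in> customers" "a i \<le> 0" by (auto simp: initial_def queued_eq)
  then show "i \<in> {1 - int (X 0)..0}"
    using arrival_pos[of i] by (cases "1 \<le> i") (auto simp: customers_def)
qed

text \<open>Every customer who has arrived by \<open>t\<close> has started, reneged or is still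
  queued. Starting and reneging exclude each other because \<open>start\<close> puts each start
  strictly before the deadline.\<close>

lemma card_started:
  assumes "0 \<le> t"
  shows "card (started t) + R t + (X t - 1) = X 0 + E t"
proof -
  let ?Q = "queued (X 0) a u b t" and ?R = "reneged (X 0) a u b t"
  have "{i \<in> customers. a i \<le> t} = started t \<union> ?R \<union> ?Q"
  proof (intro set_eqI iffI)
    fix i assume "i \<in> {i \<in> customers. a i \<le> t}"
    then show "i \<in> started t \<union> ?R \<union> ?Q"
      using order_trans[of "ereal (due i)" "ereal t" "b i"]
      by (auto simp: started_def reneged_eq queued_eq not_le not_less)
  next
    fix i assume "i \<in> started t \<union> ?R \<union> ?Q"
    then show "i \<in> {i \<in> customers. a i \<le> t}"
      using due_gt[of i] started_before_due[of i t] order_trans[of "ereal (a i)" "b i" "ereal t"]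
      by (auto simp: started_def reneged_eq queued_eq)
  qed
  moreover have "started t \<inter> ?R = {}"
    using started_before_due by (fastforce simp: started_def reneged_eq)
  moreover have "(started t \<union> ?R) \<inter> ?Q = {}"
    by (auto simp: started_def reneged_eq queued_eq)
  ultimately have "card {i \<in> customers. a i \<le> t} = card (started t) + card ?R + card ?Q"
    using assms finite_started reneging queue_length by (simp add: card_Un_disjoint)
  then show ?thesis
    using customers_arrived[OF assms] reneging[OF assms] queue_length[OF assms] by simp
qed

text \<open>The surplus 1 over the completions is the customer in service.\<close>

lemma card_started_busy:
  assumes "0 \<le> t" "\<And>s. 0 \<le> s \<Longrightarrow> s \<le> t \<Longrightarrow> X s > 0"
  shows "card (started t) = S t + 1"
proof -
  have "busy_time X t = t" using assms by (intro busy_time_eq) auto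
  then show ?thesis
    using card_started[OF assms(1)] balance[OF assms(1)] assms(2)[of t] assms(1)
    by (auto simp: of_nat_diff)
qed

lemma finite_started_between:
  "0 \<le> t \<Longrightarrow> finite {i \<in> customers. ereal s < b i \<and> b i \<le> ereal t}"
  by (rule finite_subset[OF _ finite_started[of t]]) (auto simp: started_def)

text \<open>The customer in service cancels in the difference, so that starts and completions agree
  exactly.\<close>

lemma card_started_between:
  assumes "0 \<le> s" "s \<le> t" "\<And>r. 0 \<le> r \<Longrightarrow> r \<le> t \<Longrightarrow> X r > 0"
  shows "ncard {i \<in> customers. ereal s < b i \<and> b i \<le> ereal t} = real (S t) - real (S s)"
proof -
  have "{i \<in> customers. ereal s < b i \<and> b i \<le> ereal t} = started t - started s"
    by (auto simp: started_def)
  moreover have sub: "started s \<subseteq> started t"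
    using assms(2) by (auto simp: started_def intro: order_trans simp flip: ereal_less_eq(3))
  ultimately show ?thesis
    using card_started_busy[of s] card_started_busy[of t] assms finite_started
    by (simp add: real_card_Diff_subset)
qed

text \<open>The two sides differ at most by the one initial customer who is not queued at time 0. A
  later customer with deadline at most \<open>t\<close> has also arrived by \<open>t\<close>, lead
  times being positive.\<close>

lemma card_initial_arrivals:
  assumes "0 \<le> t"
  shows "card (initial t) + card (arrivals t t) \<le> card (due_by t)"
    and "card (due_by t) \<le> card (initial t) + card (arrivals t t) + 1"
proof -
  have disj: "initial t \<inter> arrivals t t = {}"
    using initial_subset by (fastforce simp: arrivals_def)
  then have c: "card (initial t \<union> arrivals t t) = card (initial t) + card (arrivals t t)"
    using assms finite_initial finite_arrivals by (intro card_Un_disjoint) auto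
  have "initial t \<union> arrivals t t \<subseteq> due_by t"
    by (auto simp: initial_def arrivals_def due_by_def queued_eq customers_def)
  with c show "card (initial t) + card (arrivals t t) \<le> card (due_by t)"
    using card_mono[OF finite_due_by[OF assms]] by metis
  let ?I = "{1 - int (X 0)..0}" and ?Q = "queued (X 0) a u b 0"
  have sub: "?Q \<subseteq> ?I"
  proof
    fix i assume "i \<in> ?Q"
    then have "i \<in> initial (due i)" by (simp add: initial_def)
    then show "i \<in> ?I" using initial_subset by blast
  qed
  have Q: "finite ?Q" "card ?Q = X 0 - 1" using queue_length[of 0] by auto
  then have "card (?I - ?Q) = 1"
    using sub initially_nonempty by (simp add: card_Diff_subset)
  moreover have "due_by t \<subseteq> (initial t \<union> arrivals t t) \<union> (?I - ?Q)"
  proof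
    fix i assume "i \<in> due_by t"
    then show "i \<in> (initial t \<union> arrivals t t) \<union> (?I - ?Q)"
      using due_gt[of i]
      by (cases "1 \<le> i") (auto simp: due_by_def initial_def arrivals_def customers_def)
  qed
  then have "card (due_by t) \<le> card ((initial t \<union> arrivals t t) \<union> (?I - ?Q))"
    using assms finite_initial finite_arrivals by (intro card_mono) auto
  then have "card (due_by t) \<le> card (initial t \<union> arrivals t t) + card (?I - ?Q)"
    using card_Un_le order_trans by blast
  ultimately show "card (due_by t) \<le> card (initial t) + card (arrivals t t) + 1"
    using c by simp
qed

section \<open>Reneging and service starts compared with arrivals\<close>

lemma reneged_mono: "s \<le> t \<Longrightarrow> reneged (X 0) a u b s \<subseteq> reneged (X 0) a u b t"
  by (auto simp: reneged_eq)

lemma R_mono: "0 \<le> s \<Longrightarrow> s \<le> t \<Longrightarrow> R s \<le> R t"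
  using reneged_mono[of s t] reneging[of s] reneging[of t] card_mono[of "reneged (X 0) a u b t" "reneged (X 0) a u b s"] by simp

lemma reneged_due_pos: "i \<in> reneged (X 0) a u b t \<Longrightarrow> due i > 0"
  using reneging[of 0] no_initial_reneging by (force simp: reneged_eq)

lemma reneging_lower:
  assumes "0 \<le> s" "\<And>r. 0 \<le> r \<Longrightarrow> r \<le> s \<Longrightarrow> X r > 0"
  shows "card (initial s) + card (arrivals s s) \<le> R s + S s + 1"
proof -
  have "due_by s \<subseteq> reneged (X 0) a u b s \<union> started s"
  proof
    fix i assume "i \<in> due_by s"
    then show "i \<in> reneged (X 0) a u b s \<union> started s"
      using order_trans[of "b i" "ereal (due i)" "ereal s"]
      by (cases "ereal (due i) \<le> b i") (auto simp: due_by_def reneged_eq started_def)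
  qed
  then have "card (due_by s) \<le> card (reneged (X 0) a u b s \<union> started s)"
    using assms reneging finite_started by (intro card_mono) auto
  \<comment> \<open>The started customers include the one in service, whom \<open>S s\<close> does
    not count.\<close>
  also have "\<dots> \<le> R s + (S s + 1)"
    using card_Un_le[of "reneged (X 0) a u b s" "started s"] reneging[of s] card_started_busy[of s] assms by auto
  finally show ?thesis using card_initial_arrivals(1)[of s] assms by simp
qed

text \<open>Those who reneged by \<open>\<tau>\<close> and those who started after time 0 and up to
  \<open>s\<close> are disjoint, and all of them are due by \<open>\<tau> + c\<close>. Starts at
  time 0 are beyond the reach of \<open>earliest_deadline\<close>, hence the term
  \<open>S 0\<close>; taking \<open>s < \<tau>\<close> fits the hypothesis on starts strictly before
  \<open>\<tau>\<close>.\<close>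

lemma reneging_upper_good:
  assumes s: "0 \<le> s" "s < \<tau>" and busy: "\<And>r. 0 \<le> r \<Longrightarrow> r \<le> s \<Longrightarrow> X r > 0" and "0 \<le> c"
    and good: "\<And>i. i \<in> customers \<Longrightarrow> 0 < b i \<Longrightarrow> b i < ereal \<tau> \<Longrightarrow> due i \<le> \<tau> + c"
  shows "real (R \<tau>) \<le> ncard (initial (\<tau> + c)) + ncard (arrivals (\<tau> + c) (\<tau> + c))
           - real (S s) + real (S 0) + 1"
proof -
  let ?B = "{i \<in> customers. ereal 0 < b i \<and> b i \<le> ereal s}"
  let ?R = "reneged (X 0) a u b \<tau>"
  have "?R \<inter> ?B = {}"
    using started_before_due by (fastforce simp: reneged_eq)
  moreover have "finite ?R" "card ?R = R \<tau>" using reneging[of \<tau>] s by auto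
  moreover have "finite ?B" using finite_started_between[of s 0] s by simp
  ultimately have "card (?R \<union> ?B) = R \<tau> + card ?B"
    by (simp add: card_Un_disjoint)
  moreover have "?R \<union> ?B \<subseteq> due_by (\<tau> + c)"
  proof
    fix i assume "i \<in> ?R \<union> ?B"
    then show "i \<in> due_by (\<tau> + c)"
    proof
      assume "i \<in> ?R" then show ?thesis using \<open>0 \<le> c\<close> by (auto simp: reneged_eq due_by_def)
    next
      assume "i \<in> ?B"
      then have "b i < ereal \<tau>" using s by (auto intro: le_less_trans)
      with \<open>i \<in> ?B\<close> show ?thesis using good[of i] by (auto simp: due_by_def zero_ereal_def)
    qed
  qed
  then have "card (?R \<union> ?B) \<le> card (due_by (\<tau> + c))"
    using s \<open>0 \<le> c\<close> by (intro card_mono finite_due_by) auto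
  moreover have "ncard ?B = real (S s) - real (S 0)"
    using s busy by (intro card_started_between) auto
  ultimately show ?thesis
    using card_initial_arrivals(2)[of "\<tau> + c"] s \<open>0 \<le> c\<close> by linarith
qed

lemma arrivals_mono: "s \<le> s' \<Longrightarrow> d \<le> d' \<Longrightarrow> arrivals s d \<subseteq> arrivals s' d'"
  by (auto simp: arrivals_def)

text \<open>At a common instant lead times are ordered like deadlines. A customer \<open>j\<close>
  with an earlier, unexpired deadline who has not started can be passed over at
  \<open>\<sigma>\<close> only by being absent.\<close>

lemma earliest_deadline_due:
  assumes "i \<in> customers" "b i = ereal \<sigma>" "0 < \<sigma>" "j \<in> customers" "due j < due i"
    "ereal \<sigma> < b j" "\<sigma> < due j"
  shows "\<sigma> < a j"
  using earliest_deadline[of i \<sigma> j] assms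
  by (force simp: customers_def queued_eq lead_time_def due_def not_le[symmetric])

text \<open>The last late start \<open>\<sigma>\<close> exists because finitely many customers have
  started by \<open>\<tau>\<close>. Comparison with that late customer by
  \<open>earliest_deadline_due\<close> applies to those served afterwards and equally to
  \<open>k\<close>, who is unserved before the deadline \<open>\<tau>\<close>. Services are counted
  up to \<open>s < \<tau>\<close>, where the server is known to be busy.\<close>

lemma reneging_bad:
  assumes k: "k \<in> customers" "due k = \<tau>" "ereal \<tau> \<le> b k"
    and bad: "i' \<in> customers" "0 < b i'" "b i' < ereal \<tau>" "\<tau> + c < due i'" and "0 \<le> c"
    and busy: "\<And>r. 0 \<le> r \<Longrightarrow> r < \<tau> \<Longrightarrow> X r > 0"
  shows "\<exists>\<sigma> i. 0 < \<sigma> \<and> \<sigma> < \<tau> \<and> i \<in> customers \<and> b i = ereal \<sigma> \<and> \<tau> + c < due i \<and> \<sigma> < a k \<and>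
    (\<forall>s. \<sigma> \<le> s \<and> s < \<tau> \<longrightarrow> real (S s) - real (S \<sigma>) \<le>
      ncard (arrivals \<tau> (\<tau> + c)) - ncard (arrivals \<sigma> (\<tau> + c)))"
proof -
  define B where "B = {i \<in> customers. 0 < b i \<and> b i < ereal \<tau> \<and> \<tau> + c < due i}"
  have "\<tau> > 0" using bad by (metis ereal_less(2) less_trans)
  have "finite B"
    by (rule finite_subset[OF _ finite_started[of \<tau>]]) (use \<open>\<tau> > 0\<close> in \<open>auto simp: B_def started_def\<close>)
  moreover have "i' \<in> B" using bad by (simp add: B_def)
  ultimately obtain i where i: "i \<in> B" "\<And>j. j \<in> B \<Longrightarrow> b j \<le> b i"
    by (metis (mono_tags) Max_ge Max_in empty_iff finite_imageI imageE imageI image_is_empty)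
  obtain \<sigma> where \<sigma>: "b i = ereal \<sigma>" using i(1) b_finite[of i \<tau>] by (auto simp: B_def less_imp_le)
  have s: "0 < \<sigma>" "\<sigma> < \<tau>" "i \<in> customers" "\<tau> + c < due i"
    using i(1) \<sigma> by (auto simp: B_def zero_ereal_def)
  have "\<sigma> < a k"
    using k s \<open>0 \<le> c\<close> \<sigma> less_le_trans[of "ereal \<sigma>" "ereal \<tau>" "b k"]
    by (intro earliest_deadline_due[of i \<sigma> k]) auto
  moreover have "real (S s) - real (S \<sigma>) \<le>
      ncard (arrivals \<tau> (\<tau> + c)) - ncard (arrivals \<sigma> (\<tau> + c))" if "\<sigma> \<le> s" "s < \<tau>" for s
  proof -
    let ?W = "{j \<in> customers. ereal \<sigma> < b j \<and> b j \<le> ereal s}"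
    have "?W \<subseteq> arrivals \<tau> (\<tau> + c) - arrivals \<sigma> (\<tau> + c)"
    proof
      fix j assume j: "j \<in> ?W"
      then obtain r where r: "b j = ereal r" using b_finite[of j s] by auto
      then have *: "0 < b j" "b j < ereal \<tau>" "\<sigma> < due j" "a j \<le> \<tau>"
        using started_before_due[of j s] j s that by auto
      \<comment> \<open>Otherwise \<open>j\<close> would be a late customer who starts after the
        last late start.\<close>
      have d: "due j \<le> \<tau> + c"
      proof (rule ccontr)
        assume "\<not> due j \<le> \<tau> + c"
        then have "j \<in> B" using * j by (auto simp: B_def)
        then show False using i(2)[of j] j \<sigma> by auto
      qed
      have "\<sigma> < a j"
        using s d * j \<sigma> by (intro earliest_deadline_due[of i \<sigma> j]) auto
      moreover have "1 \<le> j"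
        using \<open>\<sigma> < a j\<close> s j initial_arrival[of j] by (cases "1 \<le> j") (auto simp: customers_def)
      ultimately show "j \<in> arrivals \<tau> (\<tau> + c) - arrivals \<sigma> (\<tau> + c)"
        using d * by (auto simp: arrivals_def)
    qed
    then have "card ?W \<le> card (arrivals \<tau> (\<tau> + c) - arrivals \<sigma> (\<tau> + c))"
      using \<open>\<tau> > 0\<close> finite_arrivals by (intro card_mono) auto
    also have "real \<dots> = ncard (arrivals \<tau> (\<tau> + c)) - ncard (arrivals \<sigma> (\<tau> + c))"
      using s \<open>\<tau> > 0\<close> finite_arrivals arrivals_mono[of \<sigma> \<tau> "\<tau> + c" "\<tau> + c"]
      by (intro real_card_Diff_subset) auto
    moreover have "ncard ?W = real (S s) - real (S \<sigma>)"
      using s that busy by (intro card_started_between) auto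
    ultimately show ?thesis by simp
  qed
  ultimately show ?thesis using s \<sigma> by blast
qed

text \<open>If someone starts at \<open>\<sigma>\<close> with lead time above \<open>y\<close>, then
  by earliest-deadline-first nobody with deadline in \<open>(\<sigma>, \<sigma> + y]\<close> is left
  waiting. All such arrivals since \<open>r\<close> have therefore started since \<open>r\<close>,
  which bounds the services from below. The second form counts from time 0 and adds the initial
  customers; it serves starts too early for a full window before \<open>\<sigma>\<close>.\<close>

lemma frontier:
  assumes i: "i \<in> customers" "b i = ereal \<sigma>" "0 < \<sigma>" "\<sigma> + y < due i" and "0 \<le> y"
    and busy: "\<And>r. 0 \<le> r \<Longrightarrow> r \<le> \<sigma> \<Longrightarrow> X r > 0"
  shows frontier_arrivals: "\<And>r. 0 \<le> r \<Longrightarrow> r \<le> \<sigma> \<Longrightarrow>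
      (ncard (arrivals \<sigma> (\<sigma> + y)) - ncard (arrivals r (\<sigma> + y)))
      - (ncard (arrivals \<sigma> \<sigma>) - ncard (arrivals r \<sigma>)) \<le> real (S \<sigma>) - real (S r)"
      (is "\<And>r. _ \<Longrightarrow> _ \<Longrightarrow> ?Arr r")
    and frontier_initial:
      "(ncard (initial (\<sigma> + y)) - ncard (initial \<sigma>))
       + (ncard (arrivals \<sigma> (\<sigma> + y)) - ncard (arrivals \<sigma> \<sigma>)) \<le> real (S \<sigma>) - real (S 0)" (is ?Ini)
proof -
  have served: "b j \<le> ereal \<sigma>" if "j \<in> customers" "a j \<le> \<sigma>" "\<sigma> < due j" "due j \<le> \<sigma> + y" for j
    using earliest_deadline_due[OF i(1-3), of j] that i(4) by (force simp: not_le[symmetric])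
  {
    fix r assume r: "0 \<le> r" "r \<le> \<sigma>"
    let ?A = "arrivals \<sigma> (\<sigma> + y) - arrivals r (\<sigma> + y)" and ?C = "arrivals \<sigma> \<sigma> - arrivals r \<sigma>"
    have fin: "finite ?A" "finite ?C" using finite_arrivals i(3) by auto
    \<comment> \<open>Removing \<open>?C\<close> discards those whose deadline has passed by
      \<open>\<sigma>\<close>: they may have reneged instead of being served.\<close>
    have "?C \<subseteq> ?A" using \<open>0 \<le> y\<close> by (auto simp: arrivals_def)
    then have "ncard (?A - ?C) = ncard ?A - ncard ?C"
      using fin by (intro real_card_Diff_subset) auto
    moreover have "ncard ?A = ncard (arrivals \<sigma> (\<sigma> + y)) - ncard (arrivals r (\<sigma> + y))"
      using finite_arrivals r i(3) arrivals_mono[of r \<sigma> "\<sigma> + y" "\<sigma> + y"]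
      by (intro real_card_Diff_subset) auto
    moreover have "ncard ?C = ncard (arrivals \<sigma> \<sigma>) - ncard (arrivals r \<sigma>)"
      using finite_arrivals r i(3) arrivals_mono[of r \<sigma> \<sigma> \<sigma>]
      by (intro real_card_Diff_subset) auto
    moreover have "?A - ?C \<subseteq> {j \<in> customers. ereal r < b j \<and> b j \<le> ereal \<sigma>}"
    proof
      fix j assume "j \<in> ?A - ?C"
      then have j: "1 \<le> j" "a j \<le> \<sigma>" "due j \<le> \<sigma> + y" "r < a j" "\<sigma> < due j"
        by (auto simp: arrivals_def)
      then have "j \<in> customers" by (simp add: customers_def)
      then show "j \<in> {j \<in> customers. ereal r < b j \<and> b j \<le> ereal \<sigma>}"
        using served[of j] j started_before_due[of j \<sigma>]
          less_le_trans[of "ereal r" "ereal (a j)" "b j"] by auto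
    qed
    then have "card (?A - ?C) \<le> card {j \<in> customers. ereal r < b j \<and> b j \<le> ereal \<sigma>}"
      using finite_started_between i(3) by (intro card_mono) auto
    moreover have "ncard {j \<in> customers. ereal r < b j \<and> b j \<le> ereal \<sigma>} = real (S \<sigma>) - real (S r)"
      using r busy by (intro card_started_between) auto
    ultimately show "?Arr r"
      by linarith
  }
  let ?A = "arrivals \<sigma> (\<sigma> + y) - arrivals \<sigma> \<sigma>" and ?I = "initial (\<sigma> + y) - initial \<sigma>"
  have "ncard ?A = ncard (arrivals \<sigma> (\<sigma> + y)) - ncard (arrivals \<sigma> \<sigma>)"
    using finite_arrivals i(3) \<open>0 \<le> y\<close> arrivals_mono[of \<sigma> \<sigma> \<sigma> "\<sigma> + y"]
    by (intro real_card_Diff_subset) auto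
  moreover have sub: "initial \<sigma> \<subseteq> initial (\<sigma> + y)" using \<open>0 \<le> y\<close> by (auto simp: initial_def)
  then have "ncard ?I = ncard (initial (\<sigma> + y)) - ncard (initial \<sigma>)"
    using finite_initial by (intro real_card_Diff_subset) auto
  moreover have "?A \<inter> ?I = {}"
    using initial_subset by (fastforce simp: arrivals_def)
  then have "card (?A \<union> ?I) = card ?A + card ?I"
    using finite_arrivals finite_initial i(3) by (intro card_Un_disjoint) auto
  moreover have "?A \<union> ?I \<subseteq> {j \<in> customers. ereal 0 < b j \<and> b j \<le> ereal \<sigma>}"
  proof
    fix j assume "j \<in> ?A \<union> ?I"
    then show "j \<in> {j \<in> customers. ereal 0 < b j \<and> b j \<le> ereal \<sigma>}"
    proof
      assume "j \<in> ?A"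
      then have j: "1 \<le> j" "a j \<le> \<sigma>" "due j \<le> \<sigma> + y" "\<sigma> < due j" by (auto simp: arrivals_def)
      then have "j \<in> customers" "0 < a j" using arrival_pos by (auto simp: customers_def)
      then show ?thesis
        using served[of j] j started_before_due[of j \<sigma>]
        by (auto simp flip: zero_ereal_def intro: less_le_trans[of 0 "ereal (a j)"])
    next
      assume "j \<in> ?I"
      then have "j \<in> customers" "a j \<le> 0" "0 < b j" "\<sigma> < due j" "due j \<le> \<sigma> + y"
        by (auto simp: initial_def queued_eq zero_ereal_def)
      then show ?thesis using served[of j] i(3) by (auto simp flip: zero_ereal_def)
    qed
  qed
  then have "card (?A \<union> ?I) \<le> card {j \<in> customers. ereal 0 < b j \<and> b j \<le> ereal \<sigma>}"
    using finite_started_between i(3) by (intro card_mono) auto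
  moreover have "ncard {j \<in> customers. ereal 0 < b j \<and> b j \<le> ereal \<sigma>} = real (S \<sigma>) - real (S 0)"
    using i(3) busy by (intro card_started_between) auto
  ultimately show ?Ini
    by linarith
qed

end

section \<open>The fluid limit and sample paths close to it\<close>

text \<open>Knowledge about y* is condensed into \<open>frontier_levels\<close>: arbitrarily close
  levels between which \<open>lam * G\<close> passes \<open>mu\<close>, with \<open>F0\<close> below
  the upper one. \<open>G0\<close> and \<open>q0\<close> describe the limiting initial queue by
  deadline and in total.\<close>

locale fluid =
  fixes lam mu F0 q0 :: real and G G0 :: "real \<Rightarrow> real"
  assumes rates: "0 < mu" "mu \<le> lam"
    and G_mono: "mono G" and G_nonneg: "\<And>x. 0 \<le> G x" and G_le_1: "\<And>x. G x \<le> 1"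
    and G_nonpos: "\<And>x. x \<le> 0 \<Longrightarrow> G x = 0" and G_tendsto_0: "(G \<longlongrightarrow> 0) (at_right 0)"
    and frontier_levels: "\<And>\<kappa>. mu < lam \<Longrightarrow> 0 < \<kappa> \<Longrightarrow>
      \<exists>y1 y2. y1 < y2 \<and> y2 \<le> y1 + \<kappa> \<and> F0 < y2 \<and> lam * G y1 \<le> mu \<and> mu < lam * G y2"
    and F0_nonneg: "0 \<le> F0"
    and G0_cont: "continuous_on {0..} G0" and G0_mono: "\<And>x y. 0 \<le> x \<Longrightarrow> x \<le> y \<Longrightarrow> G0 x \<le> G0 y"
    and G0_0: "G0 0 = 0" and G0_pos: "\<And>x. F0 < x \<Longrightarrow> 0 < G0 x"
    and G0_le: "\<And>x. G0 x \<le> q0"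
begin

text \<open>The scaled number of arrivals up to \<open>s\<close> with deadline at most
  \<open>x\<close> tends to \<open>lam * (Gam x - Gam (x - s))\<close>; the value 0 at negative
  arguments covers the case \<open>x < s\<close>.\<close>

definition Gam :: "real \<Rightarrow> real" where "Gam x = integral {0..x} G"

text \<open>The function K of the overview: an arrival at time \<open>s\<close> is due by
  \<open>t\<close> with limiting probability \<open>G (t - s)\<close>, and integration over
  \<open>s\<close> gives \<open>Gam t\<close>.\<close>

definition expired :: "real \<Rightarrow> real" where "expired t = G0 t + lam * Gam t"

definition eta :: "real \<Rightarrow> real" where
  "eta t = (SUP s\<in>{0..t}. max 0 (expired s - mu * s))"

definition phi :: "real \<Rightarrow> real" where "phi t = q0 + (lam - mu) * t - eta t"

section \<open>Regularity of the limit functions\<close>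

lemma lam_pos: "0 < lam" using rates by simp

lemma G_integrable: "G integrable_on {x..y}"
  using integrable_on_mono_on[of x y G] G_mono by (auto simp: mono_on_def mono_def)

lemma Gam_nonpos: "x \<le> 0 \<Longrightarrow> Gam x = 0"
  by (cases "x = 0") (auto simp: Gam_def)

text \<open>Increments of a primitive of a monotone function lie between the endpoint values times
  the length. This replaces derivatives, which need not exist where \<open>G\<close> jumps.
  Arguments below 0 are handled by splitting at 0, where both \<open>G\<close> and
  \<open>Gam\<close> vanish.\<close>

lemma Gam_bounds:
  assumes "x \<le> y"
  shows "(y - x) * G x \<le> Gam y - Gam x" and "Gam y - Gam x \<le> (y - x) * G y"
proof -
  have "(y - x) * G x \<le> Gam y - Gam x \<and> Gam y - Gam x \<le> (y - x) * G y" if "0 \<le> x" "x \<le> y" for x y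
  proof -
    have i: "Gam y - Gam x = integral {x..y} G"
      using Henstock_Kurzweil_Integration.integral_combine[OF that G_integrable] by (simp add: Gam_def)
    have "integral {x..y} (\<lambda>_. G x) \<le> integral {x..y} G"
      using G_mono G_integrable by (intro integral_le) (auto simp: mono_def)
    moreover have "integral {x..y} G \<le> integral {x..y} (\<lambda>_. G y)"
      using G_mono G_integrable by (intro integral_le) (auto simp: mono_def)
    ultimately show ?thesis using that i by simp
  qed
  from this[of x y] this[of 0 y] have
    "(y - x) * G x \<le> Gam y - Gam x \<and> Gam y - Gam x \<le> (y - x) * G y"
    using assms G_nonpos[of x] Gam_nonpos[of x] Gam_nonpos[of y] Gam_nonpos[of 0] G_nonneg[of y]
      mult_right_mono[of y "y - x" "G y"]
    by (cases "0 \<le> x"; cases "0 \<le> y") (auto simp: G_nonpos)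
  then show "(y - x) * G x \<le> Gam y - Gam x" "Gam y - Gam x \<le> (y - x) * G y" by auto
qed

lemma Gam_mono: "x \<le> y \<Longrightarrow> Gam x \<le> Gam y"
  using Gam_bounds(1)[of x y] G_nonneg[of x] mult_nonneg_nonneg[of "y - x" "G x"] by linarith

lemma Gam_lipschitz: "x \<le> y \<Longrightarrow> Gam y - Gam x \<le> y - x"
  using Gam_bounds(2)[of x y] G_le_1[of y] mult_left_mono[of "G y" 1 "y - x"] by simp

lemma Gam_cont: "continuous_on UNIV Gam"
proof (rule lipschitz_on_continuous_on[of 1], rule lipschitz_onI)
  fix x y :: real
  show "dist (Gam x) (Gam y) \<le> 1 * dist x y"
    using Gam_lipschitz[of x y] Gam_lipschitz[of y x] Gam_mono[of x y] Gam_mono[of y x]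
    by (cases "x \<le> y") (simp_all add: dist_real_def)
qed simp

lemma expired_cont: "continuous_on {0..} expired"
  unfolding expired_def
  by (intro continuous_intros G0_cont continuous_on_subset[OF Gam_cont]) auto

lemma eta_bdd: "bdd_above ((\<lambda>s. max 0 (expired s - mu * s)) ` {0..t})"
proof -
  have "compact ((\<lambda>s. max 0 (expired s - mu * s)) ` {0..t})"
    by (intro compact_continuous_image continuous_intros continuous_on_subset[OF expired_cont]) auto
  then show ?thesis by (simp add: compact_imp_bounded bounded_imp_bdd_above)
qed

lemma eta_upper: "0 \<le> s \<Longrightarrow> s \<le> t \<Longrightarrow> max 0 (expired s - mu * s) \<le> eta t"
  unfolding eta_def by (intro cSUP_upper eta_bdd) auto

lemma eta_least:
  "0 \<le> t \<Longrightarrow> (\<And>s. 0 \<le> s \<Longrightarrow> s \<le> t \<Longrightarrow> max 0 (expired s - mu * s) \<le> z) \<Longrightarrow> eta t \<le> z"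
  unfolding eta_def by (intro cSUP_least) auto

lemma eta_nonneg: "0 \<le> t \<Longrightarrow> 0 \<le> eta t"
  using eta_upper[of t t] by simp

lemma eta_mono: "0 \<le> s \<Longrightarrow> s \<le> t \<Longrightarrow> eta s \<le> eta t"
  by (rule eta_least) (auto intro!: order_trans[OF _ eta_upper])

text \<open>Between \<open>s\<close> and \<open>t\<close> a running supremum grows by no more than
  the oscillation of the function there.\<close>

lemma eta_cont: "continuous_on {0..} eta"
  unfolding continuous_on_iff
proof (intro ballI allI impI)
  fix x e :: real assume "x \<in> {0..}" "0 < e"
  have "uniformly_continuous_on {0..x + 1} (\<lambda>s. max 0 (expired s - mu * s))"
    by (intro compact_uniformly_continuous continuous_intros continuous_on_subset[OF expired_cont]) auto
  then obtain d where d: "d > 0" "\<And>s t. s \<in> {0..x + 1} \<Longrightarrow> t \<in> {0..x + 1} \<Longrightarrow> dist s t < d \<Longrightarrow>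
      dist (max 0 (expired s - mu * s)) (max 0 (expired t - mu * t)) < e/2"
    using \<open>0 < e\<close> unfolding uniformly_continuous_on_def by (drule_tac spec[of _ "e/2"]) (auto simp: dist_commute)
  have inc: "eta t - eta s \<le> e/2" if "0 \<le> s" "s \<le> t" "t \<le> x + 1" "t - s < d" for s t
  proof -
    have "eta t \<le> eta s + e/2"
    proof (rule eta_least)
      fix r assume r: "0 \<le> r" "r \<le> t"
      show "max 0 (expired r - mu * r) \<le> eta s + e/2"
      proof (cases "r \<le> s")
        case True then show ?thesis using eta_upper[of r s] r \<open>0 < e\<close> by linarith
      next
        case False
        then have "dist (max 0 (expired r - mu * r)) (max 0 (expired s - mu * s)) < e/2"
          using that r by (intro d) (auto simp: dist_real_def)
        then show ?thesis using eta_upper[of s s] that unfolding dist_real_def by linarith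
      qed
    qed (use that in auto)
    then show ?thesis by simp
  qed
  have "dist (eta y) (eta x) < e" if "0 \<le> y" "dist y x < min d 1" for y
    using that inc[of x y] inc[of y x] eta_mono[of x y] eta_mono[of y x] \<open>x \<in> {0..}\<close> \<open>0 < e\<close>
    by (cases "x \<le> y") (auto simp: dist_real_def)
  then show "\<exists>d>0. \<forall>y\<in>{0..}. dist y x < d \<longrightarrow> dist (eta y) (eta x) < e"
    using \<open>0 < d\<close> by (intro exI[of _ "min d 1"]) auto
qed

lemma q0_pos: "0 < q0"
  using G0_pos[of "F0 + 1"] G0_le[of "F0 + 1"] by simp

lemma G_small: "0 < e \<Longrightarrow> \<exists>h>0. G h < e"
proof -
  assume "0 < e"
  then have "\<forall>\<^sub>F x in at_right 0. G x < e" using order_tendstoD(2)[OF G_tendsto_0] by blast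
  then obtain h where "h > 0" "\<forall>y>0. y < h \<longrightarrow> G y < e" by (auto simp: eventually_at_right_field)
  then show ?thesis by (intro exI[of _ "h/2"]) auto
qed

lemma G0_small: "0 < e \<Longrightarrow> \<exists>h>0. G0 h < e"
proof -
  assume e: "0 < e"
  have "\<forall>x\<in>{0..}. \<forall>e>0. \<exists>d>0. \<forall>x'\<in>{0..}. dist x' x < d \<longrightarrow> dist (G0 x') (G0 x) < e"
    using G0_cont by (simp add: continuous_on_iff)
  then obtain d where d: "d > 0" "\<And>x. 0 \<le> x \<Longrightarrow> dist x 0 < d \<Longrightarrow> dist (G0 x) (G0 0) < e"
    using e by (metis atLeast_iff order_refl dist_commute)
  then show ?thesis using d(2)[of "d/2"] G0_0 by (intro exI[of _ "d/2"]) (auto simp: dist_real_def abs_less_iff)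
qed

text \<open>The bound comes from H(0,s), which equals \<open>q0 - G0 s + lam * (s - Gam s)\<close>.
  For small \<open>s\<close> at least half of the initial queue is not yet due; for larger
  \<open>s\<close> at least \<open>lam * h / 2\<close> of the arrivals are not. Passing from
  \<open>s\<close> to a later \<open>t\<close> uses \<open>mu \<le> lam\<close>.\<close>

lemma phi_lower: "\<exists>p>0. \<forall>t\<ge>0. p \<le> phi t"
proof -
  obtain h1 where h1: "h1 > 0" "G h1 < 1/2" using G_small[of "1/2"] by auto
  obtain h2 where h2: "h2 > 0" "G0 h2 < q0/2" using G0_small[of "q0/2"] q0_pos by auto
  define h where "h = min h1 h2"
  define p where "p = min (q0/2) (lam * h / 2)"
  have "G h < 1/2" using h1 monoD[OF G_mono, of h h1] by (auto simp: h_def)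
  have h: "h > 0" using h1 h2 by (simp add: h_def)
  have p: "p > 0" using h q0_pos lam_pos by (simp add: p_def)
  have H: "p \<le> q0 - G0 s + lam * (s - Gam s)" if "0 \<le> s" for s
  proof (cases "s \<le> h")
    case True
    have "G0 s \<le> q0/2" using G0_mono[of s h2] True that h2 by (auto simp: h_def)
    moreover have "0 \<le> lam * (s - Gam s)"
      using Gam_lipschitz[of 0 s] Gam_nonpos[of 0] that lam_pos by simp
    moreover have "p \<le> q0/2" by (simp add: p_def)
    ultimately show ?thesis by linarith
  next
    case False
    have "Gam h \<le> h * G h" using Gam_bounds(2)[of 0 h] h Gam_nonpos[of 0] by simp
    also have "\<dots> \<le> h * (1/2)" using \<open>G h < 1/2\<close> h by (intro mult_left_mono) auto
    finally have "h/2 \<le> s - Gam s" using Gam_lipschitz[of h s] False by simp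
    then have "lam * (h/2) \<le> lam * (s - Gam s)" using lam_pos by simp
    moreover have "p \<le> lam * h / 2" by (simp add: p_def)
    ultimately show ?thesis using G0_le[of s] by simp
  qed
  have "p \<le> phi t" if "0 \<le> t" for t
  proof -
    have "eta t \<le> q0 + (lam - mu) * t - p"
    proof (rule eta_least[OF that])
      fix s assume s: "0 \<le> s" "s \<le> t"
      have "(lam - mu) * s \<le> (lam - mu) * t" "0 \<le> (lam - mu) * t"
        using rates s by (auto intro!: mult_left_mono)
      moreover have "p \<le> q0" using q0_pos by (simp add: p_def)
      moreover have "expired s - mu * s = (lam - mu) * s - (lam * (s - Gam s) - G0 s)"
        by (simp add: expired_def algebra_simps)
      ultimately show "max 0 (expired s - mu * s) \<le> q0 + (lam - mu) * t - p"
        using H[OF s(1)] by linarith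
    qed
    then show ?thesis by (simp add: phi_def)
  qed
  with p show ?thesis by blast
qed

end

text \<open>Constants for the comparison on \<open>[0, T]\<close>: \<open>n\<close> is the scale, \<open>e\<close> bounds the distance of the
  scaled primitives to their limits, \<open>c\<close> and \<open>v\<close> separate significant from negligible
  reneging, and customers enter service with lead time at most \<open>y\<close> if \<open>mu < lam\<close>.\<close>

locale fluid_run = fluid lam mu F0 q0 G G0 + edf_run E S X R a u b
  for lam mu F0 q0 G G0 E S X R a u b +
  fixes n T T' e d c v y w p :: real
  assumes n_pos: "0 < n" and one_le: "1 \<le> n * e"
    and ranges: "0 \<le> T" "0 < e" "0 < c" "0 < v" "T + c \<le> T'" "mu < lam \<Longrightarrow> T + y \<le> T' \<and> 0 \<le> y"
    and close_arrivals: "\<And>s x. 0 \<le> s \<Longrightarrow> s \<le> T' \<Longrightarrow> 0 \<le> x \<Longrightarrow> x \<le> T' \<Longrightarrow>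
      \<bar>ncard (arrivals s x) - n * (lam * (Gam x - Gam (x - s)))\<bar> \<le> n * e"
    and close_S: "\<And>s. 0 \<le> s \<Longrightarrow> s \<le> T' \<Longrightarrow> \<bar>real (S s) - n * (mu * s)\<bar> \<le> n * e"
    and close_E: "\<And>s. 0 \<le> s \<Longrightarrow> s \<le> T' \<Longrightarrow> \<bar>real (E s) - n * (lam * s)\<bar> \<le> n * e"
    and close_initial: "\<And>x. 0 \<le> x \<Longrightarrow> x \<le> T' \<Longrightarrow> \<bar>ncard (initial x) - n * G0 x\<bar> \<le> n * e"
    and close_X0: "\<bar>real (X 0) - n * q0\<bar> \<le> n * e"
    and few_short: "ncard {i. 1 \<le> i \<and> a i \<le> T \<and> u i \<le> v} \<le> n * d"
    and window: "mu < lam \<Longrightarrow> 0 < w \<and> 6 * e < w * (lam * G y - lam * G w - mu) \<and> 6 * e < G0 y - G0 w"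
    and short_delay: "\<And>z. v \<le> z \<Longrightarrow> mu < lam \<longrightarrow> z + c \<le> y \<Longrightarrow>
      5 * e < mu * z - lam * (Gam (z + c) - Gam c)"
    and expired_shift: "\<And>t. 0 \<le> t \<Longrightarrow> t \<le> T \<Longrightarrow> expired (t + c) - expired t \<le> d"
    and e_small: "10 * e \<le> d" and d_small: "3 * d < p" and p_lower: "\<And>t. 0 \<le> t \<Longrightarrow> p \<le> phi t"
    and X_right: "\<And>t. 0 \<le> t \<Longrightarrow> 0 < X t \<Longrightarrow> \<exists>h>0. \<forall>s. t \<le> s \<and> s < t + h \<longrightarrow> 0 < X s"
begin

section \<open>Comparison of a single path with the fluid limit\<close>

lemma scaled_le: "n * x \<le> n * z \<longleftrightarrow> x \<le> z"
  using n_pos by simp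

text \<open>Suppose a start at \<open>\<sigma>\<close> has lead time above \<open>y\<close>. Then
  the arrivals of the last \<open>w\<close> time units with deadlines in
  \<open>(\<sigma>, \<sigma> + y]\<close> have all started; per unit of scale they number at least
  about \<open>w * (lam * G y - lam * G w)\<close>, more than the capacity \<open>w * mu\<close>.
  For \<open>\<sigma> < w\<close> there is no full window, and the initial customers with such
  deadlines, at least about \<open>G0 y - G0 w\<close>, make up the excess.\<close>

lemma starts_near_frontier:
  assumes "mu < lam" and i: "i \<in> customers" "b i = ereal \<sigma>" and \<sigma>: "0 < \<sigma>" "\<sigma> \<le> T"
    and busy: "\<And>r. 0 \<le> r \<Longrightarrow> r \<le> \<sigma> \<Longrightarrow> X r > 0"
  shows "due i \<le> \<sigma> + y"
proof (rule ccontr)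
  assume "\<not> due i \<le> \<sigma> + y"
  then have late: "\<sigma> + y < due i" by simp
  have y: "0 \<le> y" "T + y \<le> T'" and w: "0 < w" "6 * e < w * (lam * G y - lam * G w - mu)" "6 * e < G0 y - G0 w"
    using ranges window \<open>mu < lam\<close> by auto
  note fr = frontier[OF i \<sigma>(1) late y(1) busy]
  have pos: "0 < lam * G y - lam * G w - mu" using w ranges by (smt (verit) mult_nonneg_nonpos)
  note A = close_arrivals[of \<sigma> "\<sigma> + y"] close_arrivals[of \<sigma> \<sigma>]
  show False
  proof (cases "w \<le> \<sigma>")
    case True
    let ?r = "\<sigma> - w"
    \<comment> \<open>Four counts of arrivals and two of services are off by at most
      \<open>n * e\<close> each.\<close>
    have "n * (lam * (Gam (y + w) - Gam y - Gam w)) - 4 * (n * e) \<le> n * (mu * w) + 2 * (n * e)"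
      using fr(1)[of ?r] A close_arrivals[of ?r "\<sigma> + y"] close_arrivals[of ?r \<sigma>]
        close_S[of \<sigma>] close_S[of ?r] True \<sigma> y w Gam_nonpos[of 0]
      by (simp add: algebra_simps)
    then have "n * (lam * (Gam (y + w) - Gam y - Gam w) - mu * w) \<le> n * (6 * e)"
      by (simp add: algebra_simps)
    then have 1: "lam * (Gam (y + w) - Gam y - Gam w) - mu * w \<le> 6 * e"
      by (simp only: scaled_le)
    have "w * G y - w * G w \<le> Gam (y + w) - Gam y - Gam w"
      using Gam_bounds(1)[of y "y + w"] Gam_bounds(2)[of 0 w] Gam_nonpos[of 0] w by simp
    then have "lam * (w * G y - w * G w) \<le> lam * (Gam (y + w) - Gam y - Gam w)"
      using lam_pos by (intro mult_left_mono) auto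
    with 1 w(2) show False by (simp add: algebra_simps)
  next
    case False
    have "n * (G0 (\<sigma> + y) - G0 \<sigma>) + n * (lam * (Gam (\<sigma> + y) - Gam y - Gam \<sigma>)) - 4 * (n * e)
        \<le> n * (mu * \<sigma>) + 2 * (n * e)"
      using fr(2) A close_initial[of "\<sigma> + y"] close_initial[of \<sigma>]
        close_S[of \<sigma>] close_S[of 0] \<sigma> y Gam_nonpos[of 0]
      by (simp add: algebra_simps)
    then have "n * (G0 (\<sigma> + y) - G0 \<sigma> + lam * (Gam (\<sigma> + y) - Gam y - Gam \<sigma>) - mu * \<sigma>) \<le> n * (6 * e)"
      by (simp add: algebra_simps)
    then have 1: "G0 (\<sigma> + y) - G0 \<sigma> + lam * (Gam (\<sigma> + y) - Gam y - Gam \<sigma>) - mu * \<sigma> \<le> 6 * e"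
      by (simp only: scaled_le)
    have "\<sigma> * G \<sigma> \<le> \<sigma> * G w" using False \<sigma> by (intro mult_left_mono monoD[OF G_mono]) auto
    moreover have "\<sigma> * G y \<le> Gam (\<sigma> + y) - Gam y" "Gam \<sigma> \<le> \<sigma> * G \<sigma>"
      using Gam_bounds(1)[of y "\<sigma> + y"] Gam_bounds(2)[of 0 \<sigma>] Gam_nonpos[of 0] \<sigma> by auto
    ultimately have "\<sigma> * G y - \<sigma> * G w \<le> Gam (\<sigma> + y) - Gam y - Gam \<sigma>" by linarith
    then have "lam * (\<sigma> * G y - \<sigma> * G w) \<le> lam * (Gam (\<sigma> + y) - Gam y - Gam \<sigma>)"
      using lam_pos by (intro mult_left_mono) auto
    moreover have "0 \<le> \<sigma> * (lam * G y - lam * G w - mu)" using pos \<sigma> by simp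
    moreover have "G0 y \<le> G0 (\<sigma> + y)" "G0 \<sigma> \<le> G0 w" using G0_mono \<sigma> y False by auto
    ultimately show False using 1 w(3) by (simp add: algebra_simps)
  qed
qed

text \<open>With \<open>z = \<tau> - \<sigma>\<close>, the inequality of \<open>reneging_bad\<close>
  reads \<open>mu * z \<le> lam * (Gam (z + c) - Gam c)\<close> up to \<open>5 * e\<close>, so
  \<open>short_delay\<close> forces \<open>z < v\<close>. The lead time of \<open>k\<close> is
  shorter still, as \<open>k\<close> arrives after \<open>\<sigma>\<close> and is due at
  \<open>\<tau>\<close>.\<close>

lemma bad_reneging_short:
  assumes k: "k \<in> customers" "due k = \<tau>" "ereal \<tau> \<le> b k" and \<tau>: "\<tau> \<le> T"
    and bad: "i' \<in> customers" "0 < b i'" "b i' < ereal \<tau>" "\<tau> + c < due i'"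
    and busy: "\<And>r. 0 \<le> r \<Longrightarrow> r < \<tau> \<Longrightarrow> X r > 0"
  shows "1 \<le> k \<and> a k \<le> T \<and> u k \<le> v"
proof -
  obtain \<sigma> i where s: "0 < \<sigma>" "\<sigma> < \<tau>" "i \<in> customers" "b i = ereal \<sigma>" "\<tau> + c < due i" "\<sigma> < a k"
    and S: "\<And>s. \<sigma> \<le> s \<Longrightarrow> s < \<tau> \<Longrightarrow> real (S s) - real (S \<sigma>) \<le>
      ncard (arrivals \<tau> (\<tau> + c)) - ncard (arrivals \<sigma> (\<tau> + c))"
    using reneging_bad[OF k bad _ busy] ranges by (metis less_imp_le)
  \<comment> \<open>Services are under control only before \<open>\<tau>\<close>; stopping at most
    \<open>e / mu\<close> earlier costs one more \<open>e\<close>.\<close>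
  define s where "s = max \<sigma> (\<tau> - e / mu)"
  have s': "\<sigma> \<le> s" "s < \<tau>" using s ranges rates by (auto simp: s_def)
  have "mu * (\<tau> - e / mu) \<le> mu * s" using rates by (intro mult_left_mono) (auto simp: s_def)
  then have mus: "mu * \<tau> - e \<le> mu * s" using rates by (simp add: algebra_simps)
  then have "n * (mu * \<tau> - e) \<le> n * (mu * s)" by (simp only: scaled_le)
  then have "n * (mu * (\<tau> - \<sigma>) - e) - 2 * (n * e) \<le> n * (lam * (Gam (\<tau> + c - \<sigma>) - Gam c)) + 2 * (n * e)"
    using S[OF s'] close_S[of s] close_S[of \<sigma>] close_arrivals[of \<tau> "\<tau> + c"] close_arrivals[of \<sigma> "\<tau> + c"]
      s s' \<tau> ranges(1,3,5)
    by (simp add: algebra_simps)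
  then have "n * (mu * (\<tau> - \<sigma>) - lam * (Gam (\<tau> - \<sigma> + c) - Gam c)) \<le> n * (5 * e)"
    by (simp add: algebra_simps)
  then have le: "mu * (\<tau> - \<sigma>) - lam * (Gam (\<tau> - \<sigma> + c) - Gam c) \<le> 5 * e"
    by (simp only: scaled_le)
  \<comment> \<open>The customer \<open>i\<close> is due after \<open>\<tau> + c\<close> but, having
    started near the frontier, no later than \<open>\<sigma> + y\<close>.\<close>
  have "mu < lam \<longrightarrow> \<tau> - \<sigma> + c \<le> y"
    using starts_near_frontier[OF _ s(3,4,1)] s \<tau> busy by force
  then have "\<tau> - \<sigma> < v"
    using short_delay[of "\<tau> - \<sigma>"] le by linarith
  moreover have "1 \<le> k" using initial_arrival[of k] k(1) s by (force simp: customers_def)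
  ultimately show ?thesis
    using k s \<tau> due_gt[of k] ranges unfolding due_def by auto
qed

text \<open>Let \<open>\<tau>\<close> be the last deadline of a \<open>good\<close> reneging
  customer: \<open>reneging_upper_good\<close> bounds the count at \<open>\<tau>\<close>, and
  whoever reneges later is not \<open>good\<close>, hence among the few with short lead times. The
  slack \<open>- 3 * e\<close> is kept to pay for the errors of \<open>X 0\<close>, \<open>E\<close>
  and \<open>S\<close> in \<open>never_idle\<close>.\<close>

lemma reneging_upper:
  assumes t: "0 \<le> t" "t \<le> T" and busy: "\<And>r. 0 \<le> r \<Longrightarrow> r < t \<Longrightarrow> X r > 0"
  shows "real (R t) \<le> n * (eta t + 3 * d - 3 * e)"
proof -
  define Re where "Re = reneged (X 0) a u b"
  define good where
    "good k \<longleftrightarrow> (\<forall>i\<in>customers. 0 < b i \<and> b i < ereal (due k) \<longrightarrow> due i \<le> due k + c)" for k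
  define Short where "Short = {i. 1 \<le> i \<and> a i \<le> T \<and> u i \<le> v}"
  have "finite Short"
    by (rule finite_subset[OF _ finite_arrivals[of T "T + v"]])
      (use ranges in \<open>auto simp: Short_def arrivals_def due_def\<close>)
  have Re: "finite (Re r)" "card (Re r) = R r" if "0 \<le> r" for r
    using reneging[OF that] by (auto simp: Re_def)
  have bad: "k \<in> Short" if k: "k \<in> Re t" "\<not> good k" for k
  proof -
    obtain i where i: "i \<in> customers" "0 < b i" "b i < ereal (due k)" "due k + c < due i"
      using k by (auto simp: good_def not_le)
    have k: "k \<in> customers" "ereal (due k) \<le> b k" "due k \<le> t" using k by (auto simp: Re_def reneged_eq)
    then show ?thesis
      using bad_reneging_short[OF k(1) refl k(2) _ i] busy t by (auto simp: Short_def)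
  qed
  have "d > 0" using e_small ranges by linarith
  show ?thesis
  proof (cases "\<exists>k\<in>Re t. good k")
    case False
    then have "Re t \<subseteq> Short" using bad by auto
    then have "R t \<le> card Short" using \<open>finite Short\<close> Re t by (metis card_mono)
    then have "real (R t) \<le> n * d" using few_short unfolding Short_def by linarith
    also have "\<dots> \<le> n * (eta t + 3 * d - 3 * e)"
      unfolding scaled_le using eta_nonneg[of t] t \<open>d > 0\<close> e_small ranges by linarith
    finally show ?thesis .
  next
    case True
    define K where "K = {k \<in> Re t. good k}"
    have "finite K" "K \<noteq> {}" using Re t True by (auto simp: K_def)
    then have "Max (due ` K) \<in> due ` K" by (intro Max_in) auto
    then obtain k where "k \<in> K" "due k = Max (due ` K)" by auto
    with \<open>finite K\<close> have k: "k \<in> K" "\<And>j. j \<in> K \<Longrightarrow> due j \<le> due k" by auto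
    define \<tau> where "\<tau> = due k"
    have \<tau>: "0 < \<tau>" "\<tau> \<le> t" "good k" using k(1) reneged_due_pos[of k t] by (auto simp: K_def Re_def \<tau>_def reneged_eq)
    have "Re t \<subseteq> Re \<tau> \<union> Short"
    proof
      fix j assume j: "j \<in> Re t"
      show "j \<in> Re \<tau> \<union> Short"
      proof (cases "due j \<le> \<tau>")
        case True
        then show ?thesis using j by (auto simp: Re_def reneged_eq)
      next
        case False
        then have "j \<notin> K" using k(2) \<tau>_def by auto
        then show ?thesis using bad j by (auto simp: K_def)
      qed
    qed
    then have "R t \<le> card (Re \<tau> \<union> Short)"
      using Re t \<tau> \<open>finite Short\<close> by (metis card_mono finite_Un less_imp_le)
    also have "\<dots> \<le> R \<tau> + card Short"
      using card_Un_le[of "Re \<tau>" Short] Re \<tau> by auto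
    finally have Rt: "real (R t) \<le> real (R \<tau>) + n * d" using few_short unfolding Short_def by linarith
    define s where "s = max 0 (\<tau> - e / mu)"
    have s': "0 \<le> s" "s < \<tau>" using \<tau> ranges rates by (auto simp: s_def)
    have "mu * (\<tau> - e / mu) \<le> mu * s" using rates by (intro mult_left_mono) (auto simp: s_def)
    then have "mu * \<tau> - e \<le> mu * s" using rates by (simp add: algebra_simps)
    then have mus: "n * (mu * \<tau> - e) \<le> n * (mu * s)" by (simp only: scaled_le)
    have "real (R \<tau>) \<le> ncard (initial (\<tau> + c)) + ncard (arrivals (\<tau> + c) (\<tau> + c))
           - real (S s) + real (S 0) + 1"
      using s' ranges \<tau> busy unfolding good_def \<tau>_def[symmetric]
      by (intro reneging_upper_good) auto
    \<comment> \<open>Four counts and the \<open>+ 1\<close> make \<open>5 * (n * e)\<close>; a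
      sixth \<open>e\<close> is the gap between \<open>mu * s\<close> and
      \<open>mu * \<tau>\<close>.\<close>
    also have "\<dots> \<le> n * G0 (\<tau> + c) + n * (lam * Gam (\<tau> + c)) - n * (mu * \<tau> - e) + 5 * (n * e)"
      using close_initial[of "\<tau> + c"] close_arrivals[of "\<tau> + c" "\<tau> + c"] close_S[of s] close_S[of 0]
        mus one_le s' ranges \<tau> t Gam_nonpos[of 0] by simp
    also have "\<dots> = n * (expired (\<tau> + c) - mu * \<tau> + 6 * e)" by (simp add: expired_def algebra_simps)
    also have "\<dots> \<le> n * (eta t + d + 6 * e)"
      unfolding scaled_le using expired_shift[of \<tau>] eta_upper[of \<tau> t] \<tau> t by simp
    finally have "real (R t) \<le> n * (eta t + d + 6 * e + d)" using Rt by (simp add: algebra_simps)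
    also have "\<dots> \<le> n * (eta t + 3 * d - 3 * e)"
      unfolding scaled_le using e_small ranges by linarith
    finally show ?thesis .
  qed
qed

text \<open>Since \<open>reneging_upper\<close> asks for busyness only before the time considered,
  it applies at the infimum \<open>t1\<close> of the idle times and makes \<open>X t1\<close>
  positive. Then \<open>X_right\<close> pushes the infimum beyond \<open>t1\<close>.\<close>

lemma never_idle:
  assumes "0 \<le> t" "t \<le> T"
  shows "0 < X t"
proof (rule ccontr)
  assume "\<not> 0 < X t"
  define Z where "Z = {s. 0 \<le> s \<and> X s = 0}"
  have Z: "t \<in> Z" "bdd_below Z" using assms \<open>\<not> 0 < X t\<close> by (auto simp: Z_def intro: bdd_belowI[of _ 0])
  define t1 where "t1 = Inf Z"
  have t1: "t1 \<le> t" "0 \<le> t1"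
    using Z by (auto simp: t1_def intro!: cInf_lower cInf_greatest) (auto simp: Z_def)
  have busy: "X r > 0" if "0 \<le> r" "r < t1" for r
    using that Z cInf_lower[of r Z] by (force simp: t1_def Z_def)
  have "0 < X t1"
  proof -
    have "busy_time X t1 = t1" using busy t1 by (intro busy_time_eq) auto
    then have "real (X t1) = real (X 0) + real (E t1) - real (S t1) - real (R t1)"
      using arg_cong[OF balance[OF t1(2)], of real_of_int] by simp
    also have "\<dots> \<ge> n * q0 + n * (lam * t1) - n * (mu * t1) - 3 * (n * e) - n * (eta t1 + 3 * d - 3 * e)"
      using close_X0 close_E[of t1] close_S[of t1] reneging_upper[OF t1(2) _ busy] t1 assms ranges by simp
    also have "n * q0 + n * (lam * t1) - n * (mu * t1) - 3 * (n * e) - n * (eta t1 + 3 * d - 3 * e) =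
        n * (phi t1 - 3 * d)" by (simp add: phi_def algebra_simps)
    finally have "n * (phi t1 - 3 * d) \<le> real (X t1)" .
    moreover have "0 < n * (phi t1 - 3 * d)" using n_pos p_lower[OF t1(2)] d_small by simp
    ultimately show ?thesis by simp
  qed
  then obtain h where h: "h > 0" "\<And>s. t1 \<le> s \<Longrightarrow> s < t1 + h \<Longrightarrow> 0 < X s" using X_right t1 by blast
  have "t1 + h \<le> Inf Z"
  proof (rule cInf_greatest)
    fix s assume "s \<in> Z"
    then show "t1 + h \<le> s" using h(2)[of s] cInf_lower[of s Z] Z by (force simp: Z_def t1_def)
  qed (use Z in auto)
  then show False using h t1_def by simp
qed

text \<open>For the lower bound \<open>reneging_lower\<close> is used at every
  \<open>s \<le> t\<close>, the reneging count being monotone. The queue error adds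
  \<open>4 * e\<close> to that of reneging, for \<open>X 0\<close>, \<open>E\<close>,
  \<open>S\<close> and the customer in service.\<close>

theorem fluid_approximation:
  assumes "0 \<le> t" "t \<le> T"
  shows "\<bar>real (R t) / n - eta t\<bar> \<le> 3 * d" and "\<bar>real (X t - 1) / n - phi t\<bar> \<le> 4 * d"
proof -
  have "real (R t) \<le> n * (eta t + 3 * d - 3 * e)"
    using reneging_upper assms never_idle by simp
  then have up: "real (R t) / n \<le> eta t + 3 * d - 3 * e" using n_pos by (simp add: field_simps)
  have lo: "eta t \<le> real (R t) / n + 4 * e"
  proof (rule eta_least[OF assms(1)])
    fix s assume s: "0 \<le> s" "s \<le> t"
    have "real (card (initial s) + card (arrivals s s)) \<le> real (R s + S s + 1)"
      using s assms by (intro of_nat_mono reneging_lower) (auto intro: never_idle)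
    then have "n * G0 s + n * (lam * Gam s) - n * (mu * s) - 4 * (n * e) \<le> real (R s)"
      using close_initial[of s] close_arrivals[of s s] close_S[of s] one_le s assms ranges Gam_nonpos[of 0]
      by simp
    also have "real (R s) \<le> real (R t)" using R_mono s by simp
    finally have "n * (expired s - mu * s - 4 * e) \<le> real (R t)" by (simp add: expired_def algebra_simps)
    then have "expired s - mu * s - 4 * e \<le> real (R t) / n" using n_pos by (simp add: field_simps)
    moreover have "0 \<le> real (R t) / n" using n_pos by simp
    ultimately show "max 0 (expired s - mu * s) \<le> real (R t) / n + 4 * e" using ranges by linarith
  qed
  show R: "\<bar>real (R t) / n - eta t\<bar> \<le> 3 * d" using up lo e_small ranges by linarith
  have "busy_time X t = t" using assms by (intro busy_time_eq) (auto intro: never_idle)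
  then have "real (X t) = real (X 0) + real (E t) - real (S t) - real (R t)"
    using arg_cong[OF balance[OF assms(1)], of real_of_int] by simp
  then have X: "real (X t - 1) = real (X 0) + real (E t) - real (S t) - real (R t) - 1"
    using never_idle[OF assms] by (simp add: of_nat_diff)
  have "real (X 0) + real (E t) - real (S t) - 1 - n * (q0 + (lam - mu) * t) =
     (real (X 0) - n * q0) + (real (E t) - n * (lam * t)) - (real (S t) - n * (mu * t)) - 1"
    by (simp add: algebra_simps)
  also have "\<bar>\<dots>\<bar> \<le> n * (4 * e)"
    using close_X0 close_E[of t] close_S[of t] one_le assms ranges by simp
  finally have "\<bar>(real (X 0) + real (E t) - real (S t) - 1) / n - (q0 + (lam - mu) * t)\<bar> \<le> 4 * e"
    using n_pos by (simp add: abs_le_iff field_simps)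
  moreover have "real (X t - 1) / n = (real (X 0) + real (E t) - real (S t) - 1) / n - real (R t) / n"
    unfolding X by (simp add: diff_divide_distrib add_divide_distrib)
  ultimately show "\<bar>real (X t - 1) / n - phi t\<bar> \<le> 4 * d"
    using R e_small ranges unfolding phi_def by linarith
qed

end

section \<open>Convergence of sample paths\<close>

text \<open>The order of choice matters: \<open>d\<close> after the lower bound \<open>p\<close>,
  then \<open>v\<close> from the smallness of \<open>G\<close> near 0, the frontier levels from
  \<open>v\<close>, then \<open>w\<close>, and \<open>e\<close> last because it has to beat every
  gap. One value serves for both \<open>c\<close> and \<open>v\<close>.\<close>

lemma (in fluid) constants_exist:
  assumes "0 \<le> T" "0 < \<delta>"
  obtains T' e d c v y w p where "T \<le> T'" "d \<le> \<delta>" "0 < d" "0 < e" "0 < c" "0 < v" "T + c \<le> T'"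
    "mu < lam \<Longrightarrow> T + y \<le> T' \<and> 0 \<le> y" "(lam * T + 1) * G (2 * v) < d"
    "mu < lam \<Longrightarrow> 0 < w \<and> 6 * e < w * (lam * G y - lam * G w - mu) \<and> 6 * e < G0 y - G0 w"
    "\<And>z. v \<le> z \<Longrightarrow> mu < lam \<longrightarrow> z + c \<le> y \<Longrightarrow> 5 * e < mu * z - lam * (Gam (z + c) - Gam c)"
    "\<And>t. 0 \<le> t \<Longrightarrow> t \<le> T \<Longrightarrow> expired (t + c) - expired t \<le> d" "10 * e \<le> d" "3 * d < p"
    "\<And>t. 0 \<le> t \<Longrightarrow> p \<le> phi t"
proof -
  obtain p where p: "p > 0" "\<And>t. 0 \<le> t \<Longrightarrow> p \<le> phi t" using phi_lower by blast
  \<comment> \<open>Keeps \<open>3 * d\<close> below the lower bound of \<open>phi\<close>, which is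
    what excludes idling.\<close>
  define d where "d = min \<delta> (p / 4)"
  have d: "0 < d" "d \<le> \<delta>" "3 * d < p" using p \<open>0 < \<delta>\<close> by (auto simp: d_def)
  have lT: "0 < lam * T + 1" using lam_pos \<open>0 \<le> T\<close> by (simp add: add_nonneg_pos)
  obtain h where h: "h > 0" "G h < min (mu / (2 * lam)) (d / (lam * T + 1))"
    using G_small[of "min (mu / (2 * lam)) (d / (lam * T + 1))"] d lT rates lam_pos by auto
  have "uniformly_continuous_on {0..T+1} expired"
    by (intro compact_uniformly_continuous continuous_on_subset[OF expired_cont]) auto
  then obtain c0 where c0: "c0 > 0"
    "\<And>s t. s \<in> {0..T+1} \<Longrightarrow> t \<in> {0..T+1} \<Longrightarrow> dist s t < c0 \<Longrightarrow> dist (expired s) (expired t) < d"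
    using d unfolding uniformly_continuous_on_def by (metis dist_commute)
  \<comment> \<open>The first entry makes \<open>G (2 * v)\<close> small, the second controls
    \<open>expired\<close> under a shift by \<open>v\<close>, and the third keeps
    \<open>t + v\<close> inside \<open>{0..T+1}\<close>.\<close>
  define v where "v = min (h/2) (min (c0/2) 1)"
  have v: "0 < v" "2 * v \<le> h" "v < c0" "v \<le> 1" using h c0 by (auto simp: v_def)
  have G2v: "lam * G (2 * v) \<le> mu / 2" "(lam * T + 1) * G (2 * v) < d"
  proof -
    have *: "G (2 * v) \<le> G h" using v monoD[OF G_mono] by blast
    have "lam * G (2 * v) \<le> lam * (mu / (2 * lam))" using * h lam_pos by (intro mult_left_mono) auto
    then show "lam * G (2 * v) \<le> mu / 2" using lam_pos by simp
    have "(lam * T + 1) * G (2 * v) < (lam * T + 1) * (d / (lam * T + 1))"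
      using * h lT by (intro mult_strict_left_mono) auto
    then show "(lam * T + 1) * G (2 * v) < d" using lT by simp
  qed
  have shift: "expired (t + v) - expired t \<le> d" if "0 \<le> t" "t \<le> T" for t
    using c0(2)[of "t + v" t] that v by (simp add: dist_real_def)
  \<comment> \<open>Lead times between \<open>y1\<close> and \<open>y\<close> may arrive faster than
    \<open>mu\<close>. A gap of at most \<open>\<kappa>\<close> limits the excess to
    \<open>lam * \<kappa> = mu * v / 4\<close>, half of what the stretch from \<open>v\<close> to
    \<open>2 * v\<close> saves.\<close>
  define \<kappa> where "\<kappa> = mu * v / (4 * lam)"
  have \<kappa>: "\<kappa> > 0" "lam * \<kappa> = mu * v / 4" using rates v lam_pos by (auto simp: \<kappa>_def)
  define P where "P y1 y2 \<longleftrightarrow> y1 < y2 \<and> y2 \<le> y1 + \<kappa> \<and> F0 < y2 \<and> lam * G y1 \<le> mu \<and> mu < lam * G y2" for y1 y2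
  obtain y1 y where y: "mu < lam \<Longrightarrow> P y1 y" using frontier_levels[OF _ \<kappa>(1)] unfolding P_def by blast
  \<comment> \<open>The increment of \<open>Gam\<close> is split at \<open>2 * v\<close>: below, the
    slope \<open>lam * G\<close> is at most \<open>mu / 2\<close>; above, it is at most
    \<open>mu\<close> except on a stretch of length \<open>\<kappa>\<close>.\<close>
  have delay: "mu * v / 4 \<le> mu * z - lam * (Gam (z + v) - Gam v)"
    if z: "v \<le> z" "mu < lam \<longrightarrow> z + v \<le> y" for z
  proof -
    have "lam * (Gam (2 * v) - Gam v) \<le> lam * (v * G (2 * v))"
      using Gam_bounds(2)[of v "2 * v"] v lam_pos by (intro mult_left_mono) auto
    also have "\<dots> \<le> v * (mu / 2)" using G2v(1) v mult_left_mono[of "lam * G (2 * v)" "mu/2" v] by (simp add: mult_ac)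
    finally have 1: "lam * (Gam (2 * v) - Gam v) \<le> mu * v / 2" by (simp add: mult.commute)
    have 2: "lam * (Gam (z + v) - Gam (2 * v)) \<le> mu * (z - v) + mu * v / 4"
    proof (cases "mu < lam")
      case False
      then have "lam = mu" using rates by simp
      moreover have "lam * (Gam (z + v) - Gam (2 * v)) \<le> lam * (z - v)"
        using Gam_lipschitz[of "2 * v" "z + v"] z lam_pos by (intro mult_left_mono) auto
      ultimately show ?thesis using rates v by (simp add: add_increasing2)
    next
      case True
      then have P: "y1 < y" "y \<le> y1 + \<kappa>" "lam * G y1 \<le> mu" using y by (auto simp: P_def)
      have low: "lam * (Gam r - Gam s) \<le> mu * (r - s)" if "s \<le> r" "r \<le> y1" for r s
      proof -
        have "lam * (Gam r - Gam s) \<le> lam * ((r - s) * G r)"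
          using Gam_bounds(2)[of s r] that lam_pos by (intro mult_left_mono) auto
        also have "\<dots> = (r - s) * (lam * G r)" by simp
        also have "\<dots> \<le> (r - s) * mu"
          using that P(3) monoD[OF G_mono that(2)] lam_pos
          by (intro mult_left_mono) (auto intro: order_trans[OF mult_left_mono])
        finally show ?thesis by (simp add: mult_ac)
      qed
      have high: "lam * (Gam r - Gam s) \<le> mu * v / 4" if "s \<le> r" "r - s \<le> \<kappa>" for r s
        using Gam_lipschitz[OF that(1)] that lam_pos unfolding \<kappa>(2)[symmetric]
        by (intro mult_left_mono) auto
      have nn: "0 \<le> mu * v / 4" "0 \<le> mu * (z - v)" using rates v z by auto
      show ?thesis
      proof (cases "z + v \<le> y1")
        case True
        then show ?thesis using low[of "2 * v" "z + v"] z nn by simp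
      next
        case no: False
        show ?thesis
        proof (cases "2 * v \<le> y1")
          case True
          have "lam * (Gam (z + v) - Gam y1) \<le> mu * v / 4"
            using no P z \<open>mu < lam\<close> by (intro high) auto
          moreover have "lam * (Gam y1 - Gam (2 * v)) \<le> mu * (y1 - 2 * v)" using True by (intro low) auto
          moreover have "mu * (y1 - 2 * v) \<le> mu * (z - v)" using no rates by (intro mult_left_mono) auto
          ultimately show ?thesis by (simp add: algebra_simps)
        next
          case False
          then have "lam * (Gam (z + v) - Gam (2 * v)) \<le> mu * v / 4"
            using P z \<open>mu < lam\<close> by (intro high) auto
          then show ?thesis using nn by simp
        qed
      qed
    qed
    show ?thesis using 1 2 by (simp add: algebra_simps)
  qed
  have mv: "0 < mu * v" using rates v by simp
  show ?thesis
  proof (cases "mu < lam")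
    case False
    define e where "e = min (d / 10) (mu * v / 40)"
    have "0 < e" "10 * e \<le> d" "5 * e < mu * v / 4" using d mv by (auto simp: e_def)
    moreover from this have "5 * e < mu * z - lam * (Gam (z + v) - Gam v)" if "v \<le> z" for z
      using delay[of z] False that by simp
    \<comment> \<open>Conditions on \<open>y\<close> and \<open>w\<close> are guarded by
      \<open>mu < lam\<close>, so these get the dummy value 0.\<close>
    ultimately show ?thesis
      using False d v G2v shift p by (intro that[of "T + 1" d e v v 0 0 p]) simp_all
  next
    case True
    then have P: "F0 < y" "mu < lam * G y" using y by (auto simp: P_def)
    have y0: "0 \<le> y" "0 < G0 y" using P F0_nonneg G0_pos by auto
    obtain w1 where w1: "w1 > 0" "G w1 < (lam * G y - mu) / lam"
      using G_small[of "(lam * G y - mu) / lam"] P lam_pos by auto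
    obtain w2 where w2: "w2 > 0" "G0 w2 < G0 y" using G0_small y0 by blast
    define w where "w = min w1 w2"
    have w: "0 < w" "G w \<le> G w1" "G0 w \<le> G0 w2"
      using w1 w2 monoD[OF G_mono, of w w1] G0_mono[of w w2] by (auto simp: w_def)
    have "lam * G w \<le> lam * G w1" using w lam_pos by (intro mult_left_mono) auto
    also have "\<dots> < lam * G y - mu" using w1 lam_pos by (simp add: field_simps)
    finally have pos: "0 < w * (lam * G y - lam * G w - mu)" "0 < G0 y - G0 w" using w w2 by auto
    define e where "e = min (min (d / 10) (mu * v / 40)) (min (w * (lam * G y - lam * G w - mu) / 12) ((G0 y - G0 w) / 12))"
    have e: "0 < e" "10 * e \<le> d" "5 * e < mu * v / 4"
      "6 * e < w * (lam * G y - lam * G w - mu)" "6 * e < G0 y - G0 w"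
    proof -
      have e: "e \<le> d / 10" "e \<le> mu * v / 40" "e \<le> w * (lam * G y - lam * G w - mu) / 12"
        "e \<le> (G0 y - G0 w) / 12" unfolding e_def by linarith+
      show "0 < e" using d mv pos by (simp add: e_def)
      show "10 * e \<le> d" using e(1) by simp
      show "5 * e < mu * v / 4" using e(2) mv by linarith
      show "6 * e < w * (lam * G y - lam * G w - mu)" using e(3) pos(1) by linarith
      have "6 * e \<le> (G0 y - G0 w) / 2" using e(4) by simp
      also have "\<dots> < G0 y - G0 w" using pos(2) by simp
      finally show "6 * e < G0 y - G0 w" .
    qed
    then show ?thesis
      using True d v G2v shift p y0 w less_le_trans[OF e(3) delay]
      by (intro that[of "T + 1 + y" d e v v y w p]) simp_all
  qed
qed

text \<open>On a fine finite grid convergence is uniform; in between, a function monotone in both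
  arguments is enclosed by its values at the two opposite corners of a cell, and uniform continuity
  of the limit makes these close.\<close>

lemma monotone_uniform_convergence2:
  fixes f :: "'i \<Rightarrow> real \<Rightarrow> real \<Rightarrow> real" and F :: "real \<Rightarrow> real \<Rightarrow> real"
  assumes mono: "\<And>j s t x y. 0 \<le> s \<Longrightarrow> s \<le> t \<Longrightarrow> 0 \<le> x \<Longrightarrow> x \<le> y \<Longrightarrow> f j s x \<le> f j t y"
    and cont: "continuous_on ({0..} \<times> {0..}) (\<lambda>(s, x). F s x)"
    and lim: "\<And>s x. 0 \<le> s \<Longrightarrow> 0 \<le> x \<Longrightarrow> ((\<lambda>j. f j s x) \<longlongrightarrow> F s x) \<F>"
    and "0 < e"
  shows "\<forall>\<^sub>F j in \<F>. \<forall>s\<in>{0..T}. \<forall>x\<in>{0..T}. \<bar>f j s x - F s x\<bar> \<le> e"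
proof (cases "0 < T")
  case False
  then have 0: "s = 0" if "s \<in> {0..T}" for s using that by auto
  have "\<forall>\<^sub>F j in \<F>. dist (f j 0 0) (F 0 0) < e" using lim[of 0 0] \<open>0 < e\<close> by (intro tendstoD) auto
  then show ?thesis
  proof (rule eventually_mono, intro ballI)
    fix j s x assume "dist (f j 0 0) (F 0 0) < e" "s \<in> {0..T}" "x \<in> {0..T}"
    then show "\<bar>f j s x - F s x\<bar> \<le> e" using 0[of s] 0[of x] by (simp add: dist_real_def)
  qed
next
  case True
  have "uniformly_continuous_on ({0..T} \<times> {0..T}) (\<lambda>(s, x). F s x)"
    by (intro compact_uniformly_continuous continuous_on_subset[OF cont] compact_Times) auto
  then obtain d where d: "d > 0" "\<And>s t x y. s \<in> {0..T} \<Longrightarrow> t \<in> {0..T} \<Longrightarrow> x \<in> {0..T} \<Longrightarrow> y \<in> {0..T} \<Longrightarrow>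
      dist (s, x) (t, y) < d \<Longrightarrow> dist (F s x) (F t y) < e/2"
    using \<open>0 < e\<close> unfolding uniformly_continuous_on_def
    by (drule_tac spec[of _ "e/2"]) (fastforce simp: dist_commute)
  obtain m :: nat where m: "2 * T / d < real m" using reals_Archimedean2 by blast
  have m0: "0 < real m" using m d True by (smt (verit) divide_pos_pos)
  define h where "h = T / real m"
  have h: "0 < h" "2 * h < d" "real m * h = T" using m m0 True d by (auto simp: h_def field_simps)
  have bracket: "\<exists>k<m. real k * h \<le> s \<and> s \<le> real (Suc k) * h" if s: "s \<in> {0..T}" for s
  proof (cases "s = T")
    case True
    \<comment> \<open>The right endpoint belongs to the last cell; rounding down would give
      \<open>m\<close>.\<close>
    then show ?thesis using h m0 by (intro exI[of _ "m - 1"]) (auto simp: of_nat_diff algebra_simps)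
  next
    case False
    define k where "k = nat \<lfloor>s / h\<rfloor>"
    have "0 \<le> s / h" using s h by simp
    then have k: "real k \<le> s / h" "s / h < real k + 1" by (auto simp: k_def)
    then have "real k * h \<le> s" "s \<le> real (Suc k) * h" using h by (auto simp: field_simps)
    moreover have "real k * h < real m * h" using calculation(1) False s h by simp
    ultimately show ?thesis using h by auto
  qed
  have grid: "real k * h \<in> {0..T}" if "k \<le> m" for k
    using that h mult_right_mono[of "real k" "real m" h] by auto
  have "\<forall>\<^sub>F j in \<F>. \<forall>k\<in>{..m}. \<forall>l\<in>{..m}. \<bar>f j (real k * h) (real l * h) - F (real k * h) (real l * h)\<bar> < e/2"
  proof (intro eventually_ball_finite ballI finite_atMost)
    fix k l assume "k \<in> {..m}" "l \<in> {..m}"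
    then have "((\<lambda>j. f j (real k * h) (real l * h)) \<longlongrightarrow> F (real k * h) (real l * h)) \<F>"
      using grid by (intro lim) auto
    then show "\<forall>\<^sub>F j in \<F>. \<bar>f j (real k * h) (real l * h) - F (real k * h) (real l * h)\<bar> < e/2"
      using tendstoD[of _ _ _ "e/2"] \<open>0 < e\<close> by (fastforce simp: dist_real_def)
  qed
  then show ?thesis
  proof (rule eventually_mono, intro ballI)
    fix j s x assume close: "\<forall>k\<in>{..m}. \<forall>l\<in>{..m}. \<bar>f j (real k * h) (real l * h) - F (real k * h) (real l * h)\<bar> < e/2"
      and s: "s \<in> {0..T}" and x: "x \<in> {0..T}"
    obtain k where k: "k < m" "real k * h \<le> s" "s \<le> real (Suc k) * h" using bracket[OF s] by blast
    obtain l where l: "l < m" "real l * h \<le> x" "x \<le> real (Suc l) * h" using bracket[OF x] by blast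
    have near: "dist (F (real k' * h) (real l' * h)) (F s x) < e/2"
      if "k' \<in> {k, Suc k}" "l' \<in> {l, Suc l}" for k' l'
    proof (rule d(2))
      have "dist (real k' * h, real l' * h) (s, x) \<le> \<bar>real k' * h - s\<bar> + \<bar>real l' * h - x\<bar>"
        unfolding dist_prod_def using sqrt_sum_squares_le_sum_abs by (simp add: dist_real_def)
      also have "\<dots> \<le> h + h"
        using that k l by (intro add_mono) (auto simp: algebra_simps)
      finally show "dist (real k' * h, real l' * h) (s, x) < d" using h by simp
      have "k' \<le> m" "l' \<le> m" using that k l by auto
      then show "real k' * h \<in> {0..T}" "real l' * h \<in> {0..T}" using grid by blast+
    qed (use s x in auto)
    have "f j s x \<le> f j (real (Suc k) * h) (real (Suc l) * h)"
      using s x k l by (intro mono) auto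
    moreover have "f j (real k * h) (real l * h) \<le> f j s x"
      using h k l by (intro mono) auto
    moreover have "\<bar>f j (real k * h) (real l * h) - F (real k * h) (real l * h)\<bar> < e/2"
      "\<bar>f j (real (Suc k) * h) (real (Suc l) * h) - F (real (Suc k) * h) (real (Suc l) * h)\<bar> < e/2"
      using close k l by (auto simp del: of_nat_Suc)
    ultimately show "\<bar>f j s x - F s x\<bar> \<le> e"
      using near[OF insertI1 insertI1] near[OF insertI2[OF singletonI] insertI2[OF singletonI]]
      unfolding dist_real_def abs_less_iff abs_le_iff by linarith
  qed
qed

lemma monotone_uniform_convergence:
  fixes f :: "'i \<Rightarrow> real \<Rightarrow> real" and F :: "real \<Rightarrow> real"
  assumes "\<And>j s t. 0 \<le> s \<Longrightarrow> s \<le> t \<Longrightarrow> f j s \<le> f j t"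
    and "continuous_on {0..} F"
    and "\<And>s. 0 \<le> s \<Longrightarrow> ((\<lambda>j. f j s) \<longlongrightarrow> F s) \<F>"
    and "0 < e"
  shows "\<forall>\<^sub>F j in \<F>. \<forall>s\<in>{0..T}. \<bar>f j s - F s\<bar> \<le> e"
proof -
  have "continuous_on ({0..} \<times> {0..}) (\<lambda>(s, x). F s)"
    unfolding case_prod_beta by (rule continuous_on_compose2[OF assms(2)]) (auto intro!: continuous_intros)
  then have "\<forall>\<^sub>F j in \<F>. \<forall>s\<in>{0..T}. \<forall>x\<in>{0..T}. \<bar>f j s - F s\<bar> \<le> e"
    using assms by (intro monotone_uniform_convergence2[where f = "\<lambda>j s x. f j s"]) auto
  then show ?thesis by (rule eventually_mono) blast
qed


text \<open>Riemann sums over the arrival time.\<close>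

lemma (in fluid) arrivals_limit:
  fixes E :: "'i \<Rightarrow> real \<Rightarrow> nat" and a u :: "'i \<Rightarrow> int \<Rightarrow> real" and n :: "'i \<Rightarrow> real" and D :: "real set"
  assumes n: "filterlim n at_top \<F>" and dense: "\<And>x y. x < y \<Longrightarrow> \<exists>z\<in>D. x < z \<and> z < y"
    and E_mono: "\<And>j s t. 0 \<le> s \<Longrightarrow> s \<le> t \<Longrightarrow> E j s \<le> E j t"
    and E_0: "\<And>j. E j 0 = 0"
    and E_lim: "\<And>t. 0 \<le> t \<Longrightarrow> ((\<lambda>j. real (E j t) / n j) \<longlongrightarrow> lam * t) \<F>"
    and arrived: "\<And>j i t. 1 \<le> i \<Longrightarrow> 0 \<le> t \<Longrightarrow> a j i \<le> t \<longleftrightarrow> i \<le> int (E j t)"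
    and leads: "\<And>q x. q \<in> \<rat> \<Longrightarrow> 0 < q \<Longrightarrow> x \<in> D \<Longrightarrow>
      ((\<lambda>j. ncard {i. 1 \<le> i \<and> i \<le> \<lfloor>q * n j\<rfloor> \<and> u j i \<le> x} / n j) \<longlongrightarrow> q * G x) \<F>"
  shows arrivals_limit_short: "\<And>T v d. 0 \<le> T \<Longrightarrow> 0 < v \<Longrightarrow> (lam * T + 1) * G (2 * v) < d \<Longrightarrow>
      \<forall>\<^sub>F j in \<F>. ncard {i. 1 \<le> i \<and> a j i \<le> T \<and> u j i \<le> v} \<le> n j * d"
    and arrivals_limit_deadline: "\<And>s x. 0 \<le> s \<Longrightarrow>
      ((\<lambda>j. ncard {i. 1 \<le> i \<and> a j i \<le> s \<and> a j i + u j i \<le> x} / n j)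
        \<longlongrightarrow> lam * (Gam x - Gam (x - s))) \<F>"
proof -
  define C where "C j t x = {i. 1 \<le> i \<and> i \<le> int (E j t) \<and> u j i \<le> x}" for j t x
  define L where "L j q x = {i. 1 \<le> i \<and> i \<le> \<lfloor>q * n j\<rfloor> \<and> u j i \<le> x}" for j q x
  have finC: "finite (C j t x)" for j t x
    by (rule finite_subset[of _ "{1..int (E j t)}"]) (auto simp: C_def)
  note leads' = leads[folded L_def]
  have n_pos: "\<forall>\<^sub>F j in \<F>. 0 < n j" using n by (simp add: filterlim_at_top_dense)
  \<comment> \<open>The number of arrivals is itself only asymptotically known, so it is enclosed
    between rational multiples of \<open>n j\<close>, at which \<open>leads\<close> applies.\<close>
  have C_lim: "((\<lambda>j. ncard (C j t x) / n j) \<longlongrightarrow> lam * t * G x) \<F>" if t: "0 \<le> t" and x: "x \<in> D" for t x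
  proof (cases "t = 0")
    case True
    then have "C j t x = {}" for j by (auto simp: C_def E_0)
    then show ?thesis using True by simp
  next
    case False
    then have lt: "0 < lam * t" using t lam_pos by simp
    show ?thesis
    proof (rule order_tendstoI)
      fix z assume z: "lam * t * G x < z"
      obtain q where q: "q \<in> \<rat>" "lam * t < q" "q * G x < z"
      proof (cases "G x = 0")
        case True
        then show ?thesis using Rats_dense_in_real[of "lam * t" "lam * t + 1"] z that by auto
      next
        case False
        then have "0 < G x" using G_nonneg[of x] by simp
        then have "lam * t < z / G x" using z by (simp add: field_simps)
        then show ?thesis using Rats_dense_in_real[of "lam * t" "z / G x"] \<open>0 < G x\<close> that
          by (auto simp: field_simps)
      qed
      have "\<forall>\<^sub>F j in \<F>. ncard (L j q x) / n j < z"
        using order_tendstoD(2)[OF leads'[OF q(1) _ x]] q lt by auto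
      moreover have "\<forall>\<^sub>F j in \<F>. real (E j t) / n j < q"
        using order_tendstoD(2)[OF E_lim[OF t] q(2)] .
      ultimately show "\<forall>\<^sub>F j in \<F>. ncard (C j t x) / n j < z"
        using n_pos
      proof eventually_elim
        case (elim j)
        have "real (E j t) \<le> q * n j" using elim by (simp add: field_simps)
        then have "int (E j t) \<le> \<lfloor>q * n j\<rfloor>" by (simp add: le_floor_iff)
        then have "C j t x \<subseteq> L j q x" by (auto simp: C_def L_def)
        moreover have "finite (L j q x)"
          by (rule finite_subset[of _ "{1..\<lfloor>q * n j\<rfloor>}"]) (auto simp: L_def)
        ultimately have "card (C j t x) \<le> card (L j q x)"
          by (intro card_mono)
        then have "ncard (C j t x) / n j \<le> ncard (L j q x) / n j"
          using elim by (intro divide_right_mono) auto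
        then show ?case using elim by linarith
      qed
    next
      fix z assume z: "z < lam * t * G x"
      obtain q where q: "q \<in> \<rat>" "0 < q" "q < lam * t" "z < q * G x"
      proof (cases "G x = 0")
        case True
        then show ?thesis using Rats_dense_in_real[OF lt] z that by auto
      next
        case False
        then have "0 < G x" using G_nonneg[of x] by simp
        then have "max 0 (z / G x) < lam * t" using z lt by (simp add: field_simps)
        then show ?thesis using Rats_dense_in_real[of "max 0 (z / G x)" "lam * t"] \<open>0 < G x\<close> that
          by (auto simp: field_simps)
      qed
      have "\<forall>\<^sub>F j in \<F>. z < ncard (L j q x) / n j"
        using order_tendstoD(1)[OF leads'[OF q(1,2) x] q(4)] .
      moreover have "\<forall>\<^sub>F j in \<F>. q < real (E j t) / n j"
        using order_tendstoD(1)[OF E_lim[OF t] q(3)] .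
      ultimately show "\<forall>\<^sub>F j in \<F>. z < ncard (C j t x) / n j"
        using n_pos
      proof eventually_elim
        case (elim j)
        have "q * n j \<le> real (E j t)" using elim by (simp add: field_simps)
        then have "\<lfloor>q * n j\<rfloor> \<le> int (E j t)" by linarith
        then have "card (L j q x) \<le> card (C j t x)"
          by (intro card_mono finC) (auto simp: C_def L_def)
        then have "ncard (L j q x) / n j \<le> ncard (C j t x) / n j"
          using elim by (intro divide_right_mono) auto
        then show ?case using elim by linarith
      qed
    qed
  qed
  {
    fix T v d assume T: "0 \<le> T" "0 < v" "(lam * T + 1) * G (2 * v) < d"
    \<comment> \<open>The bound is stated with \<open>G (2 * v)\<close> to leave room for a
      continuity point above \<open>v\<close>.\<close>
    obtain z where z: "z \<in> D" "v < z" "z < 2 * v" using dense[of v "2 * v"] T by auto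
    have "lam * T * G z \<le> (lam * T + 1) * G (2 * v)"
      using T z lam_pos G_nonneg monoD[OF G_mono, of z "2 * v"] by (intro mult_mono) auto
    then have "\<forall>\<^sub>F j in \<F>. ncard (C j T z) / n j < d"
      using order_tendstoD(2)[OF C_lim[OF T(1) z(1)]] T by auto
    then show "\<forall>\<^sub>F j in \<F>. ncard {i. 1 \<le> i \<and> a j i \<le> T \<and> u j i \<le> v} \<le> n j * d"
      using n_pos
    proof eventually_elim
      case (elim j)
      have "card {i. 1 \<le> i \<and> a j i \<le> T \<and> u j i \<le> v} \<le> card (C j T z)"
        using z arrived T by (intro card_mono finC) (auto simp: C_def)
      also have "ncard (C j T z) \<le> n j * d" using elim by (simp add: field_simps)
      finally show ?case by simp
    qed
  }
  fix s x :: real assume s: "0 \<le> s"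
  define B where "B j t = {i. 1 \<le> i \<and> a j i \<le> t \<and> a j i + u j i \<le> x}" for j t
  have finB: "finite (B j t)" if "0 \<le> t" for j t
    by (rule finite_subset[of _ "{1..int (E j t)}"]) (use that arrived in \<open>auto simp: B_def\<close>)
  have B_mono: "B j t \<subseteq> B j t'" if "t \<le> t'" for j t t' using that by (auto simp: B_def)
  have C_mono: "C j t z \<subseteq> C j t' z" if "0 \<le> t" "t \<le> t'" for j t t' z
    using E_mono[OF that, of j] by (auto simp: C_def)
  have B_diff: "ncard (B j t' - B j t) = ncard (B j t') - ncard (B j t)"
    if "0 \<le> t" "t \<le> t'" for j t t'
    using that finB B_mono[of t t' j] by (intro real_card_Diff_subset) auto
  have C_diff: "ncard (C j t' z - C j t z) = ncard (C j t' z) - ncard (C j t z)"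
    if "0 \<le> t" "t \<le> t'" for j t t' z
    using finC C_mono[OF that, of j z] by (intro real_card_Diff_subset) auto
  \<comment> \<open>For an arrival in \<open>(t, t']\<close>, a deadline at most \<open>x\<close>
    forces a lead time below \<open>x - t\<close>; conversely a lead time at most
    \<open>x - t'\<close> guarantees such a deadline, which gives \<open>low\<close>.\<close>
  have up: "ncard (B j t') - ncard (B j t) \<le> ncard (C j t' z) - ncard (C j t z)"
    if t: "0 \<le> t" "t \<le> t'" and "x - t \<le> z" for j t t' z
  proof -
    have "B j t' - B j t \<subseteq> C j t' z - C j t z"
    proof
      fix i assume i: "i \<in> B j t' - B j t"
      then have *: "1 \<le> i" "a j i \<le> t'" "a j i + u j i \<le> x" "\<not> a j i \<le> t" by (auto simp: B_def)
      then have "i \<le> int (E j t')" "\<not> i \<le> int (E j t)"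
        using arrived[of i t j] arrived[of i t' j] t by simp_all
      then show "i \<in> C j t' z - C j t z" using * that by (simp add: C_def)
    qed
    then show ?thesis
      unfolding B_diff[OF t, symmetric] C_diff[OF t, symmetric]
      by (intro of_nat_mono card_mono finite_Diff finC)
  qed
  have low: "ncard (C j t' z) - ncard (C j t z) \<le> ncard (B j t') - ncard (B j t)"
    if t: "0 \<le> t" "t \<le> t'" and "z \<le> x - t'" for j t t' z
  proof -
    have "C j t' z - C j t z \<subseteq> B j t' - B j t"
    proof
      fix i assume i: "i \<in> C j t' z - C j t z"
      then have *: "1 \<le> i" "i \<le> int (E j t')" "\<not> i \<le> int (E j t)" "u j i \<le> z" by (auto simp: C_def)
      then have "a j i \<le> t'" "\<not> a j i \<le> t"
        using arrived[of i t j] arrived[of i t' j] t by simp_all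
      then show "i \<in> B j t' - B j t" using * that by (simp add: B_def)
    qed
    then show ?thesis
      unfolding B_diff[OF t, symmetric] C_diff[OF t, symmetric]
      using t by (intro of_nat_mono card_mono finite_Diff finB) auto
  qed
  have B0: "B j 0 = {}" for j using arrived[of _ 0 j] E_0[of j] by (auto simp: B_def)
  show "((\<lambda>j. ncard {i. 1 \<le> i \<and> a j i \<le> s \<and> a j i + u j i \<le> x} / n j)
        \<longlongrightarrow> lam * (Gam x - Gam (x - s))) \<F>"
    unfolding B_def[symmetric]
  proof (cases "s = 0")
    case True
    then show "((\<lambda>j. ncard (B j s) / n j) \<longlongrightarrow> lam * (Gam x - Gam (x - s))) \<F>" by (simp add: B0)
  next
    case False
    with s have "0 < s" by simp
    define inc where "inc m j z = (\<Sum>k<m. (ncard (C j (real (Suc k) * (s / real m)) (z k))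
        - ncard (C j (real k * (s / real m)) (z k))) / n j)" for m j and z :: "nat \<Rightarrow> real"
    have inc_lim: "((\<lambda>j. inc m j z) \<longlongrightarrow> (\<Sum>k<m. lam * (s / real m) * G (z k))) \<F>"
      if "\<And>k. z k \<in> D" for m z
    proof -
      have "((\<lambda>j. inc m j z) \<longlongrightarrow> (\<Sum>k<m. lam * (real (Suc k) * (s / real m)) * G (z k)
          - lam * (real k * (s / real m)) * G (z k))) \<F>"
        unfolding inc_def diff_divide_distrib
        using that \<open>0 < s\<close> by (intro tendsto_sum tendsto_diff C_lim) auto
      also have "(\<Sum>k<m. lam * (real (Suc k) * (s / real m)) * G (z k)
          - lam * (real k * (s / real m)) * G (z k)) = (\<Sum>k<m. lam * (s / real m) * G (z k))"
        by (intro sum.cong) (auto simp: algebra_simps add_divide_distrib)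
      finally show ?thesis .
    qed
    have tele: "ncard (B j s) / n j =
        (\<Sum>k<m. (ncard (B j (real (Suc k) * (s / real m))) - ncard (B j (real k * (s / real m)))) / n j)"
      if "0 < m" for j m
      using sum_lessThan_telescope[of "\<lambda>k. ncard (B j (real k * (s / real m)))" m] that
      by (simp add: B0 flip: sum_divide_distrib)
    have bounds: "\<exists>z. (\<forall>k. z k \<in> D) \<and> (\<forall>j. 0 < n j \<longrightarrow> ncard (B j s) / n j \<le> inc m j z) \<and>
        (\<Sum>k<m. lam * (s / real m) * G (z k)) \<le> lam * (Gam x - Gam (x - s)) + lam * (2 * (s / real m))"
      "\<exists>z. (\<forall>k. z k \<in> D) \<and> (\<forall>j. 0 < n j \<longrightarrow> inc m j z \<le> ncard (B j s) / n j) \<and>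
        lam * (Gam x - Gam (x - s)) - lam * (2 * (s / real m)) \<le> (\<Sum>k<m. lam * (s / real m) * G (z k))"
      if "0 < m" for m
    proof -
      define h where "h = s / real m"
      have h: "0 < h" "real m * h = s" using \<open>0 < s\<close> that by (auto simp: h_def)
      have "\<exists>z\<in>D. x - real k * h < z \<and> z < x - real k * h + h" for k using dense h by simp
      then obtain z where z: "\<And>k. z k \<in> D" "\<And>k. x - real k * h < z k" "\<And>k. z k < x - real k * h + h"
        by metis
      \<comment> \<open>Shifting each cell to the right bounds \<open>h * G (z k)\<close> by an
        increment of \<open>Gam\<close>, so the sum telescopes even though \<open>G\<close> may
        jump; the total shift \<open>2 * h\<close> costs at most \<open>2 * h\<close>.\<close>
      have "(\<Sum>k<m. h * G (z k)) \<le> (\<Sum>k<m. Gam (x - real k * h + 2 * h) - Gam (x - real (Suc k) * h + 2 * h))"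
      proof (rule sum_mono)
        fix k
        have "h * G (z k) \<le> h * G (x - real k * h + h)"
          using z(3)[of k] h by (intro mult_left_mono monoD[OF G_mono]) auto
        also have "\<dots> \<le> Gam (x - real k * h + 2 * h) - Gam (x - real k * h + h)"
          using Gam_bounds(1)[of "x - real k * h + h" "x - real k * h + 2 * h"] h by simp
        finally show "h * G (z k) \<le> Gam (x - real k * h + 2 * h) - Gam (x - real (Suc k) * h + 2 * h)"
          by (simp add: algebra_simps)
      qed
      also have "\<dots> = Gam (x + 2 * h) - Gam (x - s + 2 * h)"
        using sum_lessThan_telescope'[of "\<lambda>k. Gam (x - real k * h + 2 * h)" m] h by simp
      also have "\<dots> \<le> Gam x - Gam (x - s) + 2 * h"
        using Gam_lipschitz[of x "x + 2 * h"] Gam_mono[of "x - s" "x - s + 2 * h"] h by simp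
      finally have "lam * (\<Sum>k<m. h * G (z k)) \<le> lam * (Gam x - Gam (x - s) + 2 * h)"
        using lam_pos by (intro mult_left_mono) auto
      then have "(\<Sum>k<m. lam * h * G (z k)) \<le> lam * (Gam x - Gam (x - s)) + lam * (2 * h)"
        by (simp add: sum_distrib_left algebra_simps)
      moreover have "ncard (B j s) / n j \<le> inc m j z" if "0 < n j" for j
        unfolding tele[OF \<open>0 < m\<close>] inc_def h_def[symmetric]
        using that h z(2) by (intro sum_mono divide_right_mono up) (auto intro: less_imp_le)
      ultimately show "\<exists>z. (\<forall>k. z k \<in> D) \<and> (\<forall>j. 0 < n j \<longrightarrow> ncard (B j s) / n j \<le> inc m j z) \<and>
        (\<Sum>k<m. lam * (s / real m) * G (z k)) \<le> lam * (Gam x - Gam (x - s)) + lam * (2 * (s / real m))"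
        using z(1) unfolding h_def by blast
      have "\<exists>z\<in>D. x - real (Suc k) * h - h < z \<and> z < x - real (Suc k) * h" for k using dense h by simp
      then obtain z where z: "\<And>k. z k \<in> D" "\<And>k. x - real (Suc k) * h - h < z k" "\<And>k. z k < x - real (Suc k) * h"
        by metis
      have "Gam x - Gam (x - s) - 2 * h \<le> Gam (x - 2 * h) - Gam (x - s - 2 * h)"
        using Gam_lipschitz[of "x - 2 * h" x] Gam_mono[of "x - s - 2 * h" "x - s"] h by simp
      also have "\<dots> = (\<Sum>k<m. Gam (x - real k * h - 2 * h) - Gam (x - real (Suc k) * h - 2 * h))"
        using sum_lessThan_telescope'[of "\<lambda>k. Gam (x - real k * h - 2 * h)" m] h by simp
      also have "\<dots> \<le> (\<Sum>k<m. h * G (z k))"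
      proof (rule sum_mono)
        fix k
        have "Gam (x - real k * h - 2 * h) - Gam (x - real (Suc k) * h - 2 * h) \<le> h * G (x - real k * h - 2 * h)"
          using Gam_bounds(2)[of "x - real (Suc k) * h - 2 * h" "x - real k * h - 2 * h"] h
          by (simp add: algebra_simps)
        also have "\<dots> \<le> h * G (z k)"
          using z(2)[of k] h by (intro mult_left_mono monoD[OF G_mono]) (auto simp: algebra_simps)
        finally show "Gam (x - real k * h - 2 * h) - Gam (x - real (Suc k) * h - 2 * h) \<le> h * G (z k)" .
      qed
      finally have "lam * (Gam x - Gam (x - s) - 2 * h) \<le> lam * (\<Sum>k<m. h * G (z k))"
        using lam_pos by (intro mult_left_mono) auto
      then have "lam * (Gam x - Gam (x - s)) - lam * (2 * h) \<le> (\<Sum>k<m. lam * h * G (z k))"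
        by (simp add: sum_distrib_left algebra_simps)
      moreover have "inc m j z \<le> ncard (B j s) / n j" if "0 < n j" for j
        unfolding tele[OF \<open>0 < m\<close>] inc_def h_def[symmetric]
        using that h z(3) by (intro sum_mono divide_right_mono low) (auto intro: less_imp_le)
      ultimately show "\<exists>z. (\<forall>k. z k \<in> D) \<and> (\<forall>j. 0 < n j \<longrightarrow> inc m j z \<le> ncard (B j s) / n j) \<and>
        lam * (Gam x - Gam (x - s)) - lam * (2 * (s / real m)) \<le> (\<Sum>k<m. lam * (s / real m) * G (z k))"
        using z(1) unfolding h_def by blast
    qed
    have fine: "\<exists>m>0. lam * (2 * (s / real m)) < e" if "0 < e" for e
    proof -
      obtain m :: nat where m: "2 * lam * s / e < real m" using reals_Archimedean2 by blast
      moreover have "0 < 2 * lam * s / e" using that \<open>0 < s\<close> lam_pos by simp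
      ultimately have "0 < real m" by linarith
      with m that show ?thesis by (intro exI[of _ m]) (auto simp: field_simps)
    qed
    show "((\<lambda>j. ncard (B j s) / n j) \<longlongrightarrow> lam * (Gam x - Gam (x - s))) \<F>"
    proof (rule order_tendstoI)
      fix r assume r: "lam * (Gam x - Gam (x - s)) < r"
      obtain m where m: "0 < m" "lam * (2 * (s / real m)) < r - lam * (Gam x - Gam (x - s))"
        using fine[of "r - lam * (Gam x - Gam (x - s))"] r by auto
      obtain z where z: "\<And>k. z k \<in> D" "\<And>j. 0 < n j \<Longrightarrow> ncard (B j s) / n j \<le> inc m j z"
        "(\<Sum>k<m. lam * (s / real m) * G (z k)) \<le> lam * (Gam x - Gam (x - s)) + lam * (2 * (s / real m))"
        using bounds(1)[OF m(1)] by auto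
      have "\<forall>\<^sub>F j in \<F>. inc m j z < r"
        using order_tendstoD(2)[OF inc_lim] z m by fastforce
      then show "\<forall>\<^sub>F j in \<F>. ncard (B j s) / n j < r"
        using n_pos by eventually_elim (use z(2) in \<open>fastforce intro: le_less_trans\<close>)
    next
      fix r assume r: "r < lam * (Gam x - Gam (x - s))"
      obtain m where m: "0 < m" "lam * (2 * (s / real m)) < lam * (Gam x - Gam (x - s)) - r"
        using fine[of "lam * (Gam x - Gam (x - s)) - r"] r by auto
      obtain z where z: "\<And>k. z k \<in> D" "\<And>j. 0 < n j \<Longrightarrow> inc m j z \<le> ncard (B j s) / n j"
        "lam * (Gam x - Gam (x - s)) - lam * (2 * (s / real m)) \<le> (\<Sum>k<m. lam * (s / real m) * G (z k))"
        using bounds(2)[OF m(1)] by auto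
      have "\<forall>\<^sub>F j in \<F>. r < inc m j z"
        using order_tendstoD(1)[OF inc_lim] z m by fastforce
      then show "\<forall>\<^sub>F j in \<F>. r < ncard (B j s) / n j"
        using n_pos by eventually_elim (use z(2) in \<open>fastforce intro: less_le_trans\<close>)
    qed
  qed
qed

text \<open>Pointwise limits of the primitives become uniform on \<open>{0..T'}\<close> by
  monotonicity, so that eventually every path satisfies \<open>fluid_run\<close> with the constants
  of \<open>constants_exist\<close>.\<close>

theorem (in fluid) fluid_limit:
  fixes E S X R :: "'i \<Rightarrow> real \<Rightarrow> nat" and a u :: "'i \<Rightarrow> int \<Rightarrow> real" and b :: "'i \<Rightarrow> int \<Rightarrow> ereal"
    and n :: "'i \<Rightarrow> real" and D :: "real set"
  assumes n: "filterlim n at_top \<F>" and dense: "\<And>x y. x < y \<Longrightarrow> \<exists>z\<in>D. x < z \<and> z < y"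
    and path: "\<And>j. edf_path (E j) (S j) (X j) (R j) (a j) (u j) (b j)"
    and E_mono: "\<And>j s t. 0 \<le> s \<Longrightarrow> s \<le> t \<Longrightarrow> E j s \<le> E j t"
    and E_0: "\<And>j. E j 0 = 0"
    and arrived: "\<And>j i t. 1 \<le> i \<Longrightarrow> 0 \<le> t \<Longrightarrow> a j i \<le> t \<longleftrightarrow> i \<le> int (E j t)"
    and E_lim: "\<And>t. 0 \<le> t \<Longrightarrow> ((\<lambda>j. real (E j t) / n j) \<longlongrightarrow> lam * t) \<F>"
    and S_mono: "\<And>j s t. 0 \<le> s \<Longrightarrow> s \<le> t \<Longrightarrow> S j s \<le> S j t"
    and S_lim: "\<And>t. 0 \<le> t \<Longrightarrow> ((\<lambda>j. real (S j t) / n j) \<longlongrightarrow> mu * t) \<F>"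
    and leads: "\<And>q x. q \<in> \<rat> \<Longrightarrow> 0 < q \<Longrightarrow> x \<in> D \<Longrightarrow>
      ((\<lambda>j. ncard {i. 1 \<le> i \<and> i \<le> \<lfloor>q * n j\<rfloor> \<and> u j i \<le> x} / n j) \<longlongrightarrow> q * G x) \<F>"
    and initial_lim: "\<And>x. 0 \<le> x \<Longrightarrow>
      ((\<lambda>j. ncard {i \<in> queued (X j 0) (a j) (u j) (b j) 0. a j i + u j i \<le> x} / n j) \<longlongrightarrow> G0 x) \<F>"
    and X0_lim: "((\<lambda>j. real (X j 0) / n j) \<longlongrightarrow> q0) \<F>"
    and X_right: "\<And>j t. 0 \<le> t \<Longrightarrow> 0 < X j t \<Longrightarrow> \<exists>h>0. \<forall>s. t \<le> s \<and> s < t + h \<longrightarrow> 0 < X j s"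
    and "0 \<le> T" "0 < \<delta>"
  shows "\<forall>\<^sub>F j in \<F>. \<forall>t\<in>{0..T}. \<bar>real (R j t) / n j - eta t\<bar> \<le> \<delta> \<and> \<bar>real (X j t - 1) / n j - phi t\<bar> \<le> \<delta>"
proof (cases rule: constants_exist[OF \<open>0 \<le> T\<close> divide_pos_pos[OF \<open>0 < \<delta>\<close> zero_less_numeral[of "num.Bit0 (num.Bit0 num.One)"]]])
  case (1 T' e d c v y w p)
  note k = 1 and e = \<open>0 < e\<close>
  have n_large: "\<forall>\<^sub>F j in \<F>. 0 < n j" "\<forall>\<^sub>F j in \<F>. 1 / e < n j"
    using n by (auto simp: filterlim_at_top_dense)
  \<comment> \<open>Uniform convergence is derived from monotonicity at every index, so the scale is
    made positive where it is not; eventually this changes nothing.\<close>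
  define nn where "nn j = (if 0 < n j then n j else 1)" for j
  have nn: "0 \<le> nn j" for j by (simp add: nn_def)
  have ev_nn: "\<forall>\<^sub>F j in \<F>. nn j = n j" using n_large(1) by eventually_elim (simp add: nn_def)
  have to_nn: "((\<lambda>j. f j / nn j) \<longlongrightarrow> l) \<F>" if "((\<lambda>j. f j / n j) \<longlongrightarrow> l) \<F>" for f and l :: real
    by (rule Lim_transform_eventually[OF that]) (use ev_nn in eventually_elim, simp)
  have queue0: "finite (queued (X j 0) (a j) (u j) (b j) 0)" for j
    using edf_path.queue_length[OF path, of 0] by simp
  have fin: "finite {i. 1 \<le> i \<and> a j i \<le> s \<and> P i}" if "0 \<le> s" for j s P
    by (rule finite_subset[of _ "{1..int (E j s)}"]) (use arrived that in auto)
  have E_close: "\<forall>\<^sub>F j in \<F>. \<forall>s\<in>{0..T'}. \<bar>real (E j s) / nn j - lam * s\<bar> \<le> e"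
    by (rule monotone_uniform_convergence)
      (use E_mono to_nn[OF E_lim] e nn in \<open>auto intro!: continuous_intros divide_right_mono\<close>)
  have S_close: "\<forall>\<^sub>F j in \<F>. \<forall>s\<in>{0..T'}. \<bar>real (S j s) / nn j - mu * s\<bar> \<le> e"
    by (rule monotone_uniform_convergence)
      (use S_mono to_nn[OF S_lim] e nn in \<open>auto intro!: continuous_intros divide_right_mono\<close>)
  have I_close: "\<forall>\<^sub>F j in \<F>. \<forall>x\<in>{0..T'}.
      \<bar>ncard {i \<in> queued (X j 0) (a j) (u j) (b j) 0. a j i + u j i \<le> x} / nn j - G0 x\<bar> \<le> e"
    by (rule monotone_uniform_convergence)
      (use to_nn[OF initial_lim] e nn queue0 G0_cont in
        \<open>auto intro!: divide_right_mono card_mono\<close>)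
  have A_close: "\<forall>\<^sub>F j in \<F>. \<forall>s\<in>{0..T'}. \<forall>x\<in>{0..T'}.
      \<bar>ncard {i. 1 \<le> i \<and> a j i \<le> s \<and> a j i + u j i \<le> x} / nn j - lam * (Gam x - Gam (x - s))\<bar> \<le> e"
  proof (rule monotone_uniform_convergence2[OF _ _ _ e])
    show "continuous_on ({0..} \<times> {0..}) (\<lambda>(s, x). lam * (Gam x - Gam (x - s)))"
      unfolding case_prod_beta
      by (intro continuous_intros continuous_on_compose2[OF Gam_cont]) auto
    show "((\<lambda>j. ncard {i. 1 \<le> i \<and> a j i \<le> s \<and> a j i + u j i \<le> x} / nn j)
        \<longlongrightarrow> lam * (Gam x - Gam (x - s))) \<F>" if "0 \<le> s" for s x
      by (rule to_nn, rule arrivals_limit_deadline[OF n dense E_mono E_0 E_lim arrived leads that])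
    show "ncard {i. 1 \<le> i \<and> a j i \<le> s \<and> a j i + u j i \<le> x} / nn j
      \<le> ncard {i. 1 \<le> i \<and> a j i \<le> t \<and> a j i + u j i \<le> y} / nn j"
      if "0 \<le> s" "s \<le> t" "x \<le> y" for j s t x y
      using that nn[of j] fin[of t] by (intro divide_right_mono of_nat_mono card_mono) auto
  qed
  \<comment> \<open>The radius \<open>q0\<close> excludes \<open>X j 0 = 0\<close>, as
    \<open>edf_run\<close> requires.\<close>
  have X0_close: "\<forall>\<^sub>F j in \<F>. dist (real (X j 0) / n j) q0 < min e q0"
    using X0_lim e q0_pos by (intro tendstoD) auto
  have short: "\<forall>\<^sub>F j in \<F>. ncard {i. 1 \<le> i \<and> a j i \<le> T \<and> u j i \<le> v} \<le> n j * d"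
    using arrivals_limit_short[OF n dense E_mono E_0 E_lim arrived leads \<open>0 \<le> T\<close> \<open>0 < v\<close> k(9)] .
  show ?thesis
    using n_large ev_nn E_close S_close I_close A_close X0_close short
  proof eventually_elim
    case (elim j)
    have N: "0 < n j" "1 / e < n j" "nn j = n j" using elim by auto
    have scale: "\<bar>r - n j * z\<bar> \<le> n j * e" if "\<bar>r / n j - z\<bar> \<le> e" for r z
    proof -
      have "r - n j * z = n j * (r / n j - z)" using N(1) by (simp add: field_simps)
      then have "\<bar>r - n j * z\<bar> = n j * \<bar>r / n j - z\<bar>" using N(1) by (simp add: abs_mult)
      then show ?thesis using that N(1) by simp
    qed
    have "0 < X j 0" using elim(8) q0_pos N by (cases "X j 0 = 0") (auto simp: dist_real_def)
    then interpret run: edf_run "E j" "S j" "X j" "R j" "a j" "u j" "b j"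
      using path arrived E_0 by (intro edf_run.intro edf_run_axioms.intro) auto
    interpret fluid_run lam mu F0 q0 G G0 "E j" "S j" "X j" "R j" "a j" "u j" "b j"
      "n j" T T' e d c v y w p
    proof (unfold_locales)
      show "\<bar>ncard (run.arrivals s x) - n j * (lam * (Gam x - Gam (x - s)))\<bar> \<le> n j * e"
        if "0 \<le> s" "s \<le> T'" "0 \<le> x" "x \<le> T'" for s x
        using elim(7) that unfolding N run.arrivals_def run.due_def by (intro scale) auto
      show "\<bar>real (S j s) - n j * (mu * s)\<bar> \<le> n j * e" if "0 \<le> s" "s \<le> T'" for s
        using elim(5) that unfolding N by (intro scale) auto
      show "\<bar>real (E j s) - n j * (lam * s)\<bar> \<le> n j * e" if "0 \<le> s" "s \<le> T'" for s
        using elim(4) that unfolding N by (intro scale) auto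
      show "\<bar>ncard (run.initial x) - n j * G0 x\<bar> \<le> n j * e" if "0 \<le> x" "x \<le> T'" for x
        using elim(6) that unfolding N run.initial_def run.due_def by (intro scale) auto
      show "\<bar>real (X j 0) - n j * q0\<bar> \<le> n j * e"
        using elim(8) by (intro scale) (auto simp: dist_real_def)
      show "1 \<le> n j * e" using N e by (simp add: field_simps)
    qed (use k N elim(9) \<open>0 \<le> T\<close> X_right in auto)
    \<comment> \<open>The constants were taken for \<open>\<delta> / 4\<close>, since the queue is
      approximated up to \<open>4 * d\<close>.\<close>
    show ?case
      using fluid_approximation k(2,3) by fastforce
  qed
qed

section \<open>Convergence of the queue\<close>

text \<open>The levels lie within \<open>\<kappa> / 2\<close> of the supremum \<open>ys\<close> of
  \<open>Y\<close>. Above \<open>ys\<close> but below \<open>y_max G\<close>, a point outside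
  \<open>Y\<close> gives \<open>mu \<le> lam * G p\<close>, and strict increase of \<open>G\<close>
  makes the inequality strict at the next point, excluding a plateau at height \<open>mu\<close>.
  Beyond \<open>y_max G\<close> the value of \<open>G\<close> is 1 and \<open>mu < lam\<close>
  decides.\<close>

lemma frontier_levels_exist:
  assumes nu: "real_distribution nu" and G: "G = cdf nu"
    and G_strict: "strict_mono_on {x. 0 < x \<and> ereal x < y_max G} G"
    and G_cont_0: "isCont G 0" and G_0: "G 0 = 0"
    and mu: "0 < mu" "mu < lam" and F0: "ereal F0 \<le> y_star lam mu G" and "0 < \<kappa>"
  shows "\<exists>y1 y2. y1 < y2 \<and> y2 \<le> y1 + \<kappa> \<and> F0 < y2 \<and> lam * G y1 \<le> mu \<and> mu < lam * G y2"
proof -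
  interpret nu: real_distribution nu by (rule nu)
  have mono: "G x \<le> G y" if "x \<le> y" for x y using nu.cdf_nondecreasing that by (simp add: G)
  define Y where "Y = {y. ereal y < y_max G \<and> lam * G y < mu}"
  obtain h where h: "h > 0" "G h < 1"
  proof -
    have "(G \<longlongrightarrow> 0) (at_right 0)"
      using G_cont_0 G_0 by (auto simp: isCont_def intro: tendsto_within_subset)
    then have "\<forall>\<^sub>F x in at_right 0. G x < 1" by (rule order_tendstoD(2)) simp
    then obtain b where "b > 0" "\<forall>y>0. y < b \<longrightarrow> G y < 1" by (auto simp: eventually_at_right_field)
    then show ?thesis by (intro that[of "b/2"]) auto
  qed
  have "ereal h \<le> y_max G"
    unfolding y_max_def
  proof (rule Inf_greatest)
    fix z assume "z \<in> ereal ` {x. G x = 1}"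
    then obtain x where x: "z = ereal x" "G x = 1" by auto
    then have "\<not> x \<le> h" using mono[of x h] h by auto
    then show "ereal h \<le> z" using x by simp
  qed
  then have "0 < y_max G" using h by (metis ereal_less(2) less_le_trans)
  then have Y0: "0 \<in> Y" using mu G_0 by (simp add: Y_def zero_ereal_def)
  \<comment> \<open>Bounds \<open>Y\<close> from above, so that its supremum is a genuine real
    number.\<close>
  obtain m where m: "mu / lam < G m"
  proof -
    have "(G \<longlongrightarrow> 1) at_top" using nu.cdf_lim_at_top_prob by (simp add: G)
    then have "\<forall>\<^sub>F x in at_top. mu / lam < G x" using mu by (intro order_tendstoD(1)) auto
    then show ?thesis using that eventually_happens'[OF trivial_limit_at_top_linorder] by blast
  qed
  have bdd: "y \<le> m" if "y \<in> Y" for y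
  proof (rule ccontr)
    assume "\<not> y \<le> m"
    then have "mu / lam < G y" using m mono[of m y] by simp
    then show False using that mu by (simp add: Y_def field_simps)
  qed
  define ys where "ys = Sup Y"
  have bddY: "bdd_above Y" using bdd by (intro bdd_aboveI)
  have ys: "0 \<le> ys" using Y0 bddY by (auto simp: ys_def intro: cSup_upper)
  have "y_star lam mu G \<le> ereal ys"
    unfolding y_star_def Y_def[symmetric] ys_def by (intro Sup_least) (auto intro: cSup_upper[OF _ bddY])
  then have "F0 \<le> ys" using F0 by (metis ereal_less_eq(3) order_trans)
  obtain y1 where y1: "y1 \<in> Y" "ys - \<kappa> / 2 < y1"
    using less_cSupD[of Y "ys - \<kappa>/2"] Y0 \<open>0 < \<kappa>\<close> unfolding ys_def by auto
  have y1_le: "y1 \<le> ys" unfolding ys_def using y1 bddY by (intro cSup_upper)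
  define y2 where "y2 = ys + \<kappa> / 2"
  have "mu < lam * G y2"
  proof (cases "y_max G < ereal y2")
    case True
    then obtain x where "G x = 1" "x < y2" unfolding y_max_def by (auto simp: Inf_less_iff)
    then have "1 \<le> G y2" using mono[of x y2] by simp
    then have "lam * 1 \<le> lam * G y2" using mu by (intro mult_left_mono) auto
    then show ?thesis using mu by linarith
  next
    case False
    define p q where "p = ys + \<kappa> / 8" and "q = ys + \<kappa> / 4"
    have pq: "ys < p" "p < q" "q < y2" using \<open>0 < \<kappa>\<close> by (auto simp: p_def q_def y2_def)
    have lt: "ereal p < y_max G" "ereal q < y_max G"
      using False pq less_le_trans[of "ereal p" "ereal y2" "y_max G"] less_le_trans[of "ereal q" "ereal y2" "y_max G"]
      by (simp_all add: not_less)
    have "p \<notin> Y" using cSup_upper[OF _ bddY, of p] pq by (auto simp: ys_def)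
    then have "mu \<le> lam * G p" using lt by (simp add: Y_def)
    moreover have "G p < G q" using strict_mono_onD[OF G_strict, of p q] lt pq ys by auto
    then have "lam * G p < lam * G q" using mu by simp
    moreover have "lam * G q \<le> lam * G y2" using mono[of q y2] pq mu by (intro mult_left_mono) auto
    ultimately show ?thesis by linarith
  qed
  moreover have "lam * G y1 \<le> mu" using y1 by (simp add: Y_def)
  ultimately show ?thesis
    using y1_le y1 \<open>F0 \<le> ys\<close> \<open>0 < \<kappa>\<close> unfolding y2_def
    by - (rule exI[of _ y1], rule exI[of _ "ys + \<kappa> / 2"], simp)
qed

section \<open>Identification of the stated limit with the fluid model\<close>

lemma finite_borel_measures_sets:
  assumes "Q0 \<in> finite_borel_measures"
  shows "finite_measure Q0" "space Q0 = {0..}" "\<And>B. B \<subseteq> {0..} \<Longrightarrow> B \<in> sets borel \<Longrightarrow> B \<in> sets Q0"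
proof -
  have s: "sets Q0 = sets (restrict_space borel {0..})" "finite_measure Q0"
    using assms by (auto simp: finite_borel_measures_def)
  show "finite_measure Q0" by fact
  show "space Q0 = {0..}" using sets_eq_imp_space_eq[OF s(1)] by (simp add: space_restrict_space)
  show "B \<in> sets Q0" if "B \<subseteq> {0..}" "B \<in> sets borel" for B
    using that unfolding s(1) by (simp add: sets_restrict_space_iff)
qed

lemma fluid_instance:
  assumes lam: "0 < mu" "mu \<le> lam"
    and nu: "real_distribution nu" and G: "G = cdf nu"
    and G_strict: "strict_mono_on {x. 0 < x \<and> ereal x < y_max G} G"
    and G_cont_0: "isCont G 0" and G_0: "G 0 = 0"
    and Q0: "Q0 \<in> finite_borel_measures"
    and F0: "0 \<le> F0" "ereal F0 \<le> y_star lam mu G"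
    and Q0_zero: "measure Q0 {0..F0} = 0"
    and G0_cont: "continuous_on {0..} (\<lambda>x. measure Q0 {0..x})"
    and Q0_pos: "\<And>x. x > F0 \<Longrightarrow> measure Q0 {0..x} > 0"
  shows "fluid lam mu F0 (measure Q0 {0..}) G (\<lambda>x. measure Q0 {0..x})"
proof
  interpret nu: real_distribution nu by (rule nu)
  interpret Q0: finite_measure Q0 using finite_borel_measures_sets(1)[OF Q0] .
  note sets = finite_borel_measures_sets(3)[OF Q0]
  show mono: "mono G" using nu.cdf_nondecreasing by (simp add: G mono_def)
  show nonneg: "0 \<le> G x" for x using nu.cdf_nonneg by (simp add: G)
  show "G x \<le> 1" for x using nu.cdf_bounded_prob by (simp add: G)
  show "G x = 0" if "x \<le> 0" for x using monoD[OF mono that] nonneg[of x] G_0 by simp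
  have "(G \<longlongrightarrow> G 0) (at 0)" using G_cont_0 by (simp add: isCont_def)
  then show "(G \<longlongrightarrow> 0) (at_right 0)" using G_0 by (auto intro: tendsto_within_subset)
  show "\<exists>y1 y2. y1 < y2 \<and> y2 \<le> y1 + \<kappa> \<and> F0 < y2 \<and> lam * G y1 \<le> mu \<and> mu < lam * G y2"
    if "mu < lam" "0 < \<kappa>" for \<kappa>
    by (rule frontier_levels_exist[OF nu G G_strict G_cont_0 G_0 lam(1) that(1) F0(2) that(2)])
  show "measure Q0 {0..x} \<le> measure Q0 {0..y}" if "x \<le> y" for x y
    using that by (intro Q0.finite_measure_mono sets) auto
  show "measure Q0 {0..0} = 0"
  proof -
    have "measure Q0 {0..0} \<le> measure Q0 {0..F0}"
      using F0 by (intro Q0.finite_measure_mono sets) auto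
    then show ?thesis using Q0_zero measure_nonneg[of Q0 "{0..0}"] by linarith
  qed
  show "measure Q0 {0..x} \<le> measure Q0 {0..}" for x
    by (intro Q0.finite_measure_mono sets) auto
qed (use assms in auto)

text \<open>The tail of \<open>Q0\<close> turns the total mass into the mass up to \<open>t\<close>,
  the term \<open>lam * t\<close> cancels, and reflecting the integration variable leaves
  \<open>Gam t\<close>.\<close>

lemma fluid_psi_minus_H:
  assumes fluid: "fluid lam mu F0 (measure Q0 {0..}) G (\<lambda>x. measure Q0 {0..x})"
    and Q0: "Q0 \<in> finite_borel_measures" and "0 \<le> t"
  shows "fluid_psi lam mu Q0 t - fluid_H lam G Q0 0 t = fluid.expired lam G (\<lambda>x. measure Q0 {0..x}) t - mu * t"
proof -
  interpret fluid lam mu F0 "measure Q0 {0..}" G "\<lambda>x. measure Q0 {0..x}" by (rule fluid)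
  interpret Q0: finite_measure Q0 using finite_borel_measures_sets(1)[OF Q0] .
  note sets = finite_borel_measures_sets(3)[OF Q0]
  have "{0..} = {0..t} \<union> {t<..}" using \<open>0 \<le> t\<close> by auto
  moreover have "measure Q0 ({0..t} \<union> {t<..}) = measure Q0 {0..t} + measure Q0 {t<..}"
    using \<open>0 \<le> t\<close> by (intro Q0.finite_measure_Union sets) auto
  ultimately have mass: "measure Q0 {0..} = measure Q0 {0..t} + measure Q0 {t<..}" by simp
  have "(G has_integral Gam t) (cbox 0 t)"
    using integrable_integral[OF G_integrable[of 0 t]] by (simp add: Gam_def)
  from has_integral_affinity[OF this, of "-1" t]
  have "((\<lambda>s. G (t - s)) has_integral Gam t) ((\<lambda>x. t - x) ` {0..t})"
    by simp
  moreover have "(\<lambda>x. t - x) ` {0..t} = {0..t}"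
    by (simp add: image_diff_atLeastAtMost)
  ultimately have G': "((\<lambda>s. G (t - s)) has_integral Gam t) {0..t}" by simp
  have "((\<lambda>s. 1 - G (t - s)) has_integral (t - Gam t)) {0..t}"
    using has_integral_diff[OF has_integral_const_real[of 1 0 t] G'] \<open>0 \<le> t\<close> by simp
  then have I: "integral {0..t} (\<lambda>s. 1 - G (t - s)) = t - Gam t" by (rule integral_unique)
  show ?thesis
    unfolding fluid_psi_def fluid_H_def expired_def mass add_0 I by (simp add: algebra_simps)
qed

lemma fluid_eta_eq:
  assumes "fluid lam mu F0 (measure Q0 {0..}) G (\<lambda>x. measure Q0 {0..x})" "Q0 \<in> finite_borel_measures"
  shows "fluid_eta lam mu G Q0 t = fluid.eta lam mu G (\<lambda>x. measure Q0 {0..x}) t"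
  unfolding fluid_eta_def fluid.eta_def[OF assms(1)]
  using fluid_psi_minus_H[OF assms] by (intro SUP_cong) auto

lemma continuous_imp_rcll:
  assumes "continuous_on {0..} f"
  shows "f \<in> rcll"
proof -
  have "(f \<longlongrightarrow> f t) (at_right t) \<and> (t > 0 \<longrightarrow> (\<exists>l. (f \<longlongrightarrow> l) (at_left t)))" if t: "0 \<le> t" for t
  proof (intro conjI impI)
    have lim: "(f \<longlongrightarrow> f t) (at t within {0..})" using assms t by (auto simp: continuous_on_def)
    then show "(f \<longlongrightarrow> f t) (at_right t)" by (rule tendsto_within_subset) (use t in auto)
    assume "0 < t"
    have "(f \<longlongrightarrow> f t) (at t)"
      using lim \<open>0 < t\<close> at_within_interior[of t "{0..}"] by simp
    then have "(f \<longlongrightarrow> f t) (at_left t)" by (rule tendsto_within_subset) simp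
    then show "\<exists>l. (f \<longlongrightarrow> l) (at_left t)" ..
  qed
  then show ?thesis by (simp add: rcll_def)
qed

section \<open>Renewal sums in probability and along single paths\<close>

lemma floor_scale_tendsto:
  assumes "0 < q"
  shows "(\<lambda>N. real (ticks q N) / real N) \<longlonglongrightarrow> q"
proof (rule tendsto_sandwich)
  have "(\<lambda>N. q - 1 / real N) \<longlonglongrightarrow> q - 0" by (intro tendsto_intros lim_1_over_n)
  then show "(\<lambda>N. q - 1 / real N) \<longlonglongrightarrow> q" by simp
  show "\<forall>\<^sub>F N in sequentially. q - 1 / real N \<le> real (ticks q N) / real N"
  proof (rule eventually_sequentiallyI)
    fix N :: nat assume "1 \<le> N"
    have "q * real N - 1 \<le> real (ticks q N)" by linarith
    then have "(q * real N - 1) / real N \<le> real (ticks q N) / real N" by (intro divide_right_mono) auto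
    then show "q - 1 / real N \<le> real (ticks q N) / real N" using \<open>1 \<le> N\<close> by (simp add: diff_divide_distrib)
  qed
  show "\<forall>\<^sub>F N in sequentially. real (ticks q N) / real N \<le> q"
  proof (rule eventually_sequentiallyI)
    fix N :: nat assume "1 \<le> N"
    have "0 \<le> q * real N" using assms by simp
    then have "real (ticks q N) \<le> q * real N" by linarith
    then show "real (ticks q N) / real N \<le> q" using \<open>1 \<le> N\<close> by (simp add: divide_le_eq)
  qed
qed auto

lemma (in prob_space) tendsto_min_L1:
  fixes Z :: "nat \<Rightarrow> 'a \<Rightarrow> real"
  assumes "\<And>N. N > 0 \<Longrightarrow> integrable M (Z N)" "(\<lambda>N. \<integral>\<omega>. \<bar>Z N \<omega>\<bar> \<partial>M) \<longlonglongrightarrow> 0"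
  shows "null_in_prob Z"
proof (rule tendsto_sandwich[OF _ _ tendsto_const assms(2)])
  show "\<forall>\<^sub>F N in sequentially. 0 \<le> (\<integral>\<omega>. min 1 \<bar>Z N \<omega>\<bar> \<partial>M)"
    by (intro always_eventually allI integral_nonneg_AE) auto
  show "\<forall>\<^sub>F N in sequentially. (\<integral>\<omega>. min 1 \<bar>Z N \<omega>\<bar> \<partial>M) \<le> (\<integral>\<omega>. \<bar>Z N \<omega>\<bar> \<partial>M)"
  proof (rule eventually_sequentiallyI)
    fix N :: nat assume "1 \<le> N"
    then have i: "integrable M (Z N)" using assms(1) by simp
    then have [measurable]: "Z N \<in> borel_measurable M" by auto
    show "(\<integral>\<omega>. min 1 \<bar>Z N \<omega>\<bar> \<partial>M) \<le> (\<integral>\<omega>. \<bar>Z N \<omega>\<bar> \<partial>M)"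
    proof (rule integral_mono)
      show "integrable M (\<lambda>\<omega>. min 1 \<bar>Z N \<omega>\<bar>)" by (rule integrable_const_bound[of _ 1]) auto
    qed (use i in auto)
  qed
qed

lemma (in prob_space) renewal_sums_L1:
  assumes T: "renewal_sequence M T" and "0 < q"
  shows "(\<lambda>\<omega>. (\<Sum>k<ticks q N. T k \<omega>) / real N - q) \<in> borel_measurable M"
    and "null_in_prob (\<lambda>N \<omega>. (\<Sum>k<ticks q N. T k \<omega>) / real N - q)"
proof -
  have ind: "indep_vars (\<lambda>_. borel) T UNIV" and d: "\<And>k. distr M borel (T k) = distr M borel (T 0)"
    and i0: "integrable M (T 0)" and mean: "expectation (T 0) = 1"
    using T by (auto simp: renewal_sequence_def)
  have m[measurable]: "T k \<in> borel_measurable M" for k using ind by (auto simp: indep_vars_def)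
  show "(\<lambda>\<omega>. (\<Sum>k<ticks q N. T k \<omega>) / real N - q) \<in> borel_measurable M" for N by measurable
  have int: "integrable M (T k)" for k by (rule integrable_distr_cong[OF i0 m d])
  show "null_in_prob (\<lambda>N \<omega>. (\<Sum>k<ticks q N. T k \<omega>) / real N - q)"
  proof (rule tendsto_min_L1)
    show "integrable M (\<lambda>\<omega>. (\<Sum>k<ticks q N. T k \<omega>) / real N - q)" for N
      by (intro Bochner_Integration.integrable_diff integrable_divide_zero
          Bochner_Integration.integrable_sum int) simp_all
  qed (rule weak_law_L1[OF ind d i0 mean floor_scale_tendsto[OF \<open>0 < q\<close>]])
qed

lemma renewal_count_mono:
  fixes T :: "nat \<Rightarrow> real"
  assumes "\<And>k. 0 < T k" "\<And>t. \<exists>n. t < (\<Sum>k<n. T k)" "s \<le> t"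
  shows "renewal_count T s \<le> renewal_count T t"
  using renewal_count_ge_iff[OF assms(1,2), of "renewal_count T s" s]
    renewal_count_ge_iff[OF assms(1,2), of "renewal_count T s" t] assms(3) by auto

lemma renewal_count_0:
  fixes T :: "nat \<Rightarrow> real"
  assumes "\<And>k. 0 < T k" "\<And>t. \<exists>n. t < (\<Sum>k<n. T k)"
  shows "renewal_count T 0 = 0"
proof -
  have "\<not> 1 \<le> renewal_count T 0"
    using renewal_count_ge_iff[OF assms, of 1 0] assms(1)[of 0] by simp
  then show ?thesis by simp
qed

text \<open>Divergence is read off the law of large numbers on the same path: an average near 1 at
  growing scales forces large partial sums.\<close>

lemma renewal_sums_unbounded:
  fixes T :: "nat \<Rightarrow> real" and N :: "nat \<Rightarrow> nat"
  assumes "filterlim (\<lambda>j. real (N j)) at_top sequentially"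
    and "(\<lambda>j. (\<Sum>k<n j. T k) / real (N j)) \<longlonglongrightarrow> 1"
  shows "\<exists>n. t < (\<Sum>k<n. T k)"
proof -
  have "\<forall>\<^sub>F j in sequentially. 1/2 < (\<Sum>k<n j. T k) / real (N j)"
    using order_tendstoD(1)[OF assms(2), of "1/2"] by simp
  moreover have "\<forall>\<^sub>F j in sequentially. max 0 (2 * t) < real (N j)"
    using assms(1) unfolding filterlim_at_top_dense by blast
  ultimately have "\<forall>\<^sub>F j in sequentially. t < (\<Sum>k<n j. T k)"
  proof eventually_elim
    case (elim j)
    then have "real (N j) / 2 < (\<Sum>k<n j. T k)" by (simp add: less_divide_eq)
    then show ?case using elim(2) by simp
  qed
  then show ?thesis by (auto simp: eventually_sequentially)
qed

theorem theorem1: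
  fixes M :: "'w measure"
    and lamN muN :: "nat \<Rightarrow> real"
    and nuN :: "nat \<Rightarrow> real measure"
    and A V :: "nat \<Rightarrow> 'w \<Rightarrow> real"
    and X Q R :: "nat \<Rightarrow> 'w \<Rightarrow> real \<Rightarrow> nat"
    and a u :: "nat \<Rightarrow> 'w \<Rightarrow> int \<Rightarrow> real"
    and b :: "nat \<Rightarrow> 'w \<Rightarrow> int \<Rightarrow> ereal"
    and lam mu F0 :: real
    and nu Q0 :: "real measure"
    and G :: "real \<Rightarrow> real"
  assumes model: "edf_queues M lamN muN nuN A V X Q R a u b"
    and lam_lim: "(\<lambda>N. lamN N / real N) \<longlonglongrightarrow> lam" and lam_pos: "lam > 0"
    and mu_lim: "(\<lambda>N. muN N / real N) \<longlonglongrightarrow> mu" and mu_pos: "mu > 0"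
    and nu: "real_distribution nu" and G: "G = cdf nu"
    and lead_lim: "weak_conv_m nuN nu"
    and G_strict: "strict_mono_on {x. 0 < x \<and> ereal x < y_max G} G"
    and G_cont_0: "isCont G 0" and G_0: "G 0 = 0"
    and G_cont_ystar: "\<And>y. lam > mu \<Longrightarrow> ereal y = y_star lam mu G \<Longrightarrow> isCont G y"
    and Q0: "Q0 \<in> finite_borel_measures"
    and F0: "0 \<le> F0" "ereal F0 \<le> y_star lam mu G"
    and Q0_zero: "measure Q0 {0..F0} = 0"
    and G0_cont: "continuous_on {0..} (\<lambda>x. measure Q0 {0..x})"
    and Q0_pos: "\<And>x. x > F0 \<Longrightarrow> measure Q0 {0..x} > 0"
    and initial_lim: "converges_in_distribution M (prod_topology weak_topology euclideanreal)
       (\<lambda>N \<omega>. (scale_measure (ennreal (1 / real N))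
                  (queue_measure (X N \<omega> 0) (a N \<omega>) (u N \<omega>) (b N \<omega>) 0),
                head_lead_time (X N \<omega> 0) (a N \<omega>) (u N \<omega>) (b N \<omega>) 0))
       (\<lambda>\<omega>. (Q0, F0))"
    and lam_ge_mu: "lam \<ge> mu"
  shows "converges_in_distribution M skorohod_topology
       (\<lambda>N \<omega> t. (real (Q N \<omega> t) / real N, real (R N \<omega> t) / real N))
       (\<lambda>\<omega> t. (fluid_phi lam mu G Q0 t, fluid_eta lam mu G Q0 t))"
proof -
  interpret edf_queues M lamN muN nuN A V X Q R a u b by (rule model)
  let ?G0 = "\<lambda>x. measure Q0 {0..x}" and ?q0 = "measure Q0 {0..}"
  have fl: "fluid lam mu F0 ?q0 G ?G0"
    by (rule fluid_instance[OF mu_pos lam_ge_mu nu G G_strict G_cont_0 G_0 Q0 F0 Q0_zero G0_cont Q0_pos])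
  interpret fl: fluid lam mu F0 ?q0 G ?G0 by (rule fl)
  have eta: "fluid_eta lam mu G Q0 t = fl.eta t" for t by (rule fluid_eta_eq[OF fl Q0])
  have phi: "fluid_phi lam mu G Q0 t = fl.phi t" for t
    by (simp add: fluid_phi_def fluid_psi_def fl.phi_def eta)
  define path where "path N \<omega> t = (real (Q N \<omega> t) / real N, real (R N \<omega> t) / real N)" for N \<omega> t
  define limit where "limit t = (fl.phi t, fl.eta t)" for t
  define m where "m N \<omega> = scale_measure (ennreal (1 / real N))
      (queue_measure (X N \<omega> 0) (a N \<omega>) (u N \<omega>) (b N \<omega>) 0)" for N \<omega>
  have path_meas: "path N \<in> M \<rightarrow>\<^sub>M borel_of skorohod_topology" if N: "N > 0" for N
  proof (rule measurable_skorohod_compose[OF random_paths[OF N]])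
    \<comment> \<open>Taking the positive part of \<open>X - 1\<close> and dividing by
      \<open>N \<ge> 1\<close> does not increase distances.\<close>
    let ?h = "\<lambda>p :: real \<times> real. (max 0 (fst p - 1) / real N, snd p / real N)"
    show "dist (?h p) (?h q) \<le> dist p q" for p q
    proof -
      have "dist (max 0 (fst p - 1) / real N) (max 0 (fst q - 1) / real N) \<le> dist (fst p) (fst q)"
      proof -
        have "\<bar>max 0 (fst p - 1) - max 0 (fst q - 1)\<bar> / real N \<le> \<bar>fst p - fst q\<bar> / 1"
          using N by (intro frac_le) auto
        then show ?thesis by (simp add: dist_real_def flip: diff_divide_distrib)
      qed
      moreover have "dist (snd p / real N) (snd q / real N) \<le> dist (snd p) (snd q)"
      proof -
        have "\<bar>snd p - snd q\<bar> / real N \<le> \<bar>snd p - snd q\<bar> / 1"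
          using N by (intro frac_le) auto
        then show ?thesis by (simp add: dist_real_def flip: diff_divide_distrib)
      qed
      ultimately show ?thesis
        unfolding dist_prod_def by (intro real_sqrt_le_mono add_mono power_mono) auto
    qed
    show "path N \<omega> t = ?h (real (X N \<omega> t), real (R N \<omega> t))" if "\<omega> \<in> space M" "0 \<le> t" for \<omega> t
      using queue_eq[OF N that] by (cases "X N \<omega> t") (simp_all add: path_def)
  qed
  have limit_rcll: "limit \<in> rcll"
    unfolding limit_def fl.phi_def
    by (intro continuous_imp_rcll continuous_intros fl.eta_cont)
  obtain D where D: "countable D" "\<And>x. x \<in> D \<Longrightarrow> isCont G x" "\<And>x y. x < y \<Longrightarrow> \<exists>z\<in>D. x < z \<and> z < y"
    using countable_dense_continuity_points[OF fl.G_mono] by blast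
  define ZT where "ZT T q N \<omega> = (\<Sum>k<ticks q N. T k \<omega>) / real N - q"
    for T :: "nat \<Rightarrow> 'w \<Rightarrow> real" and q N \<omega>
  define ZU where "ZU q x N \<omega> = ncard {i. 1 \<le> i \<and> i \<le> int (ticks q N) \<and> u N \<omega> i \<le> x} / real N - q * G x"
    for q x N \<omega>
  define ZI where "ZI f N \<omega> = (\<integral>x. f x \<partial>m N \<omega>) - (\<integral>x. f x \<partial>Q0)" for f :: "real \<Rightarrow> real" and N \<omega>
  define P where "P = {q \<in> \<rat>. (0::real) < q}"
  \<comment> \<open>The constant 1 yields the total queue at time 0, the ramps its distribution over
    deadlines.\<close>
  define tests where "tests = insert (\<lambda>_. 1) ((\<lambda>(p, q). ramp p q) ` {(p, q). p \<in> \<rat> \<and> q \<in> \<rat> \<and> p < q})"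
  \<comment> \<open>All convergence needed on a path is collected in one countable family: sums of
    both renewal sequences, counts of short lead times, and integrals of test functions against the
    initial queue.\<close>
  define F where "F = ZT A ` P \<union> ZT V ` P \<union> (\<lambda>(q, x). ZU q x) ` (P \<times> D) \<union> ZI ` tests"
  have "countable P" unfolding P_def using countable_rat by (rule countable_subset[rotated]) auto
  moreover have "countable tests"
    unfolding tests_def
    by (intro countable_insert countable_image countable_subset[OF _ countable_SIGMA[OF countable_rat countable_rat]]) auto
  ultimately have F_countable: "countable F" unfolding F_def using D(1) by auto
  have tests: "continuous_on {0..} f" "bounded (f ` {0..})" "\<And>x. 0 \<le> f x" if "f \<in> tests" for f
    using that ramp_continuous ramp_bounded ramp_bounds(1) by (auto simp: tests_def intro: boundedI[of _ 1])
  have leads: "(\<lambda>N. cdf (nuN N) x) \<longlonglongrightarrow> G x" if "x \<in> D" for x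
    using lead_lim D(2)[OF that] by (simp add: weak_conv_m_def weak_conv_def G)
  have Z: "(N > 0 \<longrightarrow> Z N \<in> borel_measurable M) \<and> null_in_prob Z"
    if "Z \<in> F" for Z N
  proof -
    have "(N > 0 \<longrightarrow> ZU q x N \<in> borel_measurable M) \<and> null_in_prob (ZU q x)"
      if "0 < q" "x \<in> D" for q x
    proof -
      have L1: "(\<lambda>N. \<integral>\<omega>. \<bar>ZU q x N \<omega>\<bar> \<partial>M) \<longlonglongrightarrow> 0"
        unfolding ZU_def
        by (rule lead_count_L1(1)[OF lead_times_indep lead_times_law floor_scale_tendsto[OF that(1)] leads[OF that(2)]])
      have meas: "ZU q x N \<in> borel_measurable M" if N: "N > 0" for N
      proof -
        have "(\<lambda>\<omega>. ncard {i. 1 \<le> i \<and> i \<le> int (ticks q N) \<and> u N \<omega> i \<le> x}) \<in> borel_measurable M"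
          by (rule lead_count_L1(2)[OF lead_times_indep lead_times_law
                floor_scale_tendsto[OF \<open>0 < q\<close>] leads[OF \<open>x \<in> D\<close>]]) (use N in auto)
        then show ?thesis unfolding ZU_def[abs_def] by measurable
      qed
      have "integrable M (ZU q x N)" if "N > 0" for N
      proof (rule integrable_const_bound[OF _ meas[OF that]])
        show "AE \<omega> in M. norm (ZU q x N \<omega>) \<le> real (ticks q N) + \<bar>q * G x\<bar>"
        proof (rule AE_I2)
          fix \<omega>
          have "card {i. 1 \<le> i \<and> i \<le> int (ticks q N) \<and> u N \<omega> i \<le> x} \<le> card {1..int (ticks q N)}"
            by (intro card_mono) auto
          then have "ncard {i. 1 \<le> i \<and> i \<le> int (ticks q N) \<and> u N \<omega> i \<le> x} / real N \<le> real (ticks q N) / 1"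
            using \<open>N > 0\<close> by (intro frac_le) auto
          then show "norm (ZU q x N \<omega>) \<le> real (ticks q N) + \<bar>q * G x\<bar>"
            unfolding ZU_def real_norm_def
            by (intro order_trans[OF abs_triangle_ineq4]) auto
        qed
      qed
      then have "null_in_prob (ZU q x)"
        using L1 by (intro tendsto_min_L1)
      then show ?thesis using meas by blast
    qed
    moreover have "(N > 0 \<longrightarrow> ZT T q N \<in> borel_measurable M) \<and> null_in_prob (ZT T q)"
      if "renewal_sequence M T" "0 < q" for T q
      using renewal_sums_L1[OF that] by (simp add: ZT_def[abs_def])
    moreover have "(N > 0 \<longrightarrow> ZI f N \<in> borel_measurable M) \<and> null_in_prob (ZI f)"
      if "f \<in> tests" for f
      using converges_in_distribution_integral[OF initial_lim tests(1,2)[OF that]]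
      by (auto simp: ZI_def[abs_def] m_def[symmetric])
    ultimately show ?thesis
      using that arrival_renewals service_renewals unfolding F_def P_def by auto
  qed
  have sub: "\<exists>s. strict_mono s \<and> (\<forall>j. 0 < r (s j)) \<and>
      (AE \<omega> in M. \<forall>f. continuous_map skorohod_topology euclideanreal f \<longrightarrow>
        (\<lambda>j. f (path (r (s j)) \<omega>)) \<longlonglongrightarrow> f limit)"
    if r: "strict_mono r" for r :: "nat \<Rightarrow> nat"
  proof -
    obtain s where s: "strict_mono s" "\<And>j. 0 < r (s j)"
      and Z_lim: "AE \<omega> in M. \<forall>Z\<in>F. (\<lambda>j. Z (r (s j)) \<omega>) \<longlonglongrightarrow> 0"
      using AE_subsequence[OF F_countable _ _ r] Z by blast
    define N where "N j = r (s j)" for j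
    have N_pos: "0 < N j" for j using s by (simp add: N_def)
    have "strict_mono N" using r s by (auto simp: N_def strict_mono_def)
    then have N_sub: "filterlim N sequentially sequentially" by (rule filterlim_subseq)
    then have N_top: "filterlim (\<lambda>j. real (N j)) at_top sequentially"
      by (rule filterlim_compose[OF filterlim_real_sequentially])
    have dyn: "AE \<omega> in M. \<forall>j. edf_path (\<lambda>t. renewal_count (\<lambda>k. A k \<omega>) (lamN (N j) * t))
        (\<lambda>t. renewal_count (\<lambda>k. V k \<omega>) (muN (N j) * t))
        (X (N j) \<omega>) (R (N j) \<omega>) (a (N j) \<omega>) (u (N j) \<omega>) (b (N j) \<omega>)"
      using dynamics[OF N_pos] by (simp add: AE_all_countable)
    have posA: "AE \<omega> in M. \<forall>k. A k \<omega> > 0" and posV: "AE \<omega> in M. \<forall>k. V k \<omega> > 0"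
      using arrival_renewals service_renewals by (auto simp: renewal_sequence_def)
    have "AE \<omega> in M. \<forall>f. continuous_map skorohod_topology euclideanreal f \<longrightarrow>
        (\<lambda>j. f (path (N j) \<omega>)) \<longlonglongrightarrow> f limit"
      using Z_lim dyn posA posV AE_space
    proof eventually_elim
      case (elim \<omega>)
      have Z0: "(\<lambda>j. Z (N j) \<omega>) \<longlonglongrightarrow> 0" if "Z \<in> F" for Z using elim(1) that by (simp add: N_def)
      have sumA: "(\<lambda>j. (\<Sum>k<ticks q (N j). A k \<omega>) / real (N j)) \<longlonglongrightarrow> q"
        and sumV: "(\<lambda>j. (\<Sum>k<ticks q (N j). V k \<omega>) / real (N j)) \<longlonglongrightarrow> q"
        if "q \<in> \<rat>" "0 < q" for q
      proof -
        have "ZT A q \<in> F" "ZT V q \<in> F" using that by (auto simp: F_def P_def)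
        then show "(\<lambda>j. (\<Sum>k<ticks q (N j). A k \<omega>) / real (N j)) \<longlonglongrightarrow> q"
          "(\<lambda>j. (\<Sum>k<ticks q (N j). V k \<omega>) / real (N j)) \<longlonglongrightarrow> q"
          using Z0 unfolding ZT_def by (blast intro: LIM_zero_cancel)+
      qed
      have A_pos: "0 < A k \<omega>" and V_pos: "0 < V k \<omega>" for k using elim by auto
      have A_unb: "\<exists>n. t < (\<Sum>k<n. A k \<omega>)" and V_unb: "\<exists>n. t < (\<Sum>k<n. V k \<omega>)" for t
        using renewal_sums_unbounded[OF N_top sumA[of 1]] renewal_sums_unbounded[OF N_top sumV[of 1]] by auto
      have rates: "(\<lambda>j. lamN (N j) / real (N j)) \<longlonglongrightarrow> lam" "(\<lambda>j. muN (N j) / real (N j)) \<longlonglongrightarrow> mu"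
        using filterlim_compose[OF lam_lim N_sub] filterlim_compose[OF mu_lim N_sub] by auto
      have rate_pos: "0 < lamN (N j)" "0 < muN (N j)" for j using rates_pos[OF N_pos] by auto
      note run = elim(2)[rule_format]
      define Q0N where "Q0N j = queued (X (N j) \<omega> 0) (a (N j) \<omega>) (u (N j) \<omega>) (b (N j) \<omega>) 0" for j
      have queue0: "finite (Q0N j)"
        "card (Q0N j) = X (N j) \<omega> 0 - 1" for j
        using edf_path.queue_length[OF run, of 0 j] by (auto simp: Q0N_def)
      have test_lim: "(\<lambda>j. (\<Sum>i\<in>Q0N j.
          f (lead_time (a (N j) \<omega>) (u (N j) \<omega>) i 0)) / real (N j)) \<longlonglongrightarrow> (\<integral>x. f x \<partial>Q0)" if "f \<in> tests" for f
      proof -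
        have "ZI f \<in> F" using that by (simp add: F_def)
        then have "(\<lambda>j. \<integral>x. f x \<partial>m (N j) \<omega>) \<longlonglongrightarrow> (\<integral>x. f x \<partial>Q0)"
          using Z0 unfolding ZI_def by (blast intro: LIM_zero_cancel)
        then show ?thesis
          unfolding m_def Q0N_def
          using integral_scaled_queue_measure[OF queue0(1)[unfolded Q0N_def] tests(1,3)[OF that]] by simp
      qed
      have "\<forall>\<^sub>F j in sequentially. \<forall>t\<in>{0..T}. dist (path (N j) \<omega> t) (limit t) < e"
        if T: "0 < T" and e: "0 < e" for T e
      proof -
        have "\<forall>\<^sub>F j in sequentially. \<forall>t\<in>{0..T}.
            \<bar>real (R (N j) \<omega> t) / real (N j) - fl.eta t\<bar> \<le> e / 4 \<and>
            \<bar>real (X (N j) \<omega> t - 1) / real (N j) - fl.phi t\<bar> \<le> e / 4"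
        proof (rule fl.fluid_limit[OF N_top D(3) run, folded Q0N_def])
          show "renewal_count (\<lambda>k. A k \<omega>) (lamN (N j) * s) \<le> renewal_count (\<lambda>k. A k \<omega>) (lamN (N j) * t)"
            "renewal_count (\<lambda>k. V k \<omega>) (muN (N j) * s) \<le> renewal_count (\<lambda>k. V k \<omega>) (muN (N j) * t)"
            if "s \<le> t" for j s t
            using that rate_pos[of j] A_pos A_unb V_pos V_unb
            by (auto intro!: renewal_count_mono mult_left_mono)
          show "renewal_count (\<lambda>k. A k \<omega>) (lamN (N j) * 0) = 0" for j
            using renewal_count_0[OF A_pos A_unb] by simp
          show "a (N j) \<omega> i \<le> t \<longleftrightarrow> i \<le> int (renewal_count (\<lambda>k. A k \<omega>) (lamN (N j) * t))"
            if "1 \<le> i" for j i t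
            by (rule renewal_arrival_iff[OF A_pos A_unb rate_pos(1) edf_path.arrival[OF run that] that])
          show "(\<lambda>j. real (renewal_count (\<lambda>k. A k \<omega>) (lamN (N j) * t)) / real (N j)) \<longlonglongrightarrow> lam * t" if "0 \<le> t" for t
            by (rule renewal_count_limit[OF A_pos A_unb N_top N_pos rates(1) sumA that lam_pos])
          show "(\<lambda>j. real (renewal_count (\<lambda>k. V k \<omega>) (muN (N j) * t)) / real (N j)) \<longlonglongrightarrow> mu * t" if "0 \<le> t" for t
            by (rule renewal_count_limit[OF V_pos V_unb N_top N_pos rates(2) sumV that mu_pos])
          show "(\<lambda>j. ncard {i. 1 \<le> i \<and> i \<le> \<lfloor>q * real (N j)\<rfloor> \<and> u (N j) \<omega> i \<le> x} / real (N j)) \<longlonglongrightarrow> q * G x"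
            if "q \<in> \<rat>" "0 < q" "x \<in> D" for q x
          proof -
            have "ZU q x \<in> F" using that by (auto simp: F_def P_def)
            moreover have "int (ticks q (N j)) = \<lfloor>q * real (N j)\<rfloor>" for j
              using \<open>0 < q\<close> by simp
            ultimately show ?thesis
              using Z0[of "ZU q x"] unfolding ZU_def by (auto intro: LIM_zero_cancel)
          qed
          show "(\<lambda>j. ncard {i \<in> Q0N j.
              a (N j) \<omega> i + u (N j) \<omega> i \<le> x} / real (N j)) \<longlonglongrightarrow> ?G0 x" if "0 \<le> x" for x
          proof -
            have "(\<lambda>j. ncard {i \<in> Q0N j.
                lead_time (a (N j) \<omega>) (u (N j) \<omega>) i 0 \<le> x} / real (N j)) \<longlonglongrightarrow> ?G0 x"
            proof (rule initial_count_limit[OF Q0 G0_cont fl.G0_0 queue0(1)])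
              show "(\<lambda>j. (\<Sum>i\<in>Q0N j.
                ramp p q (lead_time (a (N j) \<omega>) (u (N j) \<omega>) i 0)) / real (N j)) \<longlonglongrightarrow> (\<integral>x. ramp p q x \<partial>Q0)"
                if "p \<in> \<rat>" "q \<in> \<rat>" "p < q" for p q
                using that by (intro test_lim) (auto simp: tests_def)
            qed (use N_pos that in \<open>auto simp: Q0N_def queued_def\<close>)
            then show ?thesis by (simp add: lead_time_def add.commute)
          qed
          show "(\<lambda>j. real (X (N j) \<omega> 0) / real (N j)) \<longlonglongrightarrow> ?q0"
          \<comment> \<open>The queue misses at most the customer in service, whose weight
            \<open>1 / real (N j)\<close> vanishes.\<close>
          proof (rule tendsto_sandwich)
            have "(\<integral>x. 1 \<partial>Q0) = ?q0"
              using finite_borel_measures_sets(2)[OF Q0] by simp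
            then have l: "(\<lambda>j. real (X (N j) \<omega> 0 - 1) / real (N j)) \<longlonglongrightarrow> ?q0"
              using test_lim[of "\<lambda>_. 1"] by (simp add: tests_def queue0(2))
            then show "(\<lambda>j. real (X (N j) \<omega> 0 - 1) / real (N j)) \<longlonglongrightarrow> ?q0" .
            have "(\<lambda>j. 1 / real (N j)) \<longlonglongrightarrow> 0" by (rule filterlim_compose[OF lim_1_over_n N_sub])
            from tendsto_add[OF l this]
            show "(\<lambda>j. real (X (N j) \<omega> 0 - 1) / real (N j) + 1 / real (N j)) \<longlonglongrightarrow> ?q0" by simp
            show "\<forall>\<^sub>F j in sequentially. real (X (N j) \<omega> 0 - 1) / real (N j) \<le> real (X (N j) \<omega> 0) / real (N j)"
              by (intro always_eventually allI divide_right_mono) auto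
            show "\<forall>\<^sub>F j in sequentially. real (X (N j) \<omega> 0) / real (N j) \<le> real (X (N j) \<omega> 0 - 1) / real (N j) + 1 / real (N j)"
              unfolding add_divide_distrib[symmetric]
              by (intro always_eventually allI divide_right_mono) auto
          qed
          show "\<exists>h>0. \<forall>s. t \<le> s \<and> s < t + h \<longrightarrow> 0 < X (N j) \<omega> s" if t: "0 \<le> t" "0 < X (N j) \<omega> t" for j t
          proof -
            \<comment> \<open>Right-continuity is part of being a random element of the Skorohod
              space, and positivity of a coordinate is an open condition.\<close>
            have "(\<lambda>t. (real (X (N j) \<omega> t), real (R (N j) \<omega> t))) \<in> rcll"
              using measurable_space[OF random_paths[OF N_pos] elim(5)] by (simp add: topspace_skorohod_topology)
            then have "((\<lambda>t. (real (X (N j) \<omega> t), real (R (N j) \<omega> t))) \<longlongrightarrow> (real (X (N j) \<omega> t), real (R (N j) \<omega> t))) (at_right t)"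
              using t by (simp add: rcll_def)
            from tendsto_fst[OF this] have "((\<lambda>s. real (X (N j) \<omega> s)) \<longlongrightarrow> real (X (N j) \<omega> t)) (at_right t)" by simp
            then have "\<forall>\<^sub>F s in at_right t. 0 < real (X (N j) \<omega> s)" using t(2) by (intro order_tendstoD(1)) auto
            then obtain c where c: "c > t" "\<And>s. t < s \<Longrightarrow> s < c \<Longrightarrow> 0 < X (N j) \<omega> s"
              by (auto simp: eventually_at_right_field)
            then show ?thesis
              using t(2) by (intro exI[of _ "c - t"]) (auto simp: le_less)
          qed
        qed (use T e in auto)
        then show ?thesis
        proof eventually_elim
          case close: (elim j)
          show ?case
          proof
            fix t assume t: "t \<in> {0..T}"
            have "Q (N j) \<omega> t = X (N j) \<omega> t - 1" using queue_eq[OF N_pos elim(5)] t by simp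
            then have "dist (path (N j) \<omega> t) (limit t) \<le>
                \<bar>real (X (N j) \<omega> t - 1) / real (N j) - fl.phi t\<bar> + \<bar>real (R (N j) \<omega> t) / real (N j) - fl.eta t\<bar>"
              unfolding path_def limit_def dist_prod_def
              using sqrt_sum_squares_le_sum_abs by (simp add: dist_real_def)
            also have "\<dots> \<le> e / 4 + e / 4" using close t by (intro add_mono) auto
            also have "\<dots> < e" using e by simp
            finally show "dist (path (N j) \<omega> t) (limit t) < e" .
          qed
        qed
      qed
      moreover have "path (N j) \<omega> \<in> rcll" for j
        using measurable_space[OF path_meas[OF N_pos] elim(5)] by (simp add: topspace_skorohod_topology)
      ultimately show ?case
        using skorohod_continuous_map_uniform_limit[OF _ limit_rcll, of _ "\<lambda>j. path (N j) \<omega>" sequentially] by blast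
    qed
    then show ?thesis using s unfolding N_def by blast
  qed
  have "converges_in_distribution M skorohod_topology path (\<lambda>_. limit)"
    by (rule converges_in_distribution_constI[OF path_meas _ sub])
      (simp_all add: limit_rcll topspace_skorohod_topology)
  then show ?thesis
    by (simp add: path_def[abs_def] limit_def[abs_def] phi eta)
qed

end
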